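(* For every $\tau\in\mathbb{H}^2$ set $$f(\tau)=\frac{\eta^4(2\tau)\,\eta^8(3\tau)}{\eta^8(\tau)\,\eta^4(6\tau)} .$$ Then the inverse function $\tau=\tau(f)$ yields $l(f)=a(\tau(f))$, and $l(f)$ satisfies the differential equation $$\frac{d^2l}{df^2}+\left\{\frac1f+\frac{1}{f-1}-\frac{2}{f-\frac13}+\frac{1}{f-\frac19}\right\}\frac{dl}{df}-\frac{8}{27(f-1)\left(f-\frac19\right)\left(f-\frac13\right)^2}\,l=0 .$$
   Context: $\mathbb{H}^2=\{\tau\in\mathbb{C}\mid \Im\tau>0\}$; $\eta(\tau)=e^{2\pi i\tau/24}\prod_{n\ge1}(1-e^{2\pi i n\tau})$ is the Dedekind eta function and $\eta^k(m\tau)=(\eta(m\tau))^k$. The cubic theta function $a$ is $a(\tau)=\sum_{m,n\in\mathbb{Z}}q^{m^2+mn+n^2}$, $q=\exp(2\pi i\tau)$. The inverse function $\tau=\tau(f)$ means any local holomorphic inverse of $\tau\mapsto f(\tau)$; the differential equation is understood where its coefficients are finite. *)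

theory Defs
  imports "HOL-Analysis.Analysis" "HOL-Complex_Analysis.Complex_Analysis"
begin

definition upper_half_plane :: "complex set" where
  "upper_half_plane = {\<tau>. Im \<tau> > 0}"

text \<open>The product over \<open>n \<ge> 1\<close> is indexed from \<open>0\<close> here, hence the factor \<open>Suc n\<close>.\<close>

definition dedekind_eta :: "complex \<Rightarrow> complex" where
  "dedekind_eta \<tau> = exp (2 * of_real pi * \<i> * \<tau> / 24) *
     (\<Prod>n. 1 - exp (2 * of_real pi * \<i> * of_nat (Suc n) * \<tau>))"

definition cubic_theta_a :: "complex \<Rightarrow> complex" where
  "cubic_theta_a \<tau> =
     (\<Sum>\<^sub>\<infinity>(m, n)\<in>(UNIV :: (int \<times> int) set).
        exp (2 * of_real pi * \<i> * \<tau>) powi (m^2 + m * n + n^2))"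

definition hauptmodul_f :: "complex \<Rightarrow> complex" where
  "hauptmodul_f \<tau> =
     dedekind_eta (2 * \<tau>) ^ 4 * dedekind_eta (3 * \<tau>) ^ 8 /
     (dedekind_eta \<tau> ^ 8 * dedekind_eta (6 * \<tau>) ^ 4)"

text \<open>\<open>g\<close>, considered on the open set \<open>U\<close>, is a holomorphic inverse of the restriction of
  \<open>F\<close> to some open subset \<open>V\<close> of \<open>D\<close>.\<close>

definition local_holomorphic_inverse ::
    "complex set \<Rightarrow> (complex \<Rightarrow> complex) \<Rightarrow> complex set \<Rightarrow> (complex \<Rightarrow> complex) \<Rightarrow> bool" where
  "local_holomorphic_inverse D F U g \<longleftrightarrow>
     open U \<and> g holomorphic_on U \<and>
     (\<exists>V. open V \<and> V \<subseteq> D \<and> F ` V = U \<and> g ` U = V \<and>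
          (\<forall>\<tau>\<in>V. g (F \<tau>) = \<tau>) \<and> (\<forall>w\<in>U. F (g w) = w))"

end

theory Submission
  imports Defs
begin

text \<open>Write \<open>A = a(\<tau>)\<close>, \<open>B = a(2\<tau>)\<close>, \<open>\<eta>\<^sub>d = \<eta>(d\<tau>)\<close> and \<open>D\<close> for the derivation
  \<open>(2\<pi>i)^(-1) d/d\<tau>\<close>. The four eta quotients of weight one and level six that vanish at a single
  cusp are linear forms in \<open>A\<close> and \<open>B\<close>, and \<open>f = (A + 2B) / (3(2B - A))\<close>. Together with
  \<open>B DA - A DB = 6(\<eta>\<^sub>1\<eta>\<^sub>2\<eta>\<^sub>3\<eta>\<^sub>6)^2\<close> this expresses \<open>Df\<close>, and then \<open>A D^2A - 2(DA)^2 = 6(\<eta>\<^sub>1\<eta>\<^sub>3)^6\<close>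
  is the differential equation.

  All these identities say that some holomorphic \<open>X\<close> of weight \<open>k\<close> is zero. Its size
  \<open>|X| Im(\<tau>)^(k/2)\<close> is preserved by moves that bring every point above a fixed height \<open>c\<close>; if \<open>X\<close>
  vanishes to order \<open>m\<close> at the cusp and \<open>k < 4\<pi>mc\<close>, the maximum modulus principle slightly below height \<open>c\<close>
  forces \<open>X = 0\<close>, so that only one or two Fourier coefficients have to be compared. The moves are
  generated by translations and by \<open>\<tau> \<mapsto> -1/(3\<tau>)\<close>, or by \<open>\<tau> \<mapsto> -1/(6\<tau>)\<close> and
  \<open>\<tau> \<mapsto> (3\<tau> - 2)/(6\<tau> - 3)\<close>. The behaviour of the eta function under inversion comes from its
  logarithmic derivative, and that of \<open>a\<close> from the theta series \<open>\<Sum> x^(n^2)\<close>, which is an eta quotient.\<close>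

text \<open>Bol's identity is why the equation has order two: \<open>1 / A\<close> has weight -1, so
  its second derivative is modular of weight 3, and the factor \<open>- A^3\<close> leads to weight
  six. In the Wronskian of \<open>A\<close> and \<open>B\<close> the derivative of the automorphy
  factor cancels as well. The singular points have a meaning. If \<open>r\<close> is the denominator
  of \<open>f\<close> as a quotient of two of the four weight one forms, these forms are
  \<open>f r\<close>, \<open>r\<close>, \<open>(f - 1) r / 8\<close> and
  \<open>(9f - 1) r / 8\<close>, while \<open>A = (3f - 1) r / 2\<close>. So 0, 1 and 1/9 are values
  at cusps and 1/3 is the value at zeros of \<open>A\<close>. Eliminating \<open>r\<close> in favour
  of \<open>A\<close> in \<open>Df\<close> produces the coefficient of \<open>dl/df\<close>. The
  criterion replaces a count of zeros on a compact modular curve. Its heights are 1/4 at level three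
  and 1/5 at level six, slightly below the lowest corners \<open>1 / sqrt 12\<close> and
  \<open>1 / sqrt 18\<close> of the regions that the moves cannot raise. The tightest case is weight
  six with \<open>m = 2\<close> and \<open>c = 1/4\<close>, where 6 < 2 pi is needed. At level six
  \<open>-1/(6\<tau>)\<close> alone is not enough, since its isometric circles at the integers leave
  a gap around the half-integers.\<close>

abbreviation complex_pi :: complex ("\<pi>") where "\<pi> \<equiv> complex_of_real pi"

abbreviation complex_sqrt3 :: complex ("\<surd>3") where "\<surd>3 \<equiv> complex_of_real (sqrt 3)"

section \<open>A vanishing criterion for modular forms\<close>

definition nome :: "complex \<Rightarrow> complex" where
  "nome \<tau> = exp (2 * \<pi> * \<i> * \<tau>)"

lemma norm_nome: "norm (nome z) = exp (- (2 * pi * Im z))"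
  by (simp add: nome_def)

lemma nome_in_ball: "Im z > 0 \<Longrightarrow> nome z \<in> ball 0 1"
  by (simp add: norm_nome)

lemma nome_nonzero [simp]: "nome z \<noteq> 0"
  by (simp add: nome_def)

lemma nome_add_of_int [simp]: "nome (z + of_int n) = nome z"
  by (simp add: nome_def algebra_simps exp_add exp_integer_2pi exp_eq_1)

lemma nome_mult_of_nat: "nome (of_nat n * z) = nome z ^ n"
  by (simp add: nome_def exp_of_nat_mult [symmetric] algebra_simps)

text \<open>The function \<open>y ^ K * exp (- (a * y))\<close> decreases beyond its maximum at
  \<open>K / a\<close>; a tangent bound for \<open>ln\<close> shows this. With
  \<open>a = 4 * pi * m\<close> this is the source of the bound on the weight.\<close>

lemma power_mult_exp_less:
  fixes a x y :: real
  assumes "0 < x" "x < y" "real K < a * x"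
  shows "y ^ K * exp (- (a * y)) < x ^ K * exp (- (a * x))"
proof -
  have "0 < a" using assms by (metis le_less_trans of_nat_0_le_iff zero_less_mult_pos2)
  have "ln y - ln x = ln (y / x)"
    using assms by (simp add: ln_div)
  also have "\<dots> \<le> y / x - 1"
    using assms by (intro ln_le_minus_one) auto
  finally have l: "ln y - ln x \<le> (y - x) / x"
    using assms by (simp add: field_simps)
  have "real K * (ln y - ln x) \<le> real K * ((y - x) / x)"
    by (intro mult_left_mono l) auto
  also have "\<dots> = (real K / x) * (y - x)" by simp
  also have "\<dots> < a * (y - x)"
    using assms by (intro mult_strict_right_mono) (auto simp: field_simps)
  finally have "real K * ln y - a * y < real K * ln x - a * x"
    by (simp add: algebra_simps)
  then have "exp (real K * ln y - a * y) < exp (real K * ln x - a * x)"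
    by simp
  moreover have "exp (real K * ln z - a * z) = z ^ K * exp (- (a * z))" if "z > 0" for z
  proof -
    have "exp (real K * ln z - a * z) = exp (real K * ln z) * exp (- (a * z))"
      by (simp flip: exp_add)
    then show ?thesis using that by (simp add: exp_of_nat_mult)
  qed
  ultimately show ?thesis using assms by auto
qed

text \<open>Moves may permute the members of the family, so \<open>step\<close> allows the index to
  change. The fixed factor \<open>l > 1\<close> ensures that height \<open>c\<close> is reached
  after finitely many moves. Sizes are squared, which makes the exponent \<open>K\<close> of
  \<open>Im \<tau>\<close> the weight itself.\<close>

lemma vanishing_of_small_weight:
  fixes X G :: "'i \<Rightarrow> complex \<Rightarrow> complex" and K m :: nat and c l :: real
  assumes fin: "finite I"
    and hol: "\<And>i. i \<in> I \<Longrightarrow> G i holomorphic_on ball 0 1"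
    and X: "\<And>i \<tau>. i \<in> I \<Longrightarrow> Im \<tau> > 0 \<Longrightarrow> X i \<tau> = nome \<tau> ^ m * G i (nome \<tau>)"
    and step: "\<And>\<tau>. 0 < Im \<tau> \<Longrightarrow> Im \<tau> < c \<Longrightarrow>
        \<exists>\<tau>'. l * Im \<tau> \<le> Im \<tau>' \<and>
          (\<forall>i\<in>I. \<exists>j\<in>I. norm (X i \<tau>) ^ 2 * Im \<tau> ^ K \<le> norm (X j \<tau>') ^ 2 * Im \<tau>' ^ K)"
    and l: "l > 1" and c: "c > 0" and K: "real K < 4 * pi * m * c"
    and i: "i \<in> I" and \<tau>: "Im \<tau> > 0"
  shows "X i \<tau> = 0"
proof -
  define N where "N i \<tau> = norm (X i \<tau>) ^ 2 * Im \<tau> ^ K" for i \<tau>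
  have reach: "\<exists>\<tau>' j. j \<in> I \<and> c \<le> Im \<tau>' \<and> N i \<tau> \<le> N j \<tau>'" if "i \<in> I" "Im \<tau> > 0" for i \<tau>
  proof -
    obtain n where "c / Im \<tau> < l ^ n" using real_arch_pow [OF l] by blast
    then have "c \<le> l ^ n * Im \<tau>" using that by (simp add: field_simps)
    then show ?thesis using that
    proof (induction n arbitrary: i \<tau>)
      case 0
      then show ?case by auto
    next
      case (Suc n)
      show ?case
      proof (cases "c \<le> Im \<tau>")
        case True
        then show ?thesis using Suc by auto
      next
        case False
        then obtain \<tau>' j where t: "l * Im \<tau> \<le> Im \<tau>'" "j \<in> I" "N i \<tau> \<le> N j \<tau>'"
          using step [of \<tau>] Suc.prems unfolding N_def by force
        have "c \<le> l ^ n * (l * Im \<tau>)" using Suc.prems by (simp add: mult_ac)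
        also have "\<dots> \<le> l ^ n * Im \<tau>'" using t l by (intro mult_left_mono) auto
        finally have "c \<le> l ^ n * Im \<tau>'" .
        moreover have "Im \<tau>' > 0"
          using t(1) Suc.prems l by (smt (verit) mult_pos_pos)
        ultimately show ?thesis using Suc.IH [of \<tau>' j] t by (meson order_trans)
      qed
    qed
  qed
  have m: "m > 0"
    using K by (cases m) auto
  \<comment> \<open>A height \<open>c'\<close> is chosen strictly between the maximum of
    \<open>y ^ K * exp (- (4 * pi * m * y))\<close> and \<open>c\<close>. The disc of radius
    \<open>\<rho>\<close> contains the nomes of all points of height at least \<open>c'\<close>, and
    passing from \<open>c'\<close> up to \<open>c\<close> loses strictly.\<close>
  have "real K / (4 * pi * m) < c"
    using m K by (simp add: field_simps)
  then obtain c' where c'0: "c' > 0" and c': "real K / (4 * pi * m) < c'" "c' < c"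
    using c by (metis dense max_less_iff_conj)
  have c'K: "real K < 4 * pi * m * c'"
    using c'(1) m by (simp add: field_simps)
  define \<rho> where "\<rho> = exp (- (2 * pi * c'))"
  have \<rho>: "0 < \<rho>" "\<rho> < 1" using c'0 by (auto simp: \<rho>_def)
  have sub: "cball (0::complex) \<rho> \<subseteq> ball 0 1" using \<rho> by auto
  have cont: "continuous_on (cball 0 \<rho>) (G i)" if "i \<in> I" for i
    using hol [OF that] sub holomorphic_on_imp_continuous_on continuous_on_subset by blast
  have "\<exists>z\<in>sphere 0 \<rho>. \<forall>w\<in>sphere 0 \<rho>. norm (G i w) \<le> norm (G i z)" if "i \<in> I" for i
    using \<rho> continuous_on_subset [OF cont [OF that], of "sphere 0 \<rho>"]
    by (intro continuous_attains_sup continuous_on_norm) auto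
  then obtain Z where Z: "\<And>i. i \<in> I \<Longrightarrow> Z i \<in> sphere 0 \<rho>"
      "\<And>i w. i \<in> I \<Longrightarrow> w \<in> sphere 0 \<rho> \<Longrightarrow> norm (G i w) \<le> norm (G i (Z i))"
    by metis
  define j where "j = arg_max_on (\<lambda>i. norm (G i (Z i))) I"
  have j: "j \<in> I" "\<And>i. i \<in> I \<Longrightarrow> norm (G i (Z i)) \<le> norm (G j (Z j))"
  proof -
    have "Max ((\<lambda>i. norm (G i (Z i))) ` I) \<in> (\<lambda>i. norm (G i (Z i))) ` I"
      using fin i by (intro Max_in) auto
    then obtain k where "k \<in> I" "\<forall>i\<in>I. norm (G i (Z i)) \<le> norm (G k (Z k))"
      using fin by (smt (verit) Max_ge finite_imageI imageE imageI)
    then have "is_arg_max (\<lambda>i. norm (G i (Z i))) (\<lambda>i. i \<in> I) k"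
      by (auto simp: is_arg_max_linorder)
    then have "is_arg_max (\<lambda>i. norm (G i (Z i))) (\<lambda>i. i \<in> I) j"
      unfolding j_def arg_max_on_def arg_max_def by (rule someI)
    then show "j \<in> I" "\<And>i. i \<in> I \<Longrightarrow> norm (G i (Z i)) \<le> norm (G j (Z j))"
      by (auto simp: is_arg_max_linorder)
  qed
  define B where "B = norm (G j (Z j))"
  have bound: "norm (G i w) \<le> B" if "i \<in> I" "w \<in> cball 0 \<rho>" for i w
  proof (rule maximum_modulus_frontier [of "G i" "cball 0 \<rho>"])
    show "G i holomorphic_on interior (cball 0 \<rho>)"
      using hol [OF that(1)] sub \<rho> by (auto intro: holomorphic_on_subset)
    show "continuous_on (closure (cball 0 \<rho>)) (G i)" using cont that by simp
    show "norm (G i z) \<le> B" if "z \<in> frontier (cball 0 \<rho>)" for z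
      using that Z(2) [OF \<open>i \<in> I\<close>, of z] j(2) [OF \<open>i \<in> I\<close>] \<rho> by (auto simp: B_def)
  qed (use that in auto)
  have N_eq: "N i \<tau> = norm (G i (nome \<tau>)) ^ 2 * (Im \<tau> ^ K * exp (- (4 * pi * m * Im \<tau>)))"
    if "i \<in> I" "Im \<tau> > 0" for i \<tau>
    using that
    by (simp add: N_def X norm_mult norm_power norm_nome power_mult_distrib
        flip: exp_of_nat_mult exp_add power_mult)
  have small: "N i \<tau> \<le> B\<^sup>2 * (Im \<tau> ^ K * exp (- (4 * pi * m * Im \<tau>)))" if "i \<in> I" "c' \<le> Im \<tau>" for i \<tau>
  proof -
    have "norm (G i (nome \<tau>)) \<le> B"
      using that c'0 by (intro bound) (auto simp: norm_nome \<rho>_def)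
    then have "norm (G i (nome \<tau>)) ^ 2 \<le> B\<^sup>2" by (intro power_mono) auto
    moreover note N_eq [of i \<tau>]
    ultimately show ?thesis using that c'0 by (auto intro!: mult_right_mono)
  qed
  \<comment> \<open>The common maximum \<open>B\<close> of all \<open>G i\<close> on the disc is
    attained on its boundary, at a point that lifts to \<open>t\<close> of height \<open>c'\<close>.
    Moves bring \<open>t\<close> to height at least \<open>c\<close> without decreasing the size,
    but there the bound by \<open>B\<close> is strictly below the size at \<open>t\<close>.\<close>
  have "B = 0"
  proof (rule ccontr)
    assume "B \<noteq> 0"
    define t where "t = Ln (Z j) / (2 * \<pi> * \<i>)"
    have "Z j \<noteq> 0" using Z(1) [OF j(1)] \<rho> by auto
    then have t: "nome t = Z j" by (simp add: nome_def t_def)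
    have "exp (- (2 * pi * Im t)) = \<rho>"
      using Z(1) [OF j(1)] by (simp flip: norm_nome add: t)
    then have Imt: "Im t = c'" by (simp add: \<rho>_def)
    have Nt: "N j t = B\<^sup>2 * (c' ^ K * exp (- (4 * pi * m * c')))"
      using N_eq [OF j(1), of t] Imt c'0 by (simp add: t B_def)
    obtain \<tau>' k where k: "k \<in> I" "c \<le> Im \<tau>'" "N j t \<le> N k \<tau>'"
      using reach [OF j(1), of t] Imt c'0 by auto
    then have "N j t \<le> B\<^sup>2 * (Im \<tau>' ^ K * exp (- (4 * pi * m * Im \<tau>')))"
      using small [of k \<tau>'] c'(2) by linarith
    also have "\<dots> < B\<^sup>2 * (c' ^ K * exp (- (4 * pi * m * c')))"
      using power_mult_exp_less [OF c'0 _ c'K, of "Im \<tau>'"] k c' \<open>B \<noteq> 0\<close> by simp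
    finally show False using Nt by simp
  qed
  obtain \<tau>' k where k: "k \<in> I" "c \<le> Im \<tau>'" "N i \<tau> \<le> N k \<tau>'"
    using reach i \<tau> by blast
  then have "N i \<tau> \<le> 0"
    using small [of k \<tau>'] c'(2) \<open>B = 0\<close> by simp
  then show ?thesis
    using \<tau> zero_less_power [OF \<tau>, of K] by (auto simp: N_def mult_le_0_iff)
qed

section \<open>The inversion of the eta function\<close>

text \<open>Fubini in terms of iterated \<open>sums\<close>, so that the result can be added to a
  telescoping part whose two iterated sums differ.\<close>

lemma sums_swap:
  fixes f :: "nat \<Rightarrow> nat \<Rightarrow> complex"
  assumes "(\<lambda>(m, n). norm (f m n)) summable_on UNIV"
  obtains D where "(\<lambda>m. \<Sum>n. f m n) sums D" "(\<lambda>n. \<Sum>m. f m n) sums D"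
    "\<And>m. summable (\<lambda>n. f m n)" "\<And>n. summable (\<lambda>m. f m n)"
proof -
  have s: "(\<lambda>(m, n). f m n) summable_on UNIV \<times> UNIV"
    using abs_summable_summable [of "\<lambda>(m, n). f m n" UNIV] assms by (simp add: case_prod_unfold)
  then have s': "(\<lambda>(n, m). f m n) summable_on UNIV \<times> UNIV"
    by (subst summable_on_swap) (simp add: case_prod_unfold)
  obtain D where D: "((\<lambda>(m, n). f m n) has_sum D) (UNIV \<times> UNIV)"
    using s by (auto simp: summable_on_def)
  then have D': "((\<lambda>(n, m). f m n) has_sum D) (UNIV \<times> UNIV)"
    by (subst has_sum_swap) (simp add: case_prod_unfold)
  have row: "((\<lambda>n. f m n) has_sum (\<Sum>n. f m n)) UNIV" for m
    using summable_on_SigmaD1 [OF s, of m]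
    by (metis UNIV_I case_prod_conv has_sum_imp_sums has_sum_infsum sums_unique)
  have col: "((\<lambda>m. f m n) has_sum (\<Sum>m. f m n)) UNIV" for n
    using summable_on_SigmaD1 [OF s', of n]
    by (metis UNIV_I case_prod_conv has_sum_imp_sums has_sum_infsum sums_unique)
  show ?thesis
  proof
    show "(\<lambda>m. \<Sum>n. f m n) sums D"
      using has_sum_SigmaD [OF D, of "\<lambda>m. \<Sum>n. f m n"] row by (auto intro: has_sum_imp_sums)
    show "(\<lambda>n. \<Sum>m. f m n) sums D"
      using has_sum_SigmaD [OF D', of "\<lambda>n. \<Sum>m. f m n"] col by (auto intro: has_sum_imp_sums)
  qed (use row col in \<open>auto dest: has_sum_imp_sums sums_summable\<close>)
qed

section \<open>Partial fractions of the cotangent and of the inverse squared sine\<close>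

lemma not_Ints_if_Im_nonzero: "Im z \<noteq> 0 \<Longrightarrow> z \<notin> \<int>"
  by (auto elim!: Ints_cases)

lemma not_nonpos_Ints_if_Im_nonzero: "Im z \<noteq> 0 \<Longrightarrow> z \<notin> \<int>\<^sub>\<le>\<^sub>0"
  using not_Ints_if_Im_nonzero nonpos_Ints_Int by blast

lemma sin_pi_nonzero: "Im z \<noteq> 0 \<Longrightarrow> sin (\<pi> * z :: complex) \<noteq> 0"
  by (auto simp: sin_eq_0 field_simps)

text \<open>Logarithmic differentiation of the reflection formula
  \<open>Gamma z * Gamma (1 - z) = \<pi> / sin (\<pi> * z)\<close>.\<close>

lemma Digamma_reflection:
  fixes z :: complex
  assumes "Im z \<noteq> 0"
  shows "Digamma (1 - z) - Digamma z = \<pi> * cot (\<pi> * z)"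
proof -
  have nz: "z \<notin> \<int>\<^sub>\<le>\<^sub>0" "1 - z \<notin> \<int>\<^sub>\<le>\<^sub>0" "sin (\<pi> * z) \<noteq> 0"
    using assms by (auto intro!: not_nonpos_Ints_if_Im_nonzero sin_pi_nonzero)
  have "DERIV (\<lambda>z. Gamma z * Gamma (1 - z)) z :> Gamma z * Digamma z * Gamma (1 - z) - Gamma z * (Gamma (1 - z) * Digamma (1 - z))"
    using nz by (auto intro!: derivative_eq_intros)
  moreover have "DERIV (\<lambda>z. Gamma z * Gamma (1 - z)) z :> - (\<pi> * (\<pi> * cos (\<pi> * z))) / (sin (\<pi> * z))\<^sup>2"
    unfolding Gamma_reflection_complex
    using nz by (auto intro!: derivative_eq_intros simp: power2_eq_square)
  ultimately have "Gamma z * Digamma z * Gamma (1 - z) - Gamma z * (Gamma (1 - z) * Digamma (1 - z)) =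
      - (\<pi> * (\<pi> * cos (\<pi> * z))) / (sin (\<pi> * z))\<^sup>2"
    by (rule DERIV_unique)
  then have "(Gamma z * Gamma (1 - z)) * (Digamma (1 - z) - Digamma z) =
      (\<pi> * (\<pi> * cos (\<pi> * z))) / (sin (\<pi> * z))\<^sup>2"
    by (simp add: algebra_simps)
  then show ?thesis
    unfolding Gamma_reflection_complex using nz(3)
    by (auto simp: cot_def power2_eq_square divide_simps)
qed

lemma cot_partial_fractions:
  fixes z :: complex
  assumes "Im z \<noteq> 0"
  shows "(\<lambda>m. 1 / (z + of_nat (Suc m)) + 1 / (z - of_nat (Suc m))) sums (\<pi> * cot (\<pi> * z) - 1 / z)"
proof -
  have z0: "z \<noteq> 0" using assms by auto
  have nz: "z + of_nat k \<noteq> 0" "1 - z + of_nat k \<noteq> 0" "z - of_nat k \<noteq> 0" for k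
    using assms by (auto simp: complex_eq_iff)
  have "(\<lambda>k. inverse (of_nat (Suc k)) - inverse (w + of_nat k)) sums (Digamma w + euler_mascheroni)"
    if "w \<noteq> 0" for w :: complex
    using summable_Digamma [OF that] by (simp add: Digamma_def summable_sums)
  from sums_diff [OF this [of "1 - z"] this [of z]]
  have "(\<lambda>k. inverse (z + of_nat k) - inverse (1 - z + of_nat k)) sums (\<pi> * cot (\<pi> * z))"
    using assms z0 by (fastforce simp: Digamma_reflection [symmetric])
  \<comment> \<open>The Digamma series pairs \<open>z + k\<close> with
    \<open>1 - z + k = - (z - (k + 1))\<close>. Subtracting this telescoping series shifts the first
    index by one, which gives the symmetric pairing and splits off \<open>1 / z\<close>.\<close>
  moreover have "(\<lambda>k. inverse (z + of_nat k) - inverse (z + of_nat (Suc k))) sums (inverse (z + of_nat 0) - 0)"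
  proof (rule telescope_sums')
    show "(\<lambda>k. inverse (z + of_nat k)) \<longlonglongrightarrow> 0"
      by (intro tendsto_inverse_0 [THEN filterlim_compose]
          tendsto_add_filterlim_at_infinity [OF tendsto_const] tendsto_of_nat)
  qed
  ultimately have "(\<lambda>k. (inverse (z + of_nat k) - inverse (1 - z + of_nat k)) -
      (inverse (z + of_nat k) - inverse (z + of_nat (Suc k)))) sums (\<pi> * cot (\<pi> * z) - (inverse (z + of_nat 0) - 0))"
    by (rule sums_diff)
  also have "(\<lambda>k. (inverse (z + of_nat k) - inverse (1 - z + of_nat k)) -
      (inverse (z + of_nat k) - inverse (z + of_nat (Suc k)))) =
     (\<lambda>m. 1 / (z + of_nat (Suc m)) + 1 / (z - of_nat (Suc m)))"
  proof
    fix k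
    have "inverse (1 - z + of_nat k) = - (1 / (z - of_nat (Suc k)))"
      using nz [of k] nz(3) [of "Suc k"] by (simp add: field_simps)
    then show "(inverse (z + of_nat k) - inverse (1 - z + of_nat k)) -
      (inverse (z + of_nat k) - inverse (z + of_nat (Suc k))) =
       1 / (z + of_nat (Suc k)) + 1 / (z - of_nat (Suc k))"
      by (simp add: divide_inverse)
  qed
  finally show ?thesis by (simp add: divide_inverse)
qed

text \<open>Differentiating the Digamma reflection formula gives
  \<open>Polygamma 1 z + Polygamma 1 (1 - z)\<close>; each summand is already known as a series, so
  no cotangent series has to be differentiated termwise.\<close>

lemma sin_squared_partial_fractions:
  fixes z :: complex
  assumes "Im z \<noteq> 0"
  shows "(\<lambda>m. 1 / (z + of_nat (Suc m))^2 + 1 / (z - of_nat (Suc m))^2) sums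
           ((\<pi> / sin (\<pi> * z))^2 - 1 / z^2)"
proof -
  have nz: "z \<notin> \<int>\<^sub>\<le>\<^sub>0" "1 - z \<notin> \<int>\<^sub>\<le>\<^sub>0" "sin (\<pi> * z) \<noteq> 0" "z \<noteq> 0" "1 - z \<noteq> 0"
    using assms by (auto intro!: not_nonpos_Ints_if_Im_nonzero sin_pi_nonzero)
  have op: "open {z. Im z \<noteq> 0}"
    by (intro open_Collect_neq continuous_intros)
  have "DERIV (\<lambda>z. Digamma (1 - z) - Digamma z) z :> - Polygamma 1 (1 - z) - Polygamma 1 z"
    using nz by (auto intro!: derivative_eq_intros)
  moreover have "DERIV (\<lambda>z. Digamma (1 - z) - Digamma z) z :> - (\<pi> * \<pi> / (sin (\<pi> * z))\<^sup>2)"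
  proof (rule has_field_derivative_transform_within_open [OF _ op])
    show "DERIV (\<lambda>z. \<pi> * cot (\<pi> * z)) z :> - (\<pi> * \<pi> / (sin (\<pi> * z))\<^sup>2)"
      using nz by (auto intro!: derivative_eq_intros DERIV_chain2 [OF DERIV_cot] simp: power2_eq_square divide_inverse)
  qed (use assms in \<open>auto simp: Digamma_reflection\<close>)
  ultimately have "- Polygamma 1 (1 - z) - Polygamma 1 z = - (\<pi> * \<pi> / (sin (\<pi> * z))\<^sup>2)"
    by (rule DERIV_unique)
  then have P: "Polygamma 1 z + Polygamma 1 (1 - z) = (\<pi> / sin (\<pi> * z))^2"
    by (simp add: power2_eq_square algebra_simps)
  have L: "(\<lambda>k. inverse ((w + of_nat k)^2)) sums Polygamma 1 w" if "w \<noteq> 0" for w :: complex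
    using Polygamma_LIMSEQ [of w 1] that by (simp add: eval_nat_numeral)
  have "(\<lambda>k. inverse ((z + of_nat (Suc k))^2)) sums (Polygamma 1 z - 1 / z^2)"
    using L [OF nz(4)] by (subst sums_Suc_iff) (simp add: divide_inverse)
  from sums_add [OF this L [OF nz(5)]]
  have "(\<lambda>k. inverse ((z + of_nat (Suc k))^2) + inverse ((1 - z + of_nat k)^2)) sums
      ((\<pi> / sin (\<pi> * z))^2 - 1 / z^2)"
    unfolding P [symmetric] by (simp add: algebra_simps)
  moreover have "(1 - z + of_nat k)^2 = (z - of_nat (Suc k))^2" for k
    by (simp add: power2_eq_square algebra_simps)
  ultimately show ?thesis by (simp add: divide_inverse)
qed

text \<open>In terms of \<open>E = exp (- 2 * \<i> * w)\<close> the cotangent is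
  \<open>\<i> * (1 + E) / (1 - E)\<close>, and \<open>E\<close> tends to 0. This yields the boundary
  term when the order of summation is changed.\<close>

lemma tendsto_cot_at_minus_i_infinity:
  fixes z :: "nat \<Rightarrow> complex"
  assumes "filterlim (\<lambda>n. Im (z n)) at_bot sequentially"
  shows "(\<lambda>n. cot (z n)) \<longlonglongrightarrow> \<i>"
proof -
  have lim: "(\<lambda>n. exp (- 2 * \<i> * z n)) \<longlonglongrightarrow> 0"
  proof (rule tendsto_norm_zero_cancel)
    have "((\<lambda>x::real. exp (2 * x)) \<longlongrightarrow> 0) at_bot"
      by (intro filterlim_compose [OF exp_at_bot] filterlim_tendsto_pos_mult_at_bot [OF tendsto_const]
          filterlim_ident) auto
    from filterlim_compose [OF this assms]
    show "(\<lambda>n. norm (exp (- 2 * \<i> * z n))) \<longlonglongrightarrow> 0" by simp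
  qed
  have "(\<lambda>n. \<i> * (1 + exp (- 2 * \<i> * z n)) / (1 - exp (- 2 * \<i> * z n))) \<longlonglongrightarrow> \<i> * (1 + 0) / (1 - 0)"
    by (intro tendsto_intros lim) auto
  moreover have "cot w = \<i> * (1 + exp (- 2 * \<i> * w)) / (1 - exp (- 2 * \<i> * w))" for w
  proof -
    have "cos w = exp (\<i> * w) * (1 + exp (- 2 * \<i> * w)) / 2"
      by (simp add: cos_exp_eq algebra_simps flip: exp_add)
    moreover have "sin w = exp (\<i> * w) * (1 - exp (- 2 * \<i> * w)) / (2 * \<i>)"
      by (simp add: sin_exp_eq algebra_simps flip: exp_add)
    moreover have "(E * a / 2) / (E * b / (2 * \<i>)) = \<i> * a / b" if "E \<noteq> 0" for E a b :: complex
      using that by (simp add: field_simps)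
    ultimately show ?thesis
      unfolding cot_def by (metis exp_not_eq_zero)
  qed
  ultimately show ?thesis by simp
qed

lemma norm_lattice_ge:
  assumes "Im z > 0"
  obtains \<delta> where "\<delta> > 0"
    "\<And>x y. norm (of_real x * z + of_real y) \<ge> \<delta> * \<bar>x\<bar>" "\<And>x y. norm (of_real x * z + of_real y) \<ge> \<delta> * \<bar>y\<bar>"
proof -
  have "norm z > 0" using assms by auto
  have 1: "norm (of_real x * z + of_real y) \<ge> Im z * \<bar>x\<bar>" for x y
    using abs_Im_le_cmod [of "of_real x * z + of_real y"] assms by (simp add: abs_mult mult.commute)
  have 2: "norm (of_real x * z + of_real y) \<ge> Im z / norm z * \<bar>y\<bar>" for x y
  proof -
    \<comment> \<open>Multiplication by \<open>cnj z\<close> makes the coefficient of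
      \<open>x\<close> real, so only \<open>y\<close> is left in the imaginary part.\<close>
    have "Im z * \<bar>y\<bar> = \<bar>Im ((of_real x * z + of_real y) * cnj z)\<bar>"
      using assms by (simp add: abs_mult algebra_simps)
    also have "\<dots> \<le> norm (of_real x * z + of_real y) * norm z"
      using abs_Im_le_cmod [of "(of_real x * z + of_real y) * cnj z"] by (simp add: norm_mult)
    finally show ?thesis using \<open>norm z > 0\<close> by (simp add: field_simps)
  qed
  show ?thesis
  proof
    show "min (Im z) (Im z / norm z) > 0" using assms \<open>norm z > 0\<close> by simp
    show "norm (of_real x * z + of_real y) \<ge> min (Im z) (Im z / norm z) * \<bar>x\<bar>" for x y
      using 1 [of x y] by (smt (verit) abs_ge_zero min.cobounded1 mult_right_mono)
    show "norm (of_real x * z + of_real y) \<ge> min (Im z) (Im z / norm z) * \<bar>y\<bar>" for x y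
      using 2 [of y x] by (smt (verit) abs_ge_zero min.cobounded2 mult_right_mono)
  qed
qed

text \<open>Both iterated sums of the telescoping terms that are subtracted here are explicit, and what
  remains converges absolutely.\<close>

lemma eisenstein_sum_swap:
  assumes \<tau>: "Im \<tau> > 0"
  defines "h \<equiv> \<lambda>m n. 1 / (of_nat (Suc m) * \<tau> + of_nat (Suc n))^2 + 1 / (of_nat (Suc m) * \<tau> - of_nat (Suc n))^2"
  obtains s where "(\<lambda>m. \<Sum>n. h m n) sums s" "(\<lambda>n. \<Sum>m. h m n) sums (s - \<pi> * \<i> / \<tau>)"
proof -
  let ?z = "\<lambda>m. of_nat (Suc m) * \<tau>"
  define k where "k m n = 1 / ((?z m + of_nat (Suc n)) * (?z m + of_nat (Suc (Suc n))))
     + 1 / ((?z m - of_nat (Suc n)) * (?z m - of_nat (Suc (Suc n))))" for m n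
  define d where "d m n = h m n - k m n" for m n
  define C where "C n = (\<pi> * cot (\<pi> * (of_nat (Suc n) / \<tau>)) - \<tau> / of_nat (Suc n)) / \<tau>" for n
  have \<tau>0: "\<tau> \<noteq> 0" using \<tau> by auto
  have nz: "?z m + of_int n \<noteq> 0" for m n
    using \<tau> by (auto simp: complex_eq_iff)
  have nz1: "?z m + of_nat n \<noteq> 0" "?z m - of_nat n \<noteq> 0" for m n
    using nz [of m "int n"] nz [of m "- int n"] by auto
  have k_eq: "k m n = (1 / (?z m + of_nat (Suc n)) - 1 / (?z m - of_nat (Suc n)))
      - (1 / (?z m + of_nat (Suc (Suc n))) - 1 / (?z m - of_nat (Suc (Suc n))))" for m n
  proof -
    have "1 / (z * (z + 1)) = 1 / z - 1 / (z + 1)" if "z \<noteq> 0" "z + 1 \<noteq> 0" for z :: complex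
      using that by (simp add: field_simps)
    from this [of "?z m + of_nat (Suc n)"]
    have 1: "1 / ((?z m + of_nat (Suc n)) * (?z m + of_nat (Suc (Suc n))))
        = 1 / (?z m + of_nat (Suc n)) - 1 / (?z m + of_nat (Suc (Suc n)))"
      using nz1 [of m "Suc n"] nz1 [of m "Suc (Suc n)"] by (simp add: add_ac)
    have "1 / (z * (z - 1)) = 1 / (z - 1) - 1 / z" if "z \<noteq> 0" "z - 1 \<noteq> 0" for z :: complex
      using that by (simp add: field_simps)
    from this [of "?z m - of_nat (Suc n)"]
    have 2: "1 / ((?z m - of_nat (Suc n)) * (?z m - of_nat (Suc (Suc n))))
        = 1 / (?z m - of_nat (Suc (Suc n))) - 1 / (?z m - of_nat (Suc n))"
      using nz1 [of m "Suc n"] nz1 [of m "Suc (Suc n)"] by (simp add: algebra_simps)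
    show ?thesis unfolding k_def 1 2 by simp
  qed
  have lim0: "(\<lambda>n. 1 / (?z m + of_nat (Suc n)) - 1 / (?z m - of_nat (Suc n))) \<longlonglongrightarrow> 0" for m
  proof -
    have "(\<lambda>n. 1 / (?z m + of_nat n)) \<longlonglongrightarrow> 0"
      by (intro tendsto_divide_0 [OF tendsto_const] tendsto_add_filterlim_at_infinity [OF tendsto_const]
          tendsto_of_nat)
    moreover have "(\<lambda>n. 1 / (- (?z m) + of_nat n)) \<longlonglongrightarrow> 0"
      by (intro tendsto_divide_0 [OF tendsto_const] tendsto_add_filterlim_at_infinity [OF tendsto_const]
          tendsto_of_nat)
    ultimately have "(\<lambda>n. 1 / (?z m + of_nat n) + 1 / (- (?z m) + of_nat n)) \<longlonglongrightarrow> 0 + 0"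
      by (rule tendsto_add)
    moreover have "1 / (- (?z m) + of_nat n) = - (1 / (?z m - of_nat n))" for n
      by (metis minus_diff_eq minus_divide_right uminus_add_conv_diff)
    ultimately show ?thesis using LIMSEQ_Suc by fastforce
  qed
  have k_row: "(\<lambda>n. k m n) sums (1 / (?z m + of_nat (Suc 0)) - 1 / (?z m - of_nat (Suc 0)))" for m
    using telescope_sums' [OF lim0 [of m]] by (simp add: k_eq [abs_def])
  have C: "(\<lambda>m. 1 / (?z m + of_nat (Suc n)) - 1 / (?z m - of_nat (Suc n))) sums C n" for n
  proof -
    define z where "z = of_nat (Suc n) / \<tau>"
    have "Im z \<noteq> 0" using \<tau> by (simp add: z_def Im_divide complex_eq_iff)
    from sums_divide [OF cot_partial_fractions [OF this], of \<tau>]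
    have "(\<lambda>m. (1 / (z + of_nat (Suc m)) + 1 / (z - of_nat (Suc m))) / \<tau>) sums C n"
      using \<tau>0 by (simp add: C_def z_def)
    also have "(\<lambda>m. (1 / (z + of_nat (Suc m)) + 1 / (z - of_nat (Suc m))) / \<tau>) =
      (\<lambda>m. 1 / (?z m + of_nat (Suc n)) - 1 / (?z m - of_nat (Suc n)))"
    proof
      fix m
      have "(z + of_nat (Suc m)) * \<tau> = ?z m + of_nat (Suc n)"
          "(z - of_nat (Suc m)) * \<tau> = - (?z m - of_nat (Suc n))"
        using \<tau>0 by (simp_all add: z_def field_simps)
      then show "(1 / (z + of_nat (Suc m)) + 1 / (z - of_nat (Suc m))) / \<tau> =
         1 / (?z m + of_nat (Suc n)) - 1 / (?z m - of_nat (Suc n))"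
        by (simp only: add_divide_distrib divide_divide_eq_left minus_divide_right [symmetric] add_uminus_conv_diff)
    qed
    finally show ?thesis .
  qed
  have k_col: "(\<lambda>m. k m n) sums (C n - C (Suc n))" for n
    using sums_diff [OF C [of n] C [of "Suc n"]] by (simp add: k_eq [abs_def])
  \<comment> \<open>This nonzero limit is the whole defect between the two orders of summation: the
    rows of \<open>k\<close> add up to \<open>C 0\<close>, its columns to \<open>C 0\<close> minus
    the limit of \<open>C\<close>. As \<open>1 / \<tau>\<close> lies in the lower half-plane, the
    cotangent tends to \<open>\<i>\<close>.\<close>
  have C_lim: "C \<longlonglongrightarrow> \<pi> * \<i> / \<tau>"
  proof -
    have neg: "pi * Im (1 / \<tau>) < 0"
      using \<tau> by (simp add: Im_divide mult_pos_neg sum_power2_gt_zero_iff divide_neg_pos)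
    have "filterlim (\<lambda>n. (pi * Im (1 / \<tau>)) * real (Suc n)) at_bot sequentially"
      by (intro filterlim_tendsto_neg_mult_at_bot [OF tendsto_const neg]
          filterlim_compose [OF filterlim_real_sequentially filterlim_Suc])
    also have "(\<lambda>n. (pi * Im (1 / \<tau>)) * real (Suc n)) = (\<lambda>n. Im (\<pi> * (of_nat (Suc n) / \<tau>)))"
      by (simp add: Im_divide fun_eq_iff)
    finally have "(\<lambda>n. cot (\<pi> * (of_nat (Suc n) / \<tau>))) \<longlonglongrightarrow> \<i>"
      by (rule tendsto_cot_at_minus_i_infinity)
    moreover have "(\<lambda>n. \<tau> / of_nat (Suc n)) \<longlonglongrightarrow> 0"
      by (intro LIMSEQ_Suc tendsto_divide_0 [OF tendsto_const] tendsto_of_nat)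
    ultimately have "C \<longlonglongrightarrow> (\<pi> * \<i> - 0) / \<tau>"
      unfolding C_def [abs_def] by (intro tendsto_intros \<tau>0)
    then show ?thesis by simp
  qed
  have "(\<lambda>(m, n). norm (d m n)) summable_on UNIV"
  proof -
    obtain \<delta> where \<delta>: "\<delta> > 0"
      "\<And>x y. norm (of_real x * \<tau> + of_real y) \<ge> \<delta> * \<bar>x\<bar>" "\<And>x y. norm (of_real x * \<tau> + of_real y) \<ge> \<delta> * \<bar>y\<bar>"
      using norm_lattice_ge [OF \<tau>] by blast
    define b where "b m = real (Suc m) powr (- (3/2))" for m
    have "summable b"
      unfolding b_def by (subst summable_Suc_iff [of "\<lambda>m. real m powr (-(3/2))"]) (simp add: summable_real_powr_iff)
    then have b: "b summable_on UNIV"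
      by (subst summable_on_UNIV_nonneg_real_iff) (auto simp: b_def)
    have b0: "b m \<ge> 0" for m by (simp add: b_def)
    have bb: "(\<lambda>(m, n). b m * b n) summable_on UNIV \<times> UNIV"
      by (rule summable_on_SigmaI [where g = "\<lambda>m. b m * infsum b UNIV"])
        (auto intro!: has_sum_cmult_right has_sum_infsum summable_on_cmult_left b mult_nonneg_nonneg b0)
    have bound: "norm (1 / z^2 - 1 / (z * w)) \<le> \<delta> powr (-3) * (b m * b n)"
      if z: "z = of_real x * \<tau> + of_real y" and w: "w = of_real x * \<tau> + of_real y'" and "norm (w - z) = 1"
      "\<bar>x\<bar> = real (Suc m)" "\<bar>y\<bar> = real (Suc n)" "\<bar>y'\<bar> \<ge> real (Suc n)" for z w x y y' m n
    proof -
      \<comment> \<open>The difference equals \<open>(w - z) / (z^2 * w)\<close> with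
        \<open>norm (w - z) = 1\<close>, hence has order three. Bounding the larger coordinate below
        by the geometric mean of both turns this into a product of two convergent series with
        exponent 3/2.\<close>
      define t where "t = \<delta> * (sqrt (real (Suc m)) * sqrt (real (Suc n)))"
      have sq: "sqrt a * sqrt b \<le> max a b" if "a > 0" "b > 0" for a b :: real
      proof -
        have "sqrt a * sqrt b \<le> sqrt (max a b) * sqrt (max a b)"
          using that by (intro mult_mono) auto
        then show ?thesis using that by simp
      qed
      have t0: "t > 0" using \<delta> by (simp add: t_def)
      have t_le: "t \<le> \<delta> * max (real (Suc m)) (real (Suc n))"
        unfolding t_def using \<delta>(1) by (intro mult_left_mono sq) auto
      also have "\<dots> \<le> norm z"
        using \<delta>(2) [of x y] \<delta>(3) [of y x] that unfolding max_def by auto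
      finally have tz: "t \<le> norm z" .
      have "\<delta> * real (Suc n) \<le> \<delta> * \<bar>y'\<bar>" using \<delta>(1) that by (intro mult_left_mono) auto
      then have "\<delta> * max (real (Suc m)) (real (Suc n)) \<le> norm w"
        using \<delta>(2) [of x y'] \<delta>(3) [of y' x] that unfolding max_def by auto
      with t_le have tw: "t \<le> norm w" by linarith
      have nz: "z \<noteq> 0" "w \<noteq> 0" using t0 tz tw by auto
      have "1 / z^2 - 1 / (z * w) = (w - z) / (z^2 * w)"
        using nz by (simp add: field_simps power2_eq_square)
      then have "norm (1 / z^2 - 1 / (z * w)) = 1 / (norm z ^ 2 * norm w)"
        using that(3) by (simp add: norm_divide norm_mult norm_power)
      also have "\<dots> \<le> 1 / (t ^ 2 * t)"
        using t0 tz tw by (intro divide_left_mono mult_mono power_mono mult_pos_pos) auto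
      also have "\<dots> = t powr (-3)"
        using t0 by (simp add: powr_minus powr_numeral divide_simps eval_nat_numeral)
      also have "\<dots> = \<delta> powr (-3) * (b m * b n)"
        using \<delta>(1) by (simp add: t_def powr_mult b_def powr_half_sqrt [symmetric] powr_powr)
      finally show ?thesis .
    qed
    have "norm (d m n) \<le> 2 * \<delta> powr (-3) * (b m * b n)" for m n
    proof -
      have "norm (1 / (?z m + of_nat (Suc n))^2 - 1 / ((?z m + of_nat (Suc n)) * (?z m + of_nat (Suc (Suc n)))))
        \<le> \<delta> powr (-3) * (b m * b n)"
        by (rule bound [where x = "real (Suc m)" and y = "real (Suc n)" and y' = "real (Suc (Suc n))"]) simp_all
      moreover have "norm (1 / (?z m - of_nat (Suc n))^2 - 1 / ((?z m - of_nat (Suc n)) * (?z m - of_nat (Suc (Suc n)))))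
        \<le> \<delta> powr (-3) * (b m * b n)"
        by (rule bound [where x = "real (Suc m)" and y = "- real (Suc n)" and y' = "- real (Suc (Suc n))"]) simp_all
      ultimately show ?thesis
        unfolding d_def h_def k_def by (intro order_trans [OF norm_diff_triangle_ineq]) linarith
    qed
    moreover have "(\<lambda>(m, n). 2 * \<delta> powr (-3) * (b m * b n)) summable_on UNIV"
      using summable_on_cmult_right [OF bb, of "2 * \<delta> powr (-3)"] by (simp add: case_prod_unfold)
    ultimately show ?thesis
      by (rule_tac summable_on_comparison_test) auto
  qed
  then obtain D where D: "(\<lambda>m. \<Sum>n. d m n) sums D" "(\<lambda>n. \<Sum>m. d m n) sums D"
    "\<And>m. summable (\<lambda>n. d m n)" "\<And>n. summable (\<lambda>m. d m n)"
    by (rule sums_swap) blast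
  have h_eq: "h m n = d m n + k m n" for m n by (simp add: d_def)
  have row: "(\<Sum>n. h m n) = (\<Sum>n. d m n) + (1 / (?z m + of_nat (Suc 0)) - 1 / (?z m - of_nat (Suc 0)))" for m
    using sums_add [OF summable_sums [OF D(3) [of m]] k_row [of m]] unfolding h_eq by (rule sums_unique [symmetric])
  have col: "(\<Sum>m. h m n) = (\<Sum>m. d m n) + (C n - C (Suc n))" for n
    using sums_add [OF summable_sums [OF D(4) [of n]] k_col [of n]] unfolding h_eq by (rule sums_unique [symmetric])
  show ?thesis
  proof
    show "(\<lambda>m. \<Sum>n. h m n) sums (D + C 0)"
      unfolding row by (rule sums_add [OF D(1) C])
    have "(\<lambda>n. \<Sum>m. h m n) sums (D + (C 0 - \<pi> * \<i> / \<tau>))"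
      unfolding col by (rule sums_add [OF D(2) telescope_sums' [OF C_lim]])
    then show "(\<lambda>n. \<Sum>m. h m n) sums (D + C 0 - \<pi> * \<i> / \<tau>)"
      by (simp only: add_diff_eq)
  qed
qed

text \<open>For \<open>z = m t\<close> the partial fractions of the inverse squared sine run along
  the rows of the lattice sum, for \<open>z = - m / t\<close> along its columns. The terms without
  partner contribute zeta(2), and the change of order contributes
  \<open>\<pi> * \<i> / t\<close>.\<close>

lemma inverse_sin_squared_sum_inversion:
  assumes t: "Im t > 0"
  obtains s where
    "(\<lambda>m. (\<pi> / sin (\<pi> * (of_nat (Suc m) * t)))^2) sums s"
    "(\<lambda>m. (\<pi> / sin (\<pi> * (of_nat (Suc m) * (- 1 / t))))^2) sums
       (t^2 * (s + \<pi> ^ 2 / 6 - \<pi> ^ 2 / (6 * t^2) - \<pi> * \<i> / t))"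
proof -
  define h where "h m n = 1 / (of_nat (Suc m) * t + of_nat (Suc n))^2 + 1 / (of_nat (Suc m) * t - of_nat (Suc n))^2" for m n
  have t0: "t \<noteq> 0" using t by auto
  obtain s where s: "(\<lambda>m. \<Sum>n. h m n) sums s" "(\<lambda>n. \<Sum>m. h m n) sums (s - \<pi> * \<i> / t)"
    using eisenstein_sum_swap [OF t] unfolding h_def by blast
  have zeta: "(\<lambda>m. 1 / of_nat (Suc m) ^ 2 :: complex) sums (\<pi> ^ 2 / 6)"
    using sums_of_real [OF inverse_squares_sums, where 'a = complex] by simp
  have Im: "Im (of_nat (Suc m) * t) \<noteq> 0" "Im (of_nat (Suc m) * (- 1 / t)) \<noteq> 0" for m
    using t by (auto simp: Im_divide complex_eq_iff)
  have 1: "(\<pi> / sin (\<pi> * (of_nat (Suc m) * t)))^2 = (\<Sum>n. h m n) + 1 / of_nat (Suc m) ^ 2 / t^2" for m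
    using sums_unique [OF sin_squared_partial_fractions [OF Im(1) [of m]]]
    by (simp add: h_def power_mult_distrib diff_eq_eq)
  have 2: "(\<pi> / sin (\<pi> * (of_nat (Suc m) * (- 1 / t))))^2 = t^2 * ((\<Sum>n. h n m) + 1 / of_nat (Suc m) ^ 2)" for m
  proof -
    let ?z = "of_nat (Suc m) * (- 1 / t) :: complex"
    have h: "1 / (?z + of_nat (Suc n))^2 + 1 / (?z - of_nat (Suc n))^2 = t^2 * h n m" for n
    proof -
      have "?z + of_nat (Suc n) = (of_nat (Suc n) * t - of_nat (Suc m)) / t"
        "?z - of_nat (Suc n) = - ((of_nat (Suc n) * t + of_nat (Suc m)) / t)"
        using t0 by (simp_all add: field_simps)
      then show ?thesis unfolding h_def by (simp only: power2_minus power_divide) (simp add: distrib_left)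
    qed
    have *: "(\<lambda>n. t^2 * h n m) sums ((\<pi> / sin (\<pi> * ?z))^2 - 1 / ?z^2)"
      using sin_squared_partial_fractions [OF Im(2) [of m]] unfolding h .
    have "(\<lambda>n. h n m) sums (((\<pi> / sin (\<pi> * ?z))^2 - 1 / ?z^2) / t^2)"
      using sums_divide [OF *, of "t^2"] t0 by simp
    note eq = sums_unique [OF this, symmetric]
    have "(\<Sum>n. h n m) * t^2 = (\<pi> / sin (\<pi> * ?z))^2 - 1 / ?z^2"
      unfolding eq using t0 by simp
    moreover have "1 / ?z^2 = t^2 * (1 / of_nat (Suc m) ^ 2)"
      by (simp add: power_mult_distrib power_divide)
    ultimately show ?thesis by (simp add: algebra_simps)
  qed
  show ?thesis
  proof
    show "(\<lambda>m. (\<pi> / sin (\<pi> * (of_nat (Suc m) * t)))^2) sums (s + \<pi> ^ 2 / 6 / t^2)"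
      unfolding 1 by (intro sums_add s sums_divide zeta)
    have "(\<lambda>m. t^2 * ((\<Sum>n. h n m) + 1 / of_nat (Suc m) ^ 2)) sums (t^2 * (s - \<pi> * \<i> / t + \<pi> ^ 2 / 6))"
      by (intro sums_mult sums_add s zeta)
    then show "(\<lambda>m. (\<pi> / sin (\<pi> * (of_nat (Suc m) * (- 1 / t))))^2) sums
       (t^2 * (s + \<pi> ^ 2 / 6 / t^2 + \<pi> ^ 2 / 6 - \<pi> ^ 2 / (6 * t^2) - \<pi> * \<i> / t))"
      unfolding 2 by (simp add: algebra_simps)
  qed
qed

section \<open>The Euler product and its logarithmic derivative\<close>

lemma norm_power_Suc_less_1:
  fixes q :: complex
  assumes "norm q < 1"
  shows "norm (q ^ Suc n) < 1"
  using power_less_one_iff [of "norm q" "Suc n"] assms by (simp add: norm_power del: power_Suc)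

definition euler_phi :: "complex \<Rightarrow> complex" where
  "euler_phi q = (\<Prod>n. 1 - q ^ Suc n)"

lemma euler_phi_0 [simp]: "euler_phi 0 = 1"
  by (simp add: euler_phi_def)

lemma one_minus_power_nonzero:
  fixes q :: complex
  assumes "norm q < 1"
  shows "1 - q ^ Suc n \<noteq> 0"
  using norm_power_Suc_less_1 [OF assms, of n] by (auto simp del: power_Suc)

lemma convergent_euler_phi:
  fixes q :: complex
  assumes "norm q < 1"
  shows "convergent_prod (\<lambda>n. 1 - q ^ Suc n)"
proof -
  have "summable (\<lambda>n. norm (- (q ^ Suc n)))"
    using summable_geometric [of "norm q"] assms
    by (simp add: norm_mult norm_power summable_mult)
  then have "convergent_prod (\<lambda>n. 1 + - (q ^ Suc n))"
  proof (rule summable_imp_convergent_prod_complex)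
    show "- (q ^ Suc n) \<noteq> - 1" for n
      using one_minus_power_nonzero [OF assms, of n] by (metis eq_iff_diff_eq_0 neg_equal_iff_equal)
  qed
  then show ?thesis by simp
qed

lemma euler_phi_nonzero: "norm q < 1 \<Longrightarrow> euler_phi q \<noteq> 0"
  unfolding euler_phi_def
  by (rule prodinf_nonzero) (use convergent_euler_phi one_minus_power_nonzero in \<open>auto simp del: power_Suc\<close>)

lemma ball_subset_smaller_ball:
  fixes x :: complex
  assumes "norm x < 1"
  obtains d r where "0 < d" "0 < r" "r < 1" "\<And>y. y \<in> ball x d \<Longrightarrow> norm y \<le> r"
proof
  show "0 < (1 - norm x) / 2" "0 < (1 + norm x) / 2" "(1 + norm x) / 2 < 1"
    using assms by (auto simp: add_pos_nonneg)
  fix y assume "y \<in> ball x ((1 - norm x) / 2)"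
  then have "norm (y - x) < (1 - norm x) / 2" by (simp add: dist_norm norm_minus_commute)
  then show "norm y \<le> (1 + norm x) / 2"
    using norm_triangle_sub [of y x] by (simp add: field_simps)
qed

text \<open>The product is the exponential of a locally uniformly convergent series of logarithms,
  which may be differentiated termwise. The principal branch is safe because
  \<open>1 - x ^ Suc n\<close> has positive real part.\<close>

lemma euler_phi_has_field_derivative:
  assumes "norm q < 1"
  obtains s where "(\<lambda>n. of_nat (Suc n) * q ^ n / (1 - q ^ Suc n)) sums s"
    "DERIV euler_phi q :> - s * euler_phi q"
proof -
  have local_bound: "\<exists>d h. 0 < d \<and> summable h \<and>
      (\<forall>\<^sub>F n in sequentially. \<forall>y\<in>ball x d \<inter> ball 0 1. norm (Ln (1 - y ^ Suc n)) \<le> h n)"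
    if "x \<in> ball 0 1" for x :: complex
  proof -
    have "norm x < 1" using that by simp
    then obtain d r where r: "0 < d" "0 < r" "r < 1" "\<And>y. y \<in> ball x d \<Longrightarrow> norm y \<le> r"
      by (rule ball_subset_smaller_ball) blast
    have "(\<lambda>n. r ^ Suc n) \<longlonglongrightarrow> 0"
      using r by (intro LIMSEQ_Suc LIMSEQ_power_zero) auto
    then have "eventually (\<lambda>n. r ^ Suc n < 1 / 2) sequentially"
      by (rule order_tendstoD) simp
    then have "\<forall>\<^sub>F n in sequentially. \<forall>y\<in>ball x d \<inter> ball 0 1. norm (Ln (1 - y ^ Suc n)) \<le> 2 * r ^ Suc n"
    proof eventually_elim
      case (elim n)
      show ?case
      proof
        fix y assume "y \<in> ball x d \<inter> ball 0 1"
        then have y: "norm (y ^ Suc n) \<le> r ^ Suc n"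
          unfolding norm_power by (intro power_mono r(4)) auto
        then have "norm (Ln (1 + - (y ^ Suc n))) \<le> 2 * norm (- (y ^ Suc n))"
          using elim by (intro norm_Ln_le) (auto simp del: power_Suc)
        then show "norm (Ln (1 - y ^ Suc n)) \<le> 2 * r ^ Suc n"
          using y by (simp del: power_Suc)
      qed
    qed
    moreover have "summable (\<lambda>n. 2 * r ^ Suc n)" using r by (simp add: summable_mult)
    ultimately show ?thesis using r(1) by blast
  qed
  have deriv: "DERIV (\<lambda>x. Ln (1 - x ^ Suc n)) x :> - (of_nat (Suc n) * x ^ n / (1 - x ^ Suc n))"
    if "x \<in> ball 0 1" for n and x :: complex
  proof -
    have "norm (x ^ Suc n) < 1" using that norm_power_Suc_less_1 [of x] by simp
    then have "Re (1 - x ^ Suc n) > 0"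
      using complex_Re_le_cmod [of "x ^ Suc n"] by (simp del: power_Suc)
    then have "1 - x ^ Suc n \<notin> \<real>\<^sub>\<le>\<^sub>0"
      using complex_nonpos_Reals_iff by fastforce
    then show ?thesis
      by (auto intro!: derivative_eq_intros simp: divide_inverse mult_ac simp del: power_Suc)
  qed
  obtain g g' where g: "\<And>x. x \<in> ball 0 1 \<Longrightarrow> (\<lambda>n. Ln (1 - x ^ Suc n)) sums g x \<and>
       (\<lambda>n. - (of_nat (Suc n) * x ^ n / (1 - x ^ Suc n))) sums g' x \<and> DERIV g x :> g' x"
    using series_and_derivative_comparison_local [OF open_ball deriv local_bound] by blast
  have phi: "exp (g x) = euler_phi x" if "x \<in> ball 0 1" for x
  proof -
    have "exp (g x) = (\<Prod>n. exp (Ln (1 - x ^ Suc n)))"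
      using prodinf_exp [of "\<lambda>n. Ln (1 - x ^ Suc n)"] g [OF that] by (simp add: sums_iff)
    then show ?thesis
      using one_minus_power_nonzero [of x] that by (simp add: euler_phi_def del: power_Suc)
  qed
  have q: "q \<in> ball 0 1" using assms by simp
  have "DERIV (\<lambda>x. exp (g x)) q :> exp (g q) * g' q"
    using g [OF q] by (auto intro!: derivative_eq_intros)
  then have D: "DERIV euler_phi q :> - (- g' q) * euler_phi q"
    using has_field_derivative_transform_within_open [OF _ open_ball q phi] by (fastforce simp: phi [OF q] mult.commute)
  have "(\<lambda>n. of_nat (Suc n) * q ^ n / (1 - q ^ Suc n)) sums (- g' q)"
    using sums_minus [of _ "g' q"] g [OF q] by (fastforce simp del: power_Suc)
  with D show ?thesis by (rule that [rotated])
qed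

lemma holomorphic_euler_phi: "euler_phi holomorphic_on ball 0 1"
  unfolding holomorphic_on_def
  by (metis euler_phi_has_field_derivative field_differentiable_at_within field_differentiable_def
      mem_ball_0)

lemma dedekind_eta_conv_euler_phi: "dedekind_eta z = exp (\<pi> * \<i> * z / 12) * euler_phi (nome z)"
proof -
  have "exp (2 * \<pi> * \<i> * of_nat (Suc n) * z) = nome z ^ Suc n" for n
    unfolding nome_def exp_of_nat_mult [symmetric] by (simp only: mult_ac)
  then show ?thesis
    by (simp add: dedekind_eta_def euler_phi_def mult_ac del: power_Suc)
qed

lemma norm_nome_less_1: "Im z > 0 \<Longrightarrow> norm (nome z) < 1"
  by (simp add: norm_nome)

lemma dedekind_eta_nonzero: "Im z > 0 \<Longrightarrow> dedekind_eta z \<noteq> 0"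
  by (simp add: dedekind_eta_conv_euler_phi euler_phi_nonzero norm_nome_less_1)

text \<open>Both sides are the double series of \<open>n q^(n k)\<close>.\<close>

lemma lambert_series_swap:
  fixes q :: complex
  assumes "norm q < 1" and s: "(\<lambda>n. of_nat (Suc n) * q ^ Suc n / (1 - q ^ Suc n)) sums s"
  shows "(\<lambda>k. q ^ Suc k / (1 - q ^ Suc k)^2) sums s"
proof -
  define f where "f n k = of_nat (Suc n) * (q ^ Suc n) ^ Suc k" for n k
  define r where "r = norm q"
  have r: "0 \<le> r" "r < 1" using assms by (auto simp: r_def)
  have row: "(\<lambda>k. of_nat (Suc n) * x ^ Suc k) sums (of_nat (Suc n) * x / (1 - x))"
    if "norm x < 1" for x :: "'a :: {real_normed_field, banach}" and n
    using sums_mult [OF geometric_sums [OF that], of "of_nat (Suc n) * x"] by (simp add: mult_ac)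
  have "(\<lambda>(n, k). norm (f n k)) summable_on UNIV \<times> UNIV"
  proof (rule summable_on_SigmaI)
    fix n :: nat
    have "norm (r ^ Suc n) < 1" using r by (simp add: power_less_one_iff del: power_Suc)
    from row [OF this, of n] have "(\<lambda>k. norm (f n k)) sums (real (Suc n) * r ^ Suc n / (1 - r ^ Suc n))"
      by (simp add: f_def norm_mult norm_power r_def del: power_Suc of_nat_Suc)
    then show "((\<lambda>k. case (n, k) of (n, k) \<Rightarrow> norm (f n k)) has_sum (real (Suc n) * r ^ Suc n / (1 - r ^ Suc n))) UNIV"
      by (simp add: sums_nonneg_imp_has_sum del: power_Suc of_nat_Suc)
  next
    have s: "summable (\<lambda>n. real (Suc n) * r ^ n)"
      using geometric_deriv_sums [of r] r by (auto simp: sums_iff)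
    have "summable (\<lambda>n. real (Suc n) * r ^ Suc n / (1 - r ^ Suc n))"
    proof (rule summable_comparison_test' [OF summable_divide [OF s, of "1 - r"]])
      fix n :: nat
      have "r ^ Suc n \<le> r ^ n" "r ^ Suc n \<le> r" "r ^ n \<ge> 0"
        using r by (auto simp: mult_left_le_one_le mult_left_le power_le_one)
      then have "r ^ Suc n / (1 - r ^ Suc n) \<le> r ^ n / (1 - r)"
        using r by (intro frac_le) auto
      then have "real (Suc n) * (r ^ Suc n / (1 - r ^ Suc n)) \<le> real (Suc n) * (r ^ n / (1 - r))"
        by (intro mult_left_mono) auto
      moreover have "r ^ Suc n / (1 - r ^ Suc n) \<ge> 0"
        using r \<open>r ^ Suc n \<le> r\<close> by (intro divide_nonneg_nonneg) auto
      ultimately have "norm (real (Suc n) * (r ^ Suc n / (1 - r ^ Suc n))) \<le> real (Suc n) * (r ^ n / (1 - r))"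
        by (metis abs_of_nonneg mult_nonneg_nonneg of_nat_0_le_iff real_norm_def)
      then show "norm (real (Suc n) * r ^ Suc n / (1 - r ^ Suc n)) \<le> real (Suc n) * r ^ n / (1 - r)"
        by (simp only: times_divide_eq_right)
    qed
    moreover have "real (Suc n) * r ^ Suc n / (1 - r ^ Suc n) \<ge> 0" for n
    proof -
      have "r ^ Suc n \<le> 1" using r by (intro power_le_one) auto
      then show ?thesis using r by (intro divide_nonneg_nonneg mult_nonneg_nonneg) auto
    qed
    ultimately show "(\<lambda>n. real (Suc n) * r ^ Suc n / (1 - r ^ Suc n)) summable_on UNIV"
      by (subst summable_on_UNIV_nonneg_real_iff) auto
  qed auto
  then obtain D where D: "(\<lambda>n. \<Sum>k. f n k) sums D" "(\<lambda>k. \<Sum>n. f n k) sums D"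
    using sums_swap [of f] by (metis UNIV_Times_UNIV)
  have "(\<Sum>k. f n k) = of_nat (Suc n) * q ^ Suc n / (1 - q ^ Suc n)" for n
    using row [OF norm_power_Suc_less_1 [OF assms(1), of n], of n]
    by (simp add: f_def sums_iff del: power_Suc of_nat_Suc)
  then have "D = s" using D(1) s sums_unique2 by (simp del: power_Suc of_nat_Suc)
  moreover have "(\<Sum>n. f n k) = q ^ Suc k / (1 - q ^ Suc k)^2" for k
  proof -
    have "(\<lambda>n. of_nat (Suc n) * (q ^ Suc k) ^ n) sums (1 / (1 - q ^ Suc k)^2)"
      using geometric_deriv_sums [OF norm_power_Suc_less_1 [OF assms(1), of k]] .
    from sums_mult [OF this, of "q ^ Suc k"]
    moreover have "f n k = q ^ Suc k * (of_nat (Suc n) * (q ^ Suc k) ^ n)" for n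
    proof -
      have "(q ^ Suc n) ^ Suc k = (q ^ Suc k) ^ Suc n"
        by (metis power_mult mult.commute)
      then show ?thesis unfolding f_def by (simp only: power_Suc [of "q ^ Suc k"] mult_ac)
    qed
    ultimately have "(\<lambda>n. f n k) sums (q ^ Suc k / (1 - q ^ Suc k)^2)"
      by (simp del: power_Suc of_nat_Suc)
    then show ?thesis by (simp add: sums_iff)
  qed
  ultimately show ?thesis using D(2) by simp
qed

lemma inverse_sin_squared_conv_nome:
  assumes "nome z \<noteq> 1"
  shows "(\<pi> / sin (\<pi> * z))^2 = - 4 * \<pi> ^ 2 * (nome z / (1 - nome z)^2)"
proof -
  define E where "E = exp (\<i> * (\<pi> * z))"
  have E: "E \<noteq> 0" by (simp add: E_def)
  have nome: "nome z = E^2"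
    unfolding nome_def E_def exp_double [symmetric] by (simp only: mult_ac)
  have "sin (\<pi> * z) = (E - 1 / E) / (2 * \<i>)"
    unfolding sin_exp_eq E_def exp_minus inverse_eq_divide ..
  also have "\<dots> = (E^2 - 1) / (2 * \<i> * E)"
  proof -
    have "E - 1 / E = (E^2 - 1) / E" using E by (simp add: field_simps power2_eq_square)
    then show ?thesis by (simp only: divide_divide_eq_left mult_ac)
  qed
  finally have sin: "sin (\<pi> * z) = (E^2 - 1) / (2 * \<i> * E)" .
  have "(\<pi> / sin (\<pi> * z))^2 = (\<pi> * (2 * \<i> * E))^2 / (E^2 - 1)^2"
    unfolding sin by (simp add: power_divide)
  also have "\<dots> = (\<pi> * (2 * \<i> * E))^2 / (1 - E^2)^2" by (simp only: power2_commute)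
  also have "\<dots> = - 4 * \<pi> ^ 2 * (E^2 / (1 - E^2)^2)" by (simp add: power_mult_distrib)
  finally show ?thesis by (simp only: nome)
qed

text \<open>The Lambert series from the logarithmic derivative of the product is rewritten as the
  series of \<open>q ^ k / (1 - q ^ k)^2\<close>. Up to \<open>- 4 * \<pi> ^ 2\<close> its terms are
  inverse squared sines at \<open>k * z\<close>, and for their sum the inversion is known.\<close>

lemma dedekind_eta_has_field_derivative:
  assumes z: "Im z > 0" and s: "(\<lambda>m. (\<pi> / sin (\<pi> * (of_nat (Suc m) * z)))^2) sums s"
  shows "DERIV dedekind_eta z :> (\<pi> * \<i> / 12 + \<i> / (2 * \<pi>) * s) * dedekind_eta z"
proof -
  define q where "q = nome z"
  have q: "norm q < 1" using norm_nome_less_1 [OF z] by (simp add: q_def)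
  obtain t where t: "(\<lambda>n. of_nat (Suc n) * q ^ n / (1 - q ^ Suc n)) sums t"
    "DERIV euler_phi q :> - t * euler_phi q"
    using euler_phi_has_field_derivative [OF q] .
  from sums_mult [OF t(1), of q] have "(\<lambda>n. of_nat (Suc n) * q ^ Suc n / (1 - q ^ Suc n)) sums (q * t)"
    by (simp add: mult_ac)
  from lambert_series_swap [OF q this]
  have "(\<lambda>k. - 4 * \<pi> ^ 2 * (q ^ Suc k / (1 - q ^ Suc k)^2)) sums (- 4 * \<pi> ^ 2 * (q * t))"
    by (rule sums_mult)
  moreover have "- 4 * \<pi> ^ 2 * (q ^ Suc k / (1 - q ^ Suc k)^2) = (\<pi> / sin (\<pi> * (of_nat (Suc k) * z)))^2" for k
  proof -
    have "nome (of_nat (Suc k) * z) = q ^ Suc k" unfolding q_def by (rule nome_mult_of_nat)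
    moreover have "q ^ Suc k \<noteq> 1" using one_minus_power_nonzero [OF q, of k] by auto
    ultimately show ?thesis using inverse_sin_squared_conv_nome by metis
  qed
  ultimately have "s = - 4 * \<pi> ^ 2 * (q * t)"
    using s sums_unique2 by (simp del: power_Suc of_nat_Suc)
  then have "\<i> / (2 * \<pi>) * s = - (2 * \<pi> * \<i> * (q * t))"
    by (simp add: field_simps power2_eq_square)
  moreover have "DERIV dedekind_eta z :> (\<pi> * \<i> / 12 - 2 * \<pi> * \<i> * (q * t)) * dedekind_eta z"
  proof -
    have "DERIV nome z :> 2 * \<pi> * \<i> * q"
      unfolding nome_def [abs_def] q_def by (auto intro!: derivative_eq_intros)
    from DERIV_chain2 [OF t(2) [unfolded q_def] this]
    have "DERIV (\<lambda>x. euler_phi (nome x)) z :> - t * euler_phi q * (2 * \<pi> * \<i> * q)"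
      by (simp add: q_def)
    moreover have "DERIV (\<lambda>x. exp (\<pi> * \<i> * x / 12)) z :> \<pi> * \<i> / 12 * exp (\<pi> * \<i> * z / 12)"
      by (auto intro!: derivative_eq_intros)
    ultimately have "DERIV (\<lambda>x. exp (\<pi> * \<i> * x / 12) * euler_phi (nome x)) z :> \<pi> * \<i> / 12 * exp (\<pi> * \<i> * z / 12) * euler_phi (nome z) +
        - t * euler_phi q * (2 * \<pi> * \<i> * q) * exp (\<pi> * \<i> * z / 12)"
      by (rule DERIV_mult [rotated])
    then have "DERIV dedekind_eta z :> \<pi> * \<i> / 12 * exp (\<pi> * \<i> * z / 12) * euler_phi (nome z) +
        - t * euler_phi q * (2 * \<pi> * \<i> * q) * exp (\<pi> * \<i> * z / 12)"
      by (simp only: dedekind_eta_conv_euler_phi [abs_def])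
    then show ?thesis
      by (rule DERIV_cong) (simp add: dedekind_eta_conv_euler_phi q_def ring_distribs mult_ac)
  qed
  ultimately show ?thesis by simp
qed

text \<open>On the upper half-plane \<open>- \<i> * \<tau>\<close> has positive real part, so the
  principal root is holomorphic there and fixes the branch of the factor of weight 1/2.\<close>

definition weight_factor :: "complex \<Rightarrow> complex" where
  "weight_factor \<tau> = csqrt (- \<i> * \<tau>)"

lemma weight_factor_squared [simp]: "weight_factor z ^ 2 = - \<i> * z"
  by (simp add: weight_factor_def)

lemma weight_factor_nonzero: "Im z > 0 \<Longrightarrow> weight_factor z \<noteq> 0"
  by (auto simp: weight_factor_def)

lemma weight_factor_scale:
  assumes "c > 0"
  shows "weight_factor (of_real c * z) = of_real (sqrt c) * weight_factor z"
  unfolding weight_factor_def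
proof (rule csqrt_unique)
  show "(of_real (sqrt c) * csqrt (- \<i> * z))\<^sup>2 = - \<i> * (of_real c * z)"
    using assms by (simp add: power_mult_distrib flip: of_real_power)
  show "0 < Re (of_real (sqrt c) * csqrt (- \<i> * z)) \<or>
      Re (of_real (sqrt c) * csqrt (- \<i> * z)) = 0 \<and> 0 \<le> Im (of_real (sqrt c) * csqrt (- \<i> * z))"
    using csqrt_principal [of "- \<i> * z"] assms by (auto simp: zero_less_mult_iff simp del: csqrt.simps)
qed

lemma Im_inversion_pos: "Im z > 0 \<Longrightarrow> Im (- 1 / z) > 0"
  by (auto simp: Im_divide intro!: divide_pos_pos) (metis add_pos_nonneg add_nonneg_pos power2_eq_square sum_power2_gt_zero_iff less_irrefl)

theorem dedekind_eta_inversion: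
  assumes "Im t > 0"
  shows "dedekind_eta (- 1 / t) = weight_factor t * dedekind_eta t"
proof -
  define G where "G t = dedekind_eta (- 1 / t) / (weight_factor t * dedekind_eta t)" for t
  define H where "H = {t. Im t > 0}"
  have "DERIV G z :> 0" if z: "Im z > 0" for z
  proof -
    have nz: "z \<noteq> 0" "weight_factor z \<noteq> 0" "dedekind_eta z \<noteq> 0" "dedekind_eta (- 1 / z) \<noteq> 0"
      using z weight_factor_nonzero dedekind_eta_nonzero Im_inversion_pos by auto
    obtain s where s: "(\<lambda>m. (\<pi> / sin (\<pi> * (of_nat (Suc m) * z)))^2) sums s"
      "(\<lambda>m. (\<pi> / sin (\<pi> * (of_nat (Suc m) * (- 1 / z))))^2) sums
         (z^2 * (s + \<pi> ^ 2 / 6 - \<pi> ^ 2 / (6 * z^2) - \<pi> * \<i> / z))"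
      using inverse_sin_squared_sum_inversion [OF z] .
    define a where "a = \<pi> * \<i> / 12 + \<i> / (2 * \<pi>) * s"
    define b where "b = \<pi> * \<i> / 12 + \<i> / (2 * \<pi>) *
       (z^2 * (s + \<pi> ^ 2 / 6 - \<pi> ^ 2 / (6 * z^2) - \<pi> * \<i> / z))"
    \<comment> \<open>The term \<open>\<pi> * \<i> / z\<close> caused by the order of summation
      becomes exactly the logarithmic derivative of \<open>weight_factor\<close>; the two multiples
      of \<open>\<pi> ^ 2 / 6\<close> account for the exponential prefactors of eta.\<close>
    have ab: "b / z^2 = a + 1 / (2 * z)"
      using nz(1) by (simp add: a_def b_def field_simps power2_eq_square)
    have d1: "DERIV dedekind_eta z :> a * dedekind_eta z"
      using dedekind_eta_has_field_derivative [OF z s(1)] by (simp add: a_def)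
    have "DERIV dedekind_eta (- 1 / z) :> b * dedekind_eta (- 1 / z)"
      using dedekind_eta_has_field_derivative [OF Im_inversion_pos [OF z] s(2)] by (simp add: b_def)
    moreover have "DERIV (\<lambda>z. - 1 / z) z :> 1 / z^2"
      using nz by (auto intro!: derivative_eq_intros simp: power2_eq_square)
    ultimately have "DERIV (\<lambda>z. dedekind_eta (- 1 / z)) z :> b * dedekind_eta (- 1 / z) * (1 / z^2)"
      by (rule DERIV_chain2)
    then have d2: "DERIV (\<lambda>z. dedekind_eta (- 1 / z)) z :> (a + 1 / (2 * z)) * dedekind_eta (- 1 / z)"
      by (rule DERIV_cong) (simp flip: ab)
    have "- \<i> * z \<notin> \<real>\<^sub>\<le>\<^sub>0"
      using z by (auto simp: complex_nonpos_Reals_iff)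
    then have "DERIV weight_factor z :> - \<i> / (2 * weight_factor z)"
      unfolding weight_factor_def [abs_def] by (auto intro!: derivative_eq_intros)
    moreover have "- \<i> / (2 * weight_factor z) = weight_factor z / (2 * z)"
      using nz weight_factor_squared [of z] by (simp add: field_simps power2_eq_square)
    ultimately have d3: "DERIV weight_factor z :> weight_factor z / (2 * z)"
      by simp
    show ?thesis
      unfolding G_def [abs_def]
      by (rule DERIV_cong [OF DERIV_divide [OF d2 DERIV_mult [OF d3 d1]]]) (use nz in \<open>simp_all add: field_simps\<close>)
  qed
  then have "\<exists>c. \<forall>z\<in>H. G z = c"
    by (intro has_field_derivative_zero_constant)
      (auto simp: H_def convex_halfspace_Im_gt intro: has_field_derivative_at_within)
  \<comment> \<open>The point \<open>\<i>\<close> is fixed by the inversion and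
    \<open>weight_factor \<i>\<close> is 1, which determines the constant.\<close>
  then have "G t = G \<i>" using assms by (auto simp: H_def)
  also have "\<dots> = 1"
    using dedekind_eta_nonzero [of \<i>] by (simp add: G_def weight_factor_def divide_inverse)
  finally show ?thesis
    using weight_factor_nonzero [OF assms] dedekind_eta_nonzero [OF assms] by (simp add: G_def)
qed

section \<open>The theta series\<close>

text \<open>The Jacobi constant theta_3 with nome \<open>x\<close>; the terms of index
  \<open>n\<close> and \<open>- n\<close> of the bilateral series are merged.\<close>

definition theta_series :: "complex \<Rightarrow> complex" where
  "theta_series x = 1 + 2 * (\<Sum>n. x ^ (Suc n)^2)"

text \<open>The finite q-binomial theorem: \<open>P n / (P i * P (n - i))\<close> is the Gaussian
  binomial coefficient, and the induction uses its Pascal rule \<open>cS\<close>.\<close>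

lemma cauchy_q_binomial:
  fixes Q y :: complex
  assumes "norm Q < 1"
  defines "P \<equiv> \<lambda>n. \<Prod>k<n. 1 - Q ^ Suc k"
  shows "(\<Prod>k<n. 1 + y * Q ^ k) = (\<Sum>i\<le>n. P n / (P i * P (n - i)) * Q ^ (i choose 2) * y ^ i)"
proof (induction n)
  case 0
  then show ?case by (simp add: P_def binomial_eq_0)
next
  case (Suc n)
  have P0: "P k \<noteq> 0" for k
    using one_minus_power_nonzero [OF assms(1)] by (simp add: P_def del: power_Suc)
  have PS: "P (Suc k) = P k * (1 - Q ^ Suc k)" for k
    by (simp add: P_def)
  \<comment> \<open>The extension by zero matters for \<open>i = Suc n\<close>: the Pascal rule then
    also covers the top coefficient, and the sum for \<open>n\<close> may be extended by one
    vanishing term.\<close>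
  define c where "c n i = (if i \<le> n then P n / (P i * P (n - i)) else 0)" for n i
  have c0: "c m 0 = 1" for m
  proof -
    have "P 0 = 1" by (simp add: P_def)
    then show ?thesis using P0 [of m] by (simp add: c_def)
  qed
  have cS: "c (Suc n) (Suc i) = c n (Suc i) + Q ^ (n - i) * c n i" if "i \<le> n" for i
  proof (cases "i = n")
    case True
    moreover have "P 0 = 1" by (simp add: P_def)
    ultimately show ?thesis using P0 [of n] P0 [of "Suc n"] by (simp add: c_def)
  next
    case False
    then have "i < n" using that by simp
    then obtain d where d: "n = Suc (i + d)"
      using less_imp_Suc_add by blast
    have q: "1 - Q ^ Suc i \<noteq> 0" "1 - Q ^ Suc d \<noteq> 0"
      by (rule one_minus_power_nonzero [OF assms(1)])+
    have "N * (1 - a * b) / (p * (1 - a) * (r * (1 - b))) = N / (p * (1 - a) * r) + b * (N / (p * (r * (1 - b))))"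
      if "1 - a \<noteq> 0" "1 - b \<noteq> 0" "p \<noteq> 0" "r \<noteq> 0" for N a b p r :: complex
    proof -
      have "N * (1 - a * b) = N * (1 - b) + N * (b * (1 - a))" by (simp add: algebra_simps)
      then show ?thesis using that by (simp add: add_divide_distrib mult_ac)
    qed
    from this [OF q P0 P0, of "P n" i d]
    have "P n * (1 - Q ^ Suc i * Q ^ Suc d) / (P (Suc i) * P (Suc d)) = P n / (P (Suc i) * P d) + Q ^ Suc d * (P n / (P i * P (Suc d)))"
      by (simp only: PS)
    moreover have "Q ^ Suc i * Q ^ Suc d = Q ^ Suc n"
      unfolding d power_add [symmetric] by simp
    ultimately have "P (Suc n) / (P (Suc i) * P (Suc d)) = P n / (P (Suc i) * P d) + Q ^ Suc d * (P n / (P i * P (Suc d)))"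
      by (simp only: PS [of n])
    moreover have "n - i = Suc d" "n - Suc i = d" "Suc n - Suc i = Suc d" "Suc i \<le> n" "Suc i \<le> Suc n" "i \<le> n"
      using d by auto
    ultimately show ?thesis unfolding c_def by (simp only: if_True)
  qed
  define t where "t m i = c m i * Q ^ (i choose 2) * y ^ i" for m i
  have t0: "t m 0 = 1" for m
    by (simp add: t_def c0 binomial_eq_0)
  have tS: "t (Suc n) (Suc i) = t n (Suc i) + t n i * (y * Q ^ n)" if "i \<le> n" for i
  proof -
    have "(Suc i choose 2) + (n - i) = (i choose 2) + n"
      using that by (simp add: numeral_2_eq_2)
    from arg_cong [OF this, of "\<lambda>k. Q ^ k"]
    have q: "Q ^ (Suc i choose 2) * Q ^ (n - i) = Q ^ (i choose 2) * Q ^ n"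
      by (simp only: power_add)
    have "t (Suc n) (Suc i) = t n (Suc i) + c n i * (Q ^ (Suc i choose 2) * Q ^ (n - i)) * y ^ Suc i"
      unfolding t_def cS [OF that] by (simp only: ring_distribs mult_ac)
    then show ?thesis unfolding q t_def by (simp add: mult_ac)
  qed
  have t_last: "t n (Suc n) = 0" by (simp add: t_def c_def)
  have "(\<Prod>k<Suc n. 1 + y * Q ^ k) = (\<Sum>i\<le>n. t n i) * (1 + y * Q ^ n)"
  proof -
    have "(\<Sum>i\<le>n. t n i) = (\<Sum>i\<le>n. P n / (P i * P (n - i)) * Q ^ (i choose 2) * y ^ i)"
      by (rule sum.cong) (auto simp only: t_def c_def atMost_iff if_True)
    then show ?thesis using Suc by (simp only: prod.lessThan_Suc)
  qed
  also have "\<dots> = (\<Sum>i\<le>Suc n. t n i) + (\<Sum>i\<le>n. t n i * (y * Q ^ n))"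
    by (simp add: distrib_left sum_distrib_right t_last)
  also have "\<dots> = t n 0 + ((\<Sum>i\<le>n. t n (Suc i)) + (\<Sum>i\<le>n. t n i * (y * Q ^ n)))"
    by (subst sum.atMost_Suc_shift) (rule add.assoc)
  also have "\<dots> = t (Suc n) 0 + (\<Sum>i\<le>n. t (Suc n) (Suc i))"
  proof -
    have "(\<Sum>i\<le>n. t (Suc n) (Suc i)) = (\<Sum>i\<le>n. t n (Suc i) + t n i * (y * Q ^ n))"
      by (rule sum.cong) (auto simp only: tS atMost_iff)
    then show ?thesis by (simp only: sum.distrib t0)
  qed
  also have "\<dots> = (\<Sum>i\<le>Suc n. t (Suc n) i)"
    by (rule sum.atMost_Suc_shift [symmetric])
  also have "\<dots> = (\<Sum>i\<le>Suc n. P (Suc n) / (P i * P (Suc n - i)) * Q ^ (i choose 2) * y ^ i)"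
    by (rule sum.cong) (auto simp only: t_def c_def atMost_iff if_True)
  finally show ?case .
qed

text \<open>A finite form of the Jacobi triple product. In the q-binomial theorem with base
  \<open>x^2\<close> and \<open>2 * n\<close> factors, \<open>y = x^(1 - 2n)\<close> makes the
  exponents of \<open>x\<close> run through the odd numbers from \<open>1 - 2n\<close> to
  \<open>2n - 1\<close>; the factor \<open>x^(n^2)\<close> clears the negative ones, so each
  positive odd exponent occurs twice.\<close>

lemma finite_jacobi_product:
  fixes x :: complex
  assumes x: "norm x < 1" "x \<noteq> 0"
  defines "P \<equiv> \<lambda>n. \<Prod>k<n. 1 - (x^2) ^ Suc k"
  shows "(\<Prod>k<n. 1 + x ^ (2 * k + 1))^2 =
    P (2 * n) / (P n * P n) + 2 * (\<Sum>j<n. P (2 * n) / (P (n + Suc j) * P (n - Suc j)) * x ^ (Suc j)^2)"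
proof -
  define y where "y = x / x ^ (2 * n)"
  define c where "c i = P (2 * n) / (P i * P (2 * n - i))" for i
  have Q: "norm (x^2) < 1" using x by (simp add: norm_power power_less_one_iff)
  have "(\<Prod>k<2 * n. 1 + y * (x^2) ^ k) = (\<Sum>i\<le>2 * n. c i * (x^2) ^ (i choose 2) * y ^ i)"
    using cauchy_q_binomial [OF Q, of y "2 * n"] unfolding P_def c_def by simp
  moreover have "x ^ n\<^sup>2 * (\<Prod>k<2 * n. 1 + y * (x^2) ^ k) = (\<Prod>k<n. 1 + x ^ (2 * k + 1))^2"
  proof -
    have "{..<2 * n} = {..<n} \<union> {n..<n + n}" by auto
    then have "(\<Prod>k<2 * n. 1 + y * (x^2) ^ k) = (\<Prod>k<n. 1 + y * (x^2) ^ k) * (\<Prod>k\<in>{n..<n + n}. 1 + y * (x^2) ^ k)"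
      by (simp add: prod.union_disjoint ivl_disj_int)
    also have "(\<Prod>k\<in>{n..<n + n}. 1 + y * (x^2) ^ k) = (\<Prod>k<n. 1 + x ^ (2 * k + 1))"
    proof -
      have "y * (x^2) ^ (k + n) = x ^ (2 * k + 1)" for k
      proof -
        have "(x^2) ^ (k + n) = x ^ (2 * k) * x ^ (2 * n)"
          by (simp only: power_mult [symmetric] power_add [symmetric] distrib_left)
        then show ?thesis using x by (simp add: y_def)
      qed
      then show ?thesis
        using prod.shift_bounds_nat_ivl [of "\<lambda>k. 1 + y * (x^2) ^ k" 0 n n] by (simp add: atLeast0LessThan)
    qed
    also have "(\<Prod>k<n. 1 + y * (x^2) ^ k) = (\<Prod>k<n. 1 + y * (x^2) ^ (n - Suc k))"
      by (rule prod.nat_diff_reindex [symmetric])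
    also have "\<dots> = (\<Prod>k<n. (1 + x ^ (2 * k + 1)) / x ^ (2 * k + 1))"
    proof (rule prod.cong)
      fix k assume "k \<in> {..<n}"
      then obtain d where d: "n = Suc (k + d)" by (metis lessThan_iff less_imp_Suc_add)
      have "y * (x^2) ^ (n - Suc k) = 1 / x ^ (2 * k + 1)"
      proof -
        have "2 * n = (2 * k + 1) + 1 + 2 * d" by (simp add: d)
        then have "x ^ (2 * n) = x ^ (2 * k + 1) * x * (x^2) ^ d"
          by (simp only: power_mult [symmetric] power_add power_one_right)
        moreover have "n - Suc k = d" by (simp add: d)
        ultimately show ?thesis using x by (simp add: y_def del: power_Suc)
      qed
      then show "1 + y * (x^2) ^ (n - Suc k) = (1 + x ^ (2 * k + 1)) / x ^ (2 * k + 1)"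
        using x by (simp add: field_simps)
    qed simp
    also have "\<dots> = (\<Prod>k<n. 1 + x ^ (2 * k + 1)) / x ^ n\<^sup>2"
    proof -
      have "(\<Prod>k<n. x ^ (2 * k + 1)) = x ^ n\<^sup>2"
      proof -
        have "(\<Sum>k<n. 2 * k + 1) = n\<^sup>2"
          by (induction n) (auto simp: power2_eq_square)
        then show ?thesis by (simp only: power_sum [symmetric])
      qed
      then show ?thesis by (simp add: prod_dividef)
    qed
    finally show ?thesis using x by (simp add: power2_eq_square)
  qed
  moreover have "x ^ n\<^sup>2 * (\<Sum>i\<le>2 * n. c i * (x^2) ^ (i choose 2) * y ^ i) = c n + 2 * (\<Sum>j<n. c (n + Suc j) * x ^ (Suc j)^2)"
  proof -
    define t where "t i = x ^ n\<^sup>2 * (c i * (x^2) ^ (i choose 2) * y ^ i)" for i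
    \<comment> \<open>Completing the square: the exponent is
      \<open>n^2 + i (i - 1) + i (1 - 2n) = (i - n)^2\<close>. The terms below and above the central
      index \<open>n\<close> then agree.\<close>
    have t: "t i = c i * x ^ nat ((int i - int n)^2)" for i
    proof -
      have "2 * (i choose 2) + i = i^2"
        by (induction i) (auto simp: numeral_2_eq_2)
      then have "n\<^sup>2 + (2 * (i choose 2) + i) = n\<^sup>2 + i\<^sup>2" by (simp only:)
      from arg_cong [OF this, of "power x"]
      have "x ^ n\<^sup>2 * ((x^2) ^ (i choose 2) * x ^ i) = x ^ (n\<^sup>2 + i\<^sup>2)"
        by (simp only: power_add power_mult)
      also have "n\<^sup>2 + i\<^sup>2 = nat ((int i - int n)^2) + 2 * n * i"
      proof -
        have "int (nat ((int i - int n)^2) + 2 * n * i) = (int i - int n)^2 + 2 * int n * int i" by simp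
        also have "\<dots> = int (n\<^sup>2 + i\<^sup>2)" by (simp add: power2_eq_square algebra_simps)
        finally show ?thesis by (simp only: of_nat_eq_iff)
      qed
      finally have e: "x ^ n\<^sup>2 * ((x^2) ^ (i choose 2) * x ^ i) = x ^ nat ((int i - int n)^2) * x ^ (2 * n * i)"
        by (simp only: power_add)
      have "y ^ i = x ^ i / x ^ (2 * n * i)"
        by (simp only: y_def power_divide power_mult)
      then have "t i = c i * (x ^ n\<^sup>2 * ((x^2) ^ (i choose 2) * x ^ i)) / x ^ (2 * n * i)"
        unfolding t_def by (simp only: times_divide_eq_right mult_ac)
      then show ?thesis unfolding e using x by simp
    qed
    have "x ^ n\<^sup>2 * (\<Sum>i\<le>2 * n. c i * (x^2) ^ (i choose 2) * y ^ i) = (\<Sum>i\<le>2 * n. t i)"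
      by (simp add: t_def sum_distrib_left)
    also have "\<dots> = (\<Sum>i<n. t i) + t n + (\<Sum>i\<in>{Suc n..<Suc n + n}. t i)"
    proof -
      have "{..2 * n} = {..<Suc n} \<union> {Suc n..<Suc n + n}" by auto
      then have "(\<Sum>i\<le>2 * n. t i) = (\<Sum>i<Suc n. t i) + (\<Sum>i\<in>{Suc n..<Suc n + n}. t i)"
        by (simp only: sum.union_disjoint finite_lessThan finite_atLeastLessThan ivl_disj_int)
      then show ?thesis by (simp only: sum.lessThan_Suc)
    qed
    also have "(\<Sum>i<n. t i) = (\<Sum>j<n. t (n - Suc j))"
      by (rule sum.nat_diff_reindex [symmetric])
    also have "\<dots> = (\<Sum>j<n. c (n + Suc j) * x ^ (Suc j)^2)"
    proof (rule sum.cong)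
      fix j assume "j \<in> {..<n}"
      then have j: "Suc j \<le> n" by auto
      have "nat ((int (n - Suc j) - int n)^2) = (Suc j)^2"
        using j by (simp add: of_nat_diff nat_eq_iff power2_eq_square algebra_simps)
      moreover have "c (n - Suc j) = c (n + Suc j)"
        using j by (simp add: c_def mult.commute Suc_diff_le)
      ultimately show "t (n - Suc j) = c (n + Suc j) * x ^ (Suc j)^2" by (simp only: t)
    qed simp
    also have "(\<Sum>i\<in>{Suc n..<Suc n + n}. t i) = (\<Sum>j<n. c (n + Suc j) * x ^ (Suc j)^2)"
    proof -
      have "nat ((int (j + Suc n) - int n)^2) = (Suc j)^2" for j
        by (simp add: nat_eq_iff)
      then have "t (j + Suc n) = c (n + Suc j) * x ^ (Suc j)^2" for j
        unfolding t by (simp add: add_ac)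
      then show ?thesis
        using sum.shift_bounds_nat_ivl [of t 0 "Suc n" n] by (simp add: atLeast0LessThan add_ac)
    qed
    also have "t n = c n" by (simp add: t)
    finally show ?thesis by simp
  qed
  ultimately have "(\<Prod>k<n. 1 + x ^ (2 * k + 1))^2 = c n + 2 * (\<Sum>j<n. c (n + Suc j) * x ^ (Suc j)^2)"
    by simp
  moreover have "c (n + Suc j) = P (2 * n) / (P (n + Suc j) * P (n - Suc j))" for j
    by (simp add: c_def)
  moreover have "c n = P (2 * n) / (P n * P n)" by (simp add: c_def mult_2)
  ultimately show ?thesis by simp
qed

lemma euler_phi_LIMSEQ:
  assumes "norm q < 1"
  shows "(\<lambda>n. \<Prod>k<n. 1 - q ^ Suc k) \<longlonglongrightarrow> euler_phi q"
proof -
  have "(\<lambda>n. \<Prod>k\<le>n. 1 - q ^ Suc k) \<longlonglongrightarrow> euler_phi q"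
    unfolding euler_phi_def by (rule convergent_prod_LIMSEQ [OF convergent_euler_phi [OF assms]])
  then have "(\<lambda>n. \<Prod>k<Suc n. 1 - q ^ Suc k) \<longlonglongrightarrow> euler_phi q"
    by (simp only: lessThan_Suc_atMost)
  then show ?thesis by (rule LIMSEQ_imp_Suc)
qed

lemma theta_series_eq_product:
  fixes x :: complex
  assumes x: "norm x < 1" "x \<noteq> 0"
  shows "theta_series x = euler_phi (x^2) ^ 5 / (euler_phi x ^ 2 * euler_phi (x^4) ^ 2)"
proof -
  let ?b = "euler_phi (x^2)" and ?c = "euler_phi (x^4)"
  define P where "P q n = (\<Prod>k<n. 1 - q ^ Suc k)" for q :: complex and n
  define R where "R n = (\<Prod>k<n. 1 + x ^ (2 * k + 1))" for n
  have x2: "norm (x^2) < 1" "norm (x^4) < 1" using x by (simp_all add: norm_power power_less_one_iff)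
  have nz: "euler_phi x \<noteq> 0" "?b \<noteq> 0" "?c \<noteq> 0"
    using x x2 by (simp_all add: euler_phi_nonzero)
  have lim: "P q \<longlonglongrightarrow> euler_phi q" if "norm q < 1" for q
    unfolding P_def [abs_def] using euler_phi_LIMSEQ [OF that] .
  have P0: "P q n \<noteq> 0" if "norm q < 1" for q n
    using one_minus_power_nonzero [OF that] by (simp add: P_def del: power_Suc)
  have double: "filterlim (\<lambda>n::nat. 2 * n) at_top sequentially"
    by (rule filterlim_subseq) (auto simp: strict_mono_def)
  have lim2: "(\<lambda>n. P q (2 * n)) \<longlonglongrightarrow> euler_phi q" if "norm q < 1" for q
    by (rule filterlim_compose [OF lim [OF that] double])
  \<comment> \<open>In \<open>P x (2 * n)\<close> the even exponents form \<open>P (x^2) n\<close>,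
    and the odd ones combine with \<open>R n\<close> to the factors
    \<open>1 - x^(2 (2k + 1))\<close>, which \<open>P (x^4) n\<close> completes to
    \<open>P (x^2) (2 * n)\<close>. The limit of \<open>R\<close> is therefore a quotient of Euler
    products.\<close>
  have R_eq: "R n * P x (2 * n) * P (x^4) n = P (x^2) (2 * n) * P (x^2) n" for n
  proof (induction n)
    case 0
    then show ?case by (simp add: R_def P_def)
  next
    case (Suc n)
    have s: "P q (2 * Suc n) = P q (2 * n) * (1 - q ^ (2 * n + 1)) * (1 - q ^ (2 * n + 2))"
         "P q (Suc n) = P q n * (1 - q ^ (n + 1))" "R (Suc n) = R n * (1 + x ^ (2 * n + 1))" for q
      by (simp_all add: P_def R_def)
    have sq: "(x^2) ^ k = x ^ k * x ^ k" for k
      by (induction k) (auto simp: power2_eq_square mult_ac)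
    have e1: "1 - (x^2) ^ (2 * n + 1) = (1 - x ^ (2 * n + 1)) * (1 + x ^ (2 * n + 1))"
      unfolding sq by (simp add: algebra_simps)
    have "4 * (n + 1) = 2 * (2 * n + 2)" "2 * (n + 1) = 2 * n + 2" by simp_all
    then have e2: "(x^4) ^ (n + 1) = (x^2) ^ (2 * n + 2)" "(x^2) ^ (n + 1) = x ^ (2 * n + 2)"
      by (simp_all only: power_mult [symmetric])
    note e = e1 e2
    have "\<lbrakk>r * a * b = c * d\<rbrakk> \<Longrightarrow> (r * u) * (a * v * (1 - w)) * (b * (1 - z)) = c * (v * u) * (1 - z) * (d * (1 - w))"
      for a b c d r u v w z :: complex
      by algebra
    from this [OF Suc] show ?case unfolding s e .
  qed
  have "(\<lambda>n. P (x^2) (2 * n) * P (x^2) n / (P x (2 * n) * P (x^4) n)) \<longlonglongrightarrow>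
     ?b * ?b / (euler_phi x * ?c)"
    using nz x x2 by (intro tendsto_divide tendsto_mult lim lim2 no_zero_divisors) simp_all
  moreover have "R n = P (x^2) (2 * n) * P (x^2) n / (P x (2 * n) * P (x^4) n)" for n
    using R_eq [of n] P0 x x2 by (simp add: field_simps)
  then have "R = (\<lambda>n. P (x^2) (2 * n) * P (x^2) n / (P x (2 * n) * P (x^4) n))" by (rule ext)
  ultimately have R_lim: "R \<longlonglongrightarrow> ?b ^ 2 / (euler_phi x * ?c)"
    by (simp only: power2_eq_square [of "euler_phi (x\<^sup>2)"])

  \<comment> \<open>Filling up with zeros turns the finite sums into series over all
    \<open>j\<close>, to which Tannery's theorem applies. The Gaussian coefficients are bounded
    uniformly, because the \<open>P (x^2) n\<close> and their inverses converge.\<close>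
  define a where "a j n = (if j < n then P (x^2) (2 * n) / (P (x^2) (n + Suc j) * P (x^2) (n - Suc j)) * x ^ (Suc j)^2 else 0)" for j n
  have a_lim: "(\<lambda>n. a j n) \<longlonglongrightarrow> x ^ (Suc j)^2 / ?b" for j
  proof -
    have "(\<lambda>n. P (x^2) (2 * n) / (P (x^2) (n + Suc j) * P (x^2) (n - Suc j)) * x ^ (Suc j)^2) \<longlonglongrightarrow>
      ?b / (?b * ?b) * x ^ (Suc j)^2"
    proof (intro tendsto_divide tendsto_mult tendsto_const lim2 x2 no_zero_divisors nz)
      show "(\<lambda>n. P (x^2) (n + Suc j)) \<longlonglongrightarrow> ?b"
        by (rule LIMSEQ_ignore_initial_segment [OF lim [OF x2(1)]])
      show "(\<lambda>n. P (x^2) (n - Suc j)) \<longlonglongrightarrow> ?b"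
        by (rule filterlim_compose [OF lim [OF x2(1)] filterlim_minus_const_nat_at_top])
    qed
    moreover have "eventually (\<lambda>n. P (x^2) (2 * n) / (P (x^2) (n + Suc j) * P (x^2) (n - Suc j)) * x ^ (Suc j)^2 = a j n) sequentially"
      using eventually_gt_at_top [of j] by eventually_elim (simp add: a_def)
    ultimately have "(\<lambda>n. a j n) \<longlonglongrightarrow> ?b / (?b * ?b) * x ^ (Suc j)^2"
      by (rule Lim_transform_eventually)
    then show ?thesis using nz by simp
  qed
  obtain K1 where K1: "\<And>n. norm (P (x^2) n) \<le> K1"
    using convergent_imp_Bseq [OF convergentI [OF lim [OF x2(1)]]] by (auto simp: Bseq_def)
  have "(\<lambda>n. inverse (P (x^2) n)) \<longlonglongrightarrow> inverse (?b)"
    by (intro tendsto_intros lim x2 nz)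
  then obtain K2 where K2: "\<And>n. norm (inverse (P (x^2) n)) \<le> K2"
    using convergent_imp_Bseq [OF convergentI] by (fastforce simp: Bseq_def)
  have K0: "K1 \<ge> 0" "K2 \<ge> 0" using K1 K2 by (meson norm_ge_zero order_trans)+
  have a_bound: "norm (a j n) \<le> K1 * (K2 * K2) * norm x ^ Suc j" for j n
  proof (cases "j < n")
    case True
    have "norm x ^ (Suc j)^2 \<le> norm x ^ Suc j"
      using x by (intro power_decreasing) (auto simp: power2_eq_square)
    then have "norm (P (x^2) (2 * n)) * (norm (inverse (P (x^2) (n + Suc j))) * norm (inverse (P (x^2) (n - Suc j)))) * norm x ^ (Suc j)^2 \<le> K1 * (K2 * K2) * norm x ^ Suc j"
      by (intro mult_mono K1 K2) (auto simp: K0)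
    then show ?thesis using True by (simp add: a_def norm_mult norm_power divide_inverse del: power_Suc)
  next
    case False
    then show ?thesis using K0 by (simp add: a_def)
  qed
  have "eventually (\<lambda>(k,n). norm (a k n) \<le> K1 * (K2 * K2) * norm x ^ Suc k) (at_top \<times>\<^sub>F sequentially)"
    using a_bound by (intro always_eventually) auto
  moreover have "summable (\<lambda>k. K1 * (K2 * K2) * norm x ^ Suc k)"
    using x by (intro summable_mult) (simp add: summable_mult)
  ultimately have tan: "summable (\<lambda>j. norm (x ^ (Suc j)^2 / ?b))"
      "(\<lambda>n. \<Sum>j. a j n) \<longlonglongrightarrow> (\<Sum>j. x ^ (Suc j)^2 / ?b)"
    using tannerys_theorem [OF a_lim] by auto
  have "R n ^ 2 = P (x^2) (2 * n) / (P (x^2) n * P (x^2) n) + 2 * (\<Sum>j. a j n)" for n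
  proof -
    have "(\<Sum>j. a j n) = (\<Sum>j<n. a j n)"
      by (rule suminf_finite) (auto simp: a_def)
    also have "\<dots> = (\<Sum>j<n. P (x^2) (2 * n) / (P (x^2) (n + Suc j) * P (x^2) (n - Suc j)) * x ^ (Suc j)^2)"
      by (rule sum.cong) (auto simp: a_def)
    finally show ?thesis using finite_jacobi_product [OF x, of n] by (simp add: R_def P_def)
  qed
  moreover have "(\<lambda>n. P (x^2) (2 * n) / (P (x^2) n * P (x^2) n) + 2 * (\<Sum>j. a j n)) \<longlonglongrightarrow>
     ?b / (?b * ?b) + 2 * (\<Sum>j. x ^ (Suc j)^2 / ?b)"
    by (intro tendsto_add tendsto_mult tendsto_divide tendsto_const tan lim2 lim x2 no_zero_divisors nz)
  ultimately have "(\<lambda>n. R n ^ 2) \<longlonglongrightarrow> ?b / (?b * ?b) + 2 * (\<Sum>j. x ^ (Suc j)^2 / ?b)"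
    by simp
  moreover have "(\<lambda>n. R n ^ 2) \<longlonglongrightarrow> (?b ^ 2 / (euler_phi x * ?c))^2"
    by (intro tendsto_intros R_lim)
  ultimately have eq: "(?b ^ 2 / (euler_phi x * ?c))^2 =
     ?b / (?b * ?b) + 2 * (\<Sum>j. x ^ (Suc j)^2 / ?b)"
    using LIMSEQ_unique by blast
  have "summable (\<lambda>j. x ^ (Suc j)^2 / ?b)"
    using tan(1) by (rule summable_norm_cancel)
  from summable_mult2 [OF this, of "?b"] have "summable (\<lambda>j. x ^ (Suc j)^2)"
    using nz by simp
  then have "(\<Sum>j. x ^ (Suc j)^2 / ?b) = (\<Sum>j. x ^ (Suc j)^2) / ?b"
    by (rule suminf_divide)
  with eq have "theta_series x = ?b * (?b ^ 2 / (euler_phi x * ?c))^2"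
    using nz by (simp add: theta_series_def field_simps)
  also have "\<dots> = ?b ^ 5 / (euler_phi x ^ 2 * ?c ^ 2)"
  proof -
    have "b * (b^2 / (a * c))^2 = b^5 / (a^2 * c^2)" for a b c :: complex
      by (simp add: power_divide power_mult_distrib eval_nat_numeral mult_ac)
    then show ?thesis .
  qed
  finally show ?thesis .
qed

text \<open>As an eta quotient the series involves arguments \<open>z / 2\<close>, \<open>z\<close>
  and \<open>2 * z\<close>; inversion exchanges the outer two. The factors from the scalings by 2
  and 1/2 cancel, and of the weight factors \<open>5 - 2 - 2 = 1\<close> remains.\<close>

lemma theta_series_inversion:
  assumes t: "Im t > 0"
  shows "theta_series (exp (\<pi> * \<i> * (- 1 / t))) = weight_factor t * theta_series (exp (\<pi> * \<i> * t))"
proof -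
  have eta: "theta_series (exp (\<pi> * \<i> * z)) = dedekind_eta z ^ 5 / (dedekind_eta (z / 2) ^ 2 * dedekind_eta (2 * z) ^ 2)"
    if z: "Im z > 0" for z
  proof -
    define x where "x = exp (\<pi> * \<i> * z)"
    define u where "u = exp (\<pi> * \<i> * z / 24)"
    have x: "norm x < 1" "x \<noteq> 0" using z by (auto simp: x_def)
    have n: "nome (z / 2) = x" "nome z = x^2" "nome (2 * z) = x^4"
      by (simp_all add: nome_def x_def mult_ac flip: exp_of_nat_mult)
    have e: "exp (\<pi> * \<i> * (z / 2) / 12) = u" "exp (\<pi> * \<i> * z / 12) = u^2"
      "exp (\<pi> * \<i> * (2 * z) / 12) = u^4" "u \<noteq> 0"
      by (simp_all add: u_def mult_ac flip: exp_of_nat_mult)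
    have "u^10 = u^2 * u^8" by (simp flip: power_add)
    then have u: "(u^2 * b) ^ 5 = u^10 * b ^ 5" "(u * a)^2 * (u^4 * c)^2 = u^10 * (a^2 * c^2)" for a b c
      by (simp_all add: power_mult_distrib mult_ac flip: power_mult)
    show ?thesis
      unfolding x_def [symmetric] theta_series_eq_product [OF x] dedekind_eta_conv_euler_phi n e u
      using e(4) by simp
  qed
  note z = Im_inversion_pos [OF t]
  have 1: "dedekind_eta (- 1 / t / 2) = weight_factor (of_real 2 * t) * dedekind_eta (2 * t)"
    using dedekind_eta_inversion [of "2 * t"] t by (simp add: mult_ac)
  have 2: "dedekind_eta (2 * (- 1 / t)) = weight_factor (of_real (1 / 2) * t) * dedekind_eta (t / 2)"
    using dedekind_eta_inversion [of "t / 2"] t by (simp add: mult_ac)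
  have s: "weight_factor (of_real 2 * t) ^ 2 = 2 * weight_factor t ^ 2" "weight_factor (of_real (1 / 2) * t) ^ 2 = weight_factor t ^ 2 / 2"
    by simp_all
  show ?thesis
    unfolding eta [OF t] eta [OF z] 1 2 dedekind_eta_inversion [OF t] power_mult_distrib s
    using weight_factor_nonzero [OF t] by (simp add: eval_nat_numeral del: weight_factor_squared)
qed

section \<open>Lacunary power series and sums over the integer lattice\<close>

lemma norm_summable_lacunary:
  fixes x :: "'a :: {real_normed_field, banach}"
  assumes "\<And>n. n \<le> e n" "norm x < 1"
  shows "summable (\<lambda>n. norm (x ^ e n))"
proof (rule summable_comparison_test')
  show "summable (\<lambda>n. norm x ^ n)" using assms by simp
  show "norm (norm (x ^ e n)) \<le> norm x ^ n" for n
    using assms by (auto simp: norm_power intro!: power_decreasing)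
qed

lemma lacunary_holomorphic:
  assumes "\<And>n. n \<le> e n"
  shows "(\<lambda>x::complex. \<Sum>n. x ^ e n) holomorphic_on ball 0 1"
proof -
  have deriv: "DERIV (\<lambda>x::complex. x ^ e n) x :> of_nat (e n) * x ^ (e n - 1)"
    if "x \<in> ball 0 1" for n x
    by (auto intro!: derivative_eq_intros)
  have local_bound: "\<exists>d h. 0 < d \<and> summable h \<and>
      (\<forall>\<^sub>F n in sequentially. \<forall>y\<in>ball x d \<inter> ball 0 1. norm (y ^ e n) \<le> h n)"
    if "x \<in> ball 0 1" for x :: complex
  proof -
    have "norm x < 1" using that by simp
    then obtain d r where r: "0 < d" "0 < r" "r < 1" "\<And>y. y \<in> ball x d \<Longrightarrow> norm y \<le> r"
      by (rule ball_subset_smaller_ball) blast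
    have "norm (y ^ e n) \<le> r ^ n" if "y \<in> ball x d \<inter> ball 0 1" for y n
    proof -
      have "norm (y ^ e n) \<le> r ^ e n"
        using that unfolding norm_power by (intro power_mono r(4)) auto
      also have "\<dots> \<le> r ^ n" using r assms by (intro power_decreasing) auto
      finally show ?thesis .
    qed
    then have "\<forall>\<^sub>F n in sequentially. \<forall>y\<in>ball x d \<inter> ball 0 1. norm (y ^ e n) \<le> r ^ n"
      by (intro always_eventually) blast
    moreover have "summable (\<lambda>n. r ^ n)" using r by simp
    ultimately show ?thesis using r(1) by blast
  qed
  have "\<exists>g g'. \<forall>x\<in>ball (0::complex) 1. (\<lambda>n. x ^ e n) sums g x \<and>
      (\<lambda>n. of_nat (e n) * x ^ (e n - 1)) sums g' x \<and> DERIV g x :> g' x"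
    by (rule series_and_derivative_comparison_local [OF open_ball deriv local_bound])
  then obtain g g' where g0: "\<forall>x\<in>ball (0::complex) 1. (\<lambda>n. x ^ e n) sums g x \<and>
      (\<lambda>n. of_nat (e n) * x ^ (e n - 1)) sums g' x \<and> DERIV g x :> g' x"
    by (elim exE)
  have g: "(\<lambda>n. x ^ e n) sums g x \<and> DERIV g x :> g' x" if "x \<in> ball 0 1" for x
    using bspec [OF g0 that] by simp
  have "g holomorphic_on ball 0 1"
    using g by (meson field_differentiable_at_within field_differentiable_def holomorphic_on_def)
  then show ?thesis
    by (rule holomorphic_transform) (use g in \<open>simp add: sums_iff\<close>)
qed

lemma has_sum_int_split:
  fixes f :: "int \<Rightarrow> 'a :: banach"
  assumes "((\<lambda>n. f (int n)) has_sum a) UNIV" "((\<lambda>n. f (- int n - 1)) has_sum b) UNIV"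
  shows "(f has_sum (a + b)) UNIV"
proof -
  have "bij_betw int UNIV {0..}"
    by (rule bij_betw_byWitness [where f' = nat]) auto
  from has_sum_reindex_bij_betw [THEN iffD1, OF this assms(1)] have 1: "(f has_sum a) {0..}" .
  have "bij_betw (\<lambda>n. - int n - 1) UNIV {..<0}"
    by (rule bij_betw_byWitness [where f' = "\<lambda>k. nat (- k - 1)"]) auto
  from has_sum_reindex_bij_betw [THEN iffD1, OF this assms(2)] have 2: "(f has_sum b) {..<0}" .
  have "(f has_sum (a + b)) ({0..} \<union> {..<0})"
    by (rule has_sum_Un_disjoint [OF 1 2]) auto
  moreover have "{0..} \<union> {..<0::int} = UNIV" by auto
  ultimately show ?thesis by simp
qed

lemma has_sum_lacunary:
  fixes x :: "'a :: {real_normed_field, banach}"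
  assumes "\<And>n. n \<le> e n" "norm x < 1"
  shows "((\<lambda>n. x ^ e n) has_sum (\<Sum>n. x ^ e n)) UNIV"
  using norm_summable_lacunary [OF assms]
  by (intro norm_summable_imp_has_sum summable_sums) (auto intro: summable_norm_cancel)

text \<open>The type is general so that the statement also applies to the real number
  \<open>norm x\<close>; this gives the absolute summability needed to multiply two such
  series.\<close>

lemma has_sum_theta_series_aux:
  fixes x :: "'a :: {real_normed_field, banach}"
  assumes "norm x < 1"
  shows "((\<lambda>n::int. x ^ nat (n^2)) has_sum (1 + 2 * (\<Sum>n. x ^ (Suc n)^2))) UNIV"
proof -
  have le: "n \<le> n^2" "n \<le> (Suc n)^2" for n
    by (simp_all add: power2_eq_square)
  have "(\<lambda>n. x ^ (Suc n)^2) sums (\<Sum>n. x ^ (Suc n)^2)"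
    by (rule summable_sums [OF summable_norm_cancel [OF norm_summable_lacunary [OF le(2) assms]]])
  then have "(\<lambda>n. x ^ n^2) sums ((\<Sum>n. x ^ (Suc n)^2) + x ^ 0^2)"
    by (rule sums_Suc_iff [of "\<lambda>n. x ^ n^2", THEN iffD1])
  from sums_unique [OF this] have "(\<Sum>n. x ^ n^2) = (\<Sum>n. x ^ (Suc n)^2) + 1"
    by simp
  moreover have "((\<lambda>n. x ^ n^2) has_sum (\<Sum>n. x ^ n^2)) UNIV"
    by (rule has_sum_lacunary [OF le(1) assms])
  moreover have "nat ((int n)^2) = n^2" for n
    by (simp only: of_nat_power [symmetric] nat_int)
  ultimately have 1: "((\<lambda>n. x ^ nat ((int n)^2)) has_sum ((\<Sum>n. x ^ (Suc n)^2) + 1)) UNIV"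
    by (simp only:)
  have "(- int n - 1)^2 = int ((Suc n)^2)" for n
    by (simp add: power2_eq_square algebra_simps)
  then have "nat ((- int n - 1)^2) = (Suc n)^2" for n
    by (simp only: nat_int)
  moreover have "((\<lambda>n. x ^ (Suc n)^2) has_sum (\<Sum>n. x ^ (Suc n)^2)) UNIV"
    by (rule has_sum_lacunary [OF le(2) assms])
  ultimately have 2: "((\<lambda>n. x ^ nat ((- int n - 1)^2)) has_sum (\<Sum>n. x ^ (Suc n)^2)) UNIV"
    by (simp only:)
  show ?thesis
    using has_sum_int_split [where f = "\<lambda>n. x ^ nat (n^2)", OF 1 2] by (simp only: add_ac mult_2)
qed

lemma has_sum_theta_series:
  "norm x < 1 \<Longrightarrow> ((\<lambda>n::int. x ^ nat (n^2)) has_sum theta_series x) UNIV"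
  unfolding theta_series_def by (rule has_sum_theta_series_aux)

text \<open>The series of \<open>x^((n+1/2)^2)\<close> without its factor \<open>x^(1/4)\<close>.\<close>

definition half_theta_series :: "complex \<Rightarrow> complex" where
  "half_theta_series x = 2 * (\<Sum>n. x ^ (n^2 + n))"

lemma has_sum_half_theta_series_aux:
  fixes x :: "'a :: {real_normed_field, banach}"
  assumes "norm x < 1"
  shows "((\<lambda>n::int. x ^ nat (n^2 + n)) has_sum (2 * (\<Sum>n. x ^ (n^2 + n)))) UNIV"
proof -
  have "((\<lambda>n. x ^ (n^2 + n)) has_sum (\<Sum>n. x ^ (n^2 + n))) UNIV"
    by (rule has_sum_lacunary) (use assms in auto)
  moreover have "(int n)^2 + int n = int (n^2 + n)" "(- int n - 1)^2 + (- int n - 1) = int (n^2 + n)" for n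
    by (simp_all add: power2_eq_square algebra_simps)
  then have "nat ((int n)^2 + int n) = n^2 + n" "nat ((- int n - 1)^2 + (- int n - 1)) = n^2 + n" for n
    by (simp_all only: nat_int)
  ultimately have "((\<lambda>n. x ^ nat ((int n)^2 + int n)) has_sum (\<Sum>n. x ^ (n^2 + n))) UNIV"
    "((\<lambda>n. x ^ nat ((- int n - 1)^2 + (- int n - 1))) has_sum (\<Sum>n. x ^ (n^2 + n))) UNIV"
    by (simp_all only:)
  from has_sum_int_split [where f = "\<lambda>n. x ^ nat (n^2 + n)", OF this] show ?thesis by (simp only: mult_2)
qed

lemma has_sum_half_theta_series:
  "norm x < 1 \<Longrightarrow> ((\<lambda>n::int. x ^ nat (n^2 + n)) has_sum half_theta_series x) UNIV"
  unfolding half_theta_series_def by (rule has_sum_half_theta_series_aux)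

lemma nat_square_plus: "0 \<le> (n::int)^2 + n"
proof -
  have "n^2 + n = n * (n + 1)" by (simp add: power2_eq_square algebra_simps)
  then show ?thesis by (cases "n \<ge> 0") (auto simp: zero_le_mult_iff)
qed

text \<open>Even and odd indices are separated by \<open>(2k)^2 = 4 k^2\<close> and
  \<open>(2k + 1)^2 = 1 + 4 (k^2 + k)\<close>. In this way the half-integral series is a difference
  of two values of \<open>theta_series\<close>, and its inversion needs no separate proof.\<close>

lemma theta_series_quadrisection:
  assumes "norm y < 1"
  shows "theta_series y = theta_series (y^4) + y * half_theta_series (y^4)"
proof -
  have y4: "norm (y^4) < 1" using assms by (simp add: norm_power power_less_one_iff)
  have "bij_betw (\<lambda>k::int. 2 * k) UNIV {n. even n}"
    by (rule bij_betw_byWitness [where f' = "\<lambda>k. k div 2"]) auto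
  moreover have "y ^ nat ((2 * k)^2) = (y^4) ^ nat (k^2)" for k :: int
    by (simp add: nat_mult_distrib power_mult)
  then have "((\<lambda>k. y ^ nat ((2 * k)^2)) has_sum theta_series (y^4)) UNIV"
    using has_sum_theta_series [OF y4] by simp
  ultimately have 1: "((\<lambda>n. y ^ nat (n^2)) has_sum theta_series (y^4)) {n. even n}"
    by (simp add: has_sum_reindex_bij_betw [where g = "\<lambda>k. 2 * k" and f = "\<lambda>n. y ^ nat (n^2)", symmetric])
  have "bij_betw (\<lambda>k::int. 2 * k + 1) UNIV {n. odd n}"
    by (rule bij_betw_byWitness [where f' = "\<lambda>k. k div 2"]) auto
  moreover have "y ^ nat ((2 * k + 1)^2) = y * (y^4) ^ nat (k^2 + k)" for k :: int
  proof -
    have "(2 * k + 1)^2 = 1 + 4 * (k^2 + k)" by (simp add: power2_eq_square algebra_simps)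
    then have "nat ((2 * k + 1)^2) = 1 + 4 * nat (k^2 + k)"
      using nat_square_plus [of k] by (simp add: nat_eq_iff)
    then show ?thesis by (simp only: power_add power_mult power_one_right)
  qed
  then have "((\<lambda>k. y ^ nat ((2 * k + 1)^2)) has_sum y * half_theta_series (y^4)) UNIV"
    using has_sum_cmult_right [OF has_sum_half_theta_series [OF y4], of y] by simp
  ultimately have 2: "((\<lambda>n. y ^ nat (n^2)) has_sum y * half_theta_series (y^4)) {n. odd n}"
    by (simp add: has_sum_reindex_bij_betw [where g = "\<lambda>k. 2 * k + 1" and f = "\<lambda>n. y ^ nat (n^2)", symmetric])
  have "((\<lambda>n. y ^ nat (n^2)) has_sum (theta_series (y^4) + y * half_theta_series (y^4))) ({n. even n} \<union> {n. odd n})"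
    by (rule has_sum_Un_disjoint [OF 1 2]) auto
  moreover have "{n. even n} \<union> {n::int. odd n} = UNIV" by auto
  ultimately show ?thesis
    using has_sum_theta_series [OF assms] has_sum_unique by (metis (no_types, lifting))
qed

lemma has_sum_times:
  fixes f :: "'a \<Rightarrow> complex" and g :: "'b \<Rightarrow> complex"
  assumes f: "(f has_sum a) A" "(\<lambda>x. norm (f x)) summable_on A"
    and g: "(g has_sum b) B" "(\<lambda>x. norm (g x)) summable_on B"
  shows "((\<lambda>(x, y). f x * g y) has_sum (a * b)) (A \<times> B)"
proof (rule has_sum_SigmaI)
  show "((\<lambda>y. case (x, y) of (x, y) \<Rightarrow> f x * g y) has_sum (f x * b)) B" for x
    using has_sum_cmult_right [OF g(1), of "f x"] by simp
  show "((\<lambda>x. f x * b) has_sum a * b) A"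
    by (rule has_sum_cmult_left [OF f(1)])
  have "(\<lambda>(x, y). norm (f x) * norm (g y)) summable_on A \<times> B"
  proof (rule summable_on_SigmaI)
    show "((\<lambda>y. case (x, y) of (x, y) \<Rightarrow> norm (f x) * norm (g y)) has_sum (norm (f x) * infsum (\<lambda>y. norm (g y)) B)) B" for x
      using has_sum_cmult_right [OF has_sum_infsum [OF g(2)], of "norm (f x)"] by simp
    show "(\<lambda>x. norm (f x) * infsum (\<lambda>y. norm (g y)) B) summable_on A"
      by (rule summable_on_cmult_left [OF f(2)])
  qed auto
  then show "(\<lambda>(x, y). f x * g y) summable_on A \<times> B"
    by (intro abs_summable_summable [of "\<lambda>(x, y). f x * g y"]) (simp add: case_prod_unfold norm_mult)
qed

text \<open>The classical formula
  \<open>a = theta_3(q) theta_3(q^3) + theta_2(q) theta_2(q^3)\<close>; the omitted factors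
  \<open>q^(1/4)\<close> and \<open>q^(3/4)\<close> of the two theta_2 combine to the explicit
  \<open>q\<close>.\<close>

definition cubic_theta_nome :: "complex \<Rightarrow> complex" where
  "cubic_theta_nome q = theta_series q * theta_series (q^3) + q * half_theta_series q * half_theta_series (q^3)"

lemma cubic_theta_a_conv_nome:
  assumes "Im z > 0"
  shows "cubic_theta_a z = cubic_theta_nome (nome z)"
proof -
  define q where "q = nome z"
  define F where "F = (\<lambda>(m::int, n::int). q powi (m^2 + m * n + n^2))"
  have q: "norm q < 1" "norm (q^3) < 1" "q \<noteq> 0"
    using norm_nome_less_1 [OF assms] by (simp_all add: q_def norm_power power_less_one_iff)
  have powi: "q powi k = q ^ nat k" if "k \<ge> 0" for k
    using that by (simp add: power_int_def)
  have abs: "(\<lambda>n::int. norm (x ^ nat (n^2))) summable_on UNIV"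
      "(\<lambda>n::int. norm (x ^ nat (n^2 + n))) summable_on UNIV" if "norm x < 1" for x :: complex
    using has_sum_theta_series_aux [of "norm x"] has_sum_half_theta_series_aux [of "norm x"] that
    by (auto simp: norm_power intro: has_sum_imp_summable)
  \<comment> \<open>Completing the square in \<open>m^2 + m n + n^2\<close> requires half of
    \<open>n\<close>, hence the split by parity. With \<open>u = m + n div 2\<close> the form
    becomes \<open>u^2 + 3 k^2\<close> for \<open>n = 2k\<close> and
    \<open>1 + (u^2 + u) + 3 (k^2 + k)\<close> for \<open>n = 2k + 1\<close>.\<close>
  have b1: "bij_betw (\<lambda>(u, k). (u - k, 2 * k)) (UNIV \<times> UNIV) {(m::int, n::int). even n}"
    by (rule bij_betw_byWitness [where f' = "\<lambda>(m, n). (m + n div 2, n div 2)"]) auto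
  have "F (case p of (u, k) \<Rightarrow> (u - k, 2 * k)) = (case p of (u, k) \<Rightarrow> q ^ nat (u^2) * (q^3) ^ nat (k^2))" for p
  proof (cases p)
    case (Pair u k)
    have e: "(u - k)^2 + (u - k) * (2 * k) + (2 * k)^2 = u^2 + 3 * k^2"
      by (simp add: power2_eq_square algebra_simps)
    have "nat (u^2 + 3 * k^2) = nat (u^2) + 3 * nat (k^2)"
      by (simp add: nat_add_distrib nat_mult_distrib)
    moreover have "0 \<le> u^2 + 3 * k^2" by simp
    ultimately show ?thesis
      by (simp only: Pair F_def prod.case e powi power_add power_mult)
  qed
  then have "((\<lambda>p. F (case p of (u, k) \<Rightarrow> (u - k, 2 * k))) has_sum theta_series q * theta_series (q^3)) (UNIV \<times> UNIV)"
    using has_sum_times [OF has_sum_theta_series [OF q(1)] abs(1) [OF q(1)] has_sum_theta_series [OF q(2)] abs(1) [OF q(2)]]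
    by simp
  then have 1: "(F has_sum theta_series q * theta_series (q^3)) {(m::int, n::int). even n}"
    using has_sum_reindex_bij_betw [OF b1, of F] by simp
  have b2: "bij_betw (\<lambda>(u, k). (u - k, 2 * k + 1)) (UNIV \<times> UNIV) {(m::int, n::int). odd n}"
    by (rule bij_betw_byWitness [where f' = "\<lambda>(m, n). (m + n div 2, n div 2)"]) auto
  have "F (case p of (u, k) \<Rightarrow> (u - k, 2 * k + 1)) = q * (case p of (u, k) \<Rightarrow> q ^ nat (u^2 + u) * (q^3) ^ nat (k^2 + k))" for p
  proof (cases p)
    case (Pair u k)
    have e: "(u - k)^2 + (u - k) * (2 * k + 1) + (2 * k + 1)^2 = 1 + (u^2 + u) + 3 * (k^2 + k)"
      by (simp add: power2_eq_square algebra_simps)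
    have "nat (1 + (u^2 + u) + 3 * (k^2 + k)) = 1 + nat (u^2 + u) + 3 * nat (k^2 + k)"
      using nat_square_plus [of u] nat_square_plus [of k] by (simp add: nat_eq_iff)
    moreover have "0 \<le> 1 + (u^2 + u) + 3 * (k^2 + k)"
      using nat_square_plus [of u] nat_square_plus [of k] by simp
    ultimately show ?thesis
      by (simp only: Pair F_def prod.case e powi power_add power_mult power_one_right mult.assoc)
  qed
  then have "((\<lambda>p. F (case p of (u, k) \<Rightarrow> (u - k, 2 * k + 1))) has_sum q * (half_theta_series q * half_theta_series (q^3))) (UNIV \<times> UNIV)"
    using has_sum_cmult_right [OF has_sum_times [OF has_sum_half_theta_series [OF q(1)] abs(2) [OF q(1)]
          has_sum_half_theta_series [OF q(2)] abs(2) [OF q(2)]], of q]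
    by simp
  then have 2: "(F has_sum q * (half_theta_series q * half_theta_series (q^3))) {(m::int, n::int). odd n}"
    using has_sum_reindex_bij_betw [OF b2, of F] by simp
  have "(F has_sum (theta_series q * theta_series (q^3) + q * (half_theta_series q * half_theta_series (q^3))))
     ({(m, n). even n} \<union> {(m, n). odd n})"
    by (rule has_sum_Un_disjoint [OF 1 2]) auto
  moreover have "{(m::int, n::int). even n} \<union> {(m, n). odd n} = UNIV" by auto
  ultimately have "(F has_sum cubic_theta_nome q) UNIV"
    by (simp add: cubic_theta_nome_def mult_ac)
  then show ?thesis
    unfolding cubic_theta_a_def F_def q_def nome_def by (rule infsumI)
qed

text \<open>After quadrisection only theta_3 values at \<open>2z\<close>, \<open>6z\<close>,
  \<open>z/2\<close> and \<open>3z/2\<close> occur. The map permutes them up to factors, and the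
  bilinear expression is reproduced because the constants pair up to \<open>s/2\<close>,
  \<open>2s\<close>, \<open>s\<close>, \<open>s\<close> with \<open>s = sqrt 3\<close>.\<close>

theorem cubic_theta_a_inversion:
  assumes "Im \<tau> > 0"
  shows "cubic_theta_a (- 1 / (3 * \<tau>)) = \<surd>3 * (- \<i> * \<tau>) * cubic_theta_a \<tau>"
proof -
  define t where "t z = theta_series (exp (\<pi> * \<i> * z))" for z
  have A: "cubic_theta_a z = t (2 * z) * t (6 * z) + (t (z / 2) - t (2 * z)) * (t (3 * z / 2) - t (6 * z))"
    if z: "Im z > 0" for z
  proof -
    define y where "y = exp (\<pi> * \<i> * (z / 2))"
    have y: "norm y < 1" using z by (simp add: y_def)
    then have y3: "norm (y^3) < 1" by (simp add: norm_power power_less_one_iff)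
    have n: "nome z = y^4" and t: "t (2 * z) = theta_series (y^4)" "t (6 * z) = theta_series ((y^3)^4)"
      "t (z / 2) = theta_series y" "t (3 * z / 2) = theta_series (y^3)"
      by (simp_all add: nome_def t_def y_def mult_ac flip: exp_of_nat_mult)
    have "(y^4)^3 = (y^3)^4" by (simp flip: power_mult)
    then have "cubic_theta_a z = theta_series (y^4) * theta_series ((y^3)^4) +
        (y * half_theta_series (y^4)) * (y^3 * half_theta_series ((y^3)^4))"
      by (simp add: cubic_theta_a_conv_nome [OF z] cubic_theta_nome_def n eval_nat_numeral mult_ac)
    also have "y * half_theta_series (y^4) = t (z / 2) - t (2 * z)"
      unfolding t theta_series_quadrisection [OF y] by simp
    also have "y^3 * half_theta_series ((y^3)^4) = t (3 * z / 2) - t (6 * z)"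
      unfolding t theta_series_quadrisection [OF y3] by simp
    finally show ?thesis unfolding t .
  qed
  have inv: "t (- 1 / z) = weight_factor z * t z" if "Im z > 0" for z
    using theta_series_inversion [OF that] by (simp only: t_def)
  define w where "w = weight_factor \<tau>"
  have w: "w * w = - \<i> * \<tau>"
    using weight_factor_squared [of \<tau>] by (simp only: w_def power2_eq_square)
  have sc: "weight_factor (3 / 2 * \<tau>) = of_real (sqrt (3 / 2)) * w" "weight_factor (\<tau> / 2) = of_real (sqrt (1 / 2)) * w"
     "weight_factor (6 * \<tau>) = of_real (sqrt 6) * w" "weight_factor (2 * \<tau>) = of_real (sqrt 2) * w"
    using weight_factor_scale [of "3 / 2" \<tau>] weight_factor_scale [of "1 / 2" \<tau>]
      weight_factor_scale [of 6 \<tau>] weight_factor_scale [of 2 \<tau>] by (simp_all add: w_def)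
  have i1: "t (2 * (- 1 / (3 * \<tau>))) = of_real (sqrt (3 / 2)) * w * t (3 * \<tau> / 2)"
    using inv [of "3 / 2 * \<tau>"] assms unfolding sc by (simp add: mult_ac)
  have i2: "t (6 * (- 1 / (3 * \<tau>))) = of_real (sqrt (1 / 2)) * w * t (\<tau> / 2)"
    using inv [of "\<tau> / 2"] assms unfolding sc by (simp add: mult_ac)
  have i3: "t ((- 1 / (3 * \<tau>)) / 2) = of_real (sqrt 6) * w * t (6 * \<tau>)"
    using inv [of "6 * \<tau>"] assms unfolding sc by (simp add: mult_ac)
  have i4: "t (3 * (- 1 / (3 * \<tau>)) / 2) = of_real (sqrt 2) * w * t (2 * \<tau>)"
    using inv [of "2 * \<tau>"] assms unfolding sc by (simp add: mult_ac)
  have sq: "sqrt (3 / 2) * sqrt (1 / 2) = sqrt 3 / 2" "sqrt 6 * sqrt 2 = 2 * sqrt 3"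
    "sqrt 6 * sqrt (1 / 2) = sqrt 3" "sqrt (3 / 2) * sqrt 2 = sqrt 3"
  proof -
    have "sqrt 6 = sqrt 3 * sqrt 2" by (simp flip: real_sqrt_mult)
    then show "sqrt (3 / 2) * sqrt (1 / 2) = sqrt 3 / 2" "sqrt 6 * sqrt 2 = 2 * sqrt 3"
      "sqrt 6 * sqrt (1 / 2) = sqrt 3" "sqrt (3 / 2) * sqrt 2 = sqrt 3"
      by (simp_all add: real_sqrt_divide)
  qed
  have csq: "complex_of_real (sqrt (3 / 2)) * of_real (sqrt (1 / 2)) = \<surd>3 / 2"
    "complex_of_real (sqrt 6) * of_real (sqrt 2) = 2 * \<surd>3"
    "complex_of_real (sqrt 6) * of_real (sqrt (1 / 2)) = \<surd>3"
    "complex_of_real (sqrt (3 / 2)) * of_real (sqrt 2) = \<surd>3"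
    unfolding of_real_mult [symmetric] sq by simp_all
  have key: "(s1 * w * d) * (s2 * w * c) + (s3 * w * b - s1 * w * d) * (s4 * w * a - s2 * w * c) =
      s * (w * w) * (a * b + (c - a) * (d - b))"
    if "s1 * s2 = s / 2" "s3 * s4 = 2 * s" "s3 * s2 = s" "s1 * s4 = s" for s1 s2 s3 s4 s w a b c d :: complex
  proof -
    have "(s1 * w * d) * (s2 * w * c) + (s3 * w * b - s1 * w * d) * (s4 * w * a - s2 * w * c) =
      (w * w) * (2 * (s1 * s2) * (c * d) + (s3 * s4) * (a * b) - (s3 * s2) * (b * c) - (s1 * s4) * (a * d))"
      by (simp add: algebra_simps)
    also have "\<dots> = s * (w * w) * (a * b + (c - a) * (d - b))"
      unfolding that by (simp add: algebra_simps)
    finally show ?thesis .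
  qed
  have "Im (- 1 / (3 * \<tau>)) > 0"
    using Im_inversion_pos [of "3 * \<tau>"] assms by simp
  from A [OF this] show ?thesis
    unfolding i1 i2 i3 i4 A [OF assms] key [OF csq] w .
qed

section \<open>Holomorphy in the nome and the first coefficients\<close>

lemma holomorphic_compose_power:
  assumes "f holomorphic_on ball 0 1" "n > 0"
  shows "(\<lambda>q::complex. f (q ^ n)) holomorphic_on ball 0 1"
proof -
  have "(\<lambda>q::complex. q ^ n) ` ball 0 1 \<subseteq> ball 0 1"
    using assms(2) by (auto simp: norm_power power_less_one_iff)
  moreover have "(\<lambda>q::complex. q ^ n) holomorphic_on ball 0 1"
    by (intro holomorphic_intros)
  ultimately show ?thesis
    using holomorphic_on_compose_gen [OF _ assms(1)] unfolding o_def by blast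
qed

lemma holomorphic_theta_series: "theta_series holomorphic_on ball 0 1"
  unfolding theta_series_def [abs_def]
  by (intro holomorphic_intros lacunary_holomorphic) (simp add: power2_eq_square)

lemma holomorphic_half_theta_series: "half_theta_series holomorphic_on ball 0 1"
  unfolding half_theta_series_def [abs_def]
  by (intro holomorphic_intros lacunary_holomorphic) simp

lemma holomorphic_cubic_theta_nome: "cubic_theta_nome holomorphic_on ball 0 1"
  unfolding cubic_theta_nome_def [abs_def]
  by (intro holomorphic_on_add holomorphic_on_mult holomorphic_on_ident holomorphic_theta_series
      holomorphic_half_theta_series holomorphic_compose_power) simp_all

lemma suminf_zero_power:
  assumes "e 0 = 0" "\<And>n. n > 0 \<Longrightarrow> e n > 0"
  shows "(\<Sum>n. (0::complex) ^ e n) = 1"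
proof -
  have "(\<Sum>n. (0::complex) ^ e n) = (\<Sum>n\<in>{0}. 0 ^ e n)"
    by (rule suminf_finite) (use assms in auto)
  then show ?thesis using assms by simp
qed

lemma half_theta_series_0 [simp]: "half_theta_series 0 = 2"
  unfolding half_theta_series_def by (subst suminf_zero_power) auto

lemma theta_series_has_field_derivative_0:
  "theta_series 0 = 1" "DERIV theta_series 0 :> 2"
proof -
  define S where "S x = (\<Sum>n. x ^ (n^2 + 2 * n))" for x :: complex
  have "S holomorphic_on ball 0 1"
    unfolding S_def [abs_def] by (rule lacunary_holomorphic) simp
  then have S: "DERIV S 0 :> deriv S 0"
    by (rule holomorphic_derivI) auto
  have S0: "S 0 = 1"
    unfolding S_def by (rule suminf_zero_power) auto
  have eq: "1 + 2 * (x * S x) = theta_series x" if "x \<in> ball 0 1" for x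
  proof -
    have "summable (\<lambda>n. x ^ (n^2 + 2 * n))"
      using that by (intro summable_norm_cancel [OF norm_summable_lacunary]) auto
    from suminf_mult [OF this, of x] have "x * S x = (\<Sum>n. x * x ^ (n^2 + 2 * n))"
      by (simp add: S_def)
    also have "\<dots> = (\<Sum>n. x ^ (Suc n)^2)"
    proof (rule suminf_cong)
      fix n :: nat
      have "(Suc n)^2 = Suc (n^2 + 2 * n)" by (simp add: power2_eq_square)
      then show "x * x ^ (n^2 + 2 * n) = x ^ (Suc n)^2" by (simp only: power_Suc)
    qed
    finally show ?thesis by (simp add: theta_series_def)
  qed
  show "theta_series 0 = 1" using eq [of 0] by simp
  have "DERIV (\<lambda>x. 1 + 2 * (x * S x)) 0 :> 2"
    by (rule derivative_eq_intros S refl | simp add: S0)+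
  then show "DERIV theta_series 0 :> 2"
    by (rule has_field_derivative_transform_within_open [where S = "ball 0 1"]) (simp_all add: eq)
qed

lemma cubic_theta_nome_0 [simp]: "cubic_theta_nome 0 = 1"
  by (simp add: cubic_theta_nome_def theta_series_has_field_derivative_0)

text \<open>The value counts the six vectors on which \<open>m^2 + m n + n^2\<close> equals 1: two
  come from \<open>theta_series q\<close>, four from the product of the half series. Both
  differential identities are checked against this coefficient.\<close>

lemma deriv_cubic_theta_nome_0 [simp]: "deriv cubic_theta_nome 0 = 6"
proof -
  have h: "DERIV half_theta_series 0 :> deriv half_theta_series 0"
    using holomorphic_derivI [OF holomorphic_half_theta_series] by auto
  have c: "DERIV (\<lambda>q. f (q ^ 3)) 0 :> 0"
    if "DERIV f 0 :> d" for f :: "complex \<Rightarrow> complex" and d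
  proof -
    have "DERIV (\<lambda>q::complex. q ^ 3) 0 :> 0"
      by (auto intro!: derivative_eq_intros)
    moreover have "DERIV f ((0::complex) ^ 3) :> d" using that by simp
    ultimately show ?thesis using DERIV_chain2 [of f d "\<lambda>q. q ^ 3" 0 0] by simp
  qed
  note t = theta_series_has_field_derivative_0
  have "((\<lambda>q. theta_series q * theta_series (q ^ 3) + q * half_theta_series q * half_theta_series (q ^ 3))
     has_field_derivative 6) (at 0)"
    by (rule DERIV_cong [OF DERIV_add [OF DERIV_mult [OF t(2) c [OF t(2)]]
          DERIV_mult [OF DERIV_mult [OF DERIV_ident h] c [OF h]]]])
      (simp add: t(1))
  then show ?thesis
    unfolding cubic_theta_nome_def [abs_def] by (rule DERIV_imp_deriv)
qed

section \<open>Reduction theory\<close>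

lemma Im_inversion_scaled:
  assumes "c > 0"
  shows "Im (- 1 / (of_real c * \<sigma>)) = Im \<sigma> / (c * ((Re \<sigma>)^2 + (Im \<sigma>)^2))"
proof -
  have "Im (- 1 / (of_real c * \<sigma>)) = c * Im \<sigma> / (c^2 * ((Re \<sigma>)^2 + (Im \<sigma>)^2))"
    by (simp add: Im_divide power_mult_distrib distrib_left)
  then show ?thesis using assms by (simp add: power2_eq_square)
qed

text \<open>After translation to real part at most 1/2, the inversion divides the height by
  \<open>3 * norm \<sigma> ^ 2\<close>, which is at most
  \<open>3 (1/4 + 1/16) = 15/16\<close>.\<close>

lemma reduction_level_3:
  assumes "0 < Im \<tau>" "Im \<tau> < 1 / 4"
  obtains n :: int where "16 / 15 * Im \<tau> \<le> Im (- 1 / (3 * (\<tau> + of_int n)))"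
proof -
  define \<sigma> where "\<sigma> = \<tau> + of_int (- round (Re \<tau>))"
  have "\<bar>Re \<sigma>\<bar> \<le> 1 / 2"
    using of_int_round_abs_le [of "Re \<tau>"] by (simp add: \<sigma>_def abs_minus_commute)
  then have "(Re \<sigma>)^2 \<le> (1 / 2)^2" by (rule power2_le_iff_abs_le [THEN iffD2, rotated]) simp
  moreover have "(Im \<tau>)^2 < (1 / 4)^2" using assms by (intro power_strict_mono) auto
  ultimately have "3 * ((Re \<sigma>)^2 + (Im \<tau>)^2) \<le> 15 / 16" by (simp add: power_divide)
  moreover have "0 < (Re \<sigma>)^2 + (Im \<tau>)^2" using assms by (simp add: add_nonneg_pos)
  ultimately have "Im \<tau> / (15 / 16) \<le> Im \<tau> / (3 * ((Re \<sigma>)^2 + (Im \<tau>)^2))"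
    using assms by (intro divide_left_mono) auto
  moreover have "Im \<sigma> = Im \<tau>" by (simp add: \<sigma>_def)
  ultimately show ?thesis
    using Im_inversion_scaled [of 3 \<sigma>] that [of "- round (Re \<tau>)"] by (simp add: \<sigma>_def)
qed

text \<open>The Atkin-Lehner involution of determinant 3 at level six; it exchanges the cusps
  infinity and 1/2.\<close>

definition fricke_3 :: "complex \<Rightarrow> complex" where
  "fricke_3 \<tau> = (3 * \<tau> - 2) / (6 * \<tau> - 3)"

lemma Im_fricke_3:
  "Im (fricke_3 \<tau>) = Im \<tau> / (12 * ((Re \<tau> - 1 / 2)^2 + (Im \<tau>)^2))"
proof -
  have "Im (fricke_3 \<tau>) = 3 * Im \<tau> / ((6 * Re \<tau> - 3)^2 + (6 * Im \<tau>)^2)"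
    by (simp add: fricke_3_def Im_divide algebra_simps)
  also have "(6 * Re \<tau> - 3)^2 + (6 * Im \<tau>)^2 = 3 * (12 * ((Re \<tau> - 1 / 2)^2 + (Im \<tau>)^2))"
    by (simp add: power2_eq_square algebra_simps)
  finally show ?thesis by (simp only: mult_divide_mult_cancel_left_if) simp
qed

text \<open>The circles on which the two involutions preserve the height, around 0 with squared
  radius 1/6 and around 1/2 with squared radius 1/12, meet at real part 1/3; this dictates the strip
  from -1/3 to 2/3 and the case split. The height is divided by at most
  \<open>6 (1/9 + 1/25)\<close> or \<open>12 (1/36 + 1/25)\<close>, both below 10/11.\<close>

lemma reduction_level_6:
  assumes "0 < Im \<tau>" "Im \<tau> < 1 / 5"
  obtains n :: int where "11 / 10 * Im \<tau> \<le> Im (- 1 / (6 * (\<tau> + of_int n)))"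
    | n :: int where "11 / 10 * Im \<tau> \<le> Im (fricke_3 (\<tau> + of_int n))"
proof -
  define n where "n = - \<lfloor>Re \<tau> + 1 / 3\<rfloor>"
  define \<sigma> where "\<sigma> = \<tau> + of_int n"
  have "Re \<sigma> + 1 / 3 = frac (Re \<tau> + 1 / 3)" by (simp add: \<sigma>_def n_def frac_def)
  then have Re: "- 1 / 3 \<le> Re \<sigma>" "Re \<sigma> < 2 / 3"
    using frac_ge_0 [of "Re \<tau> + 1 / 3"] frac_lt_1 [of "Re \<tau> + 1 / 3"] by linarith+
  have Im: "Im \<sigma> = Im \<tau>" by (simp add: \<sigma>_def)
  have Im2: "(Im \<tau>)^2 < (1 / 5)^2" using assms by (intro power_strict_mono) auto
  show ?thesis
  proof (cases "Re \<sigma> \<le> 1 / 3")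
    case True
    have "(Re \<sigma>)^2 \<le> (1 / 3)^2" using Re True by (intro power2_le_iff_abs_le [THEN iffD2]) auto
    then have "6 * ((Re \<sigma>)^2 + (Im \<tau>)^2) \<le> 10 / 11" using Im2 by (simp add: power_divide)
    moreover have "0 < (Re \<sigma>)^2 + (Im \<tau>)^2" using assms by (simp add: add_nonneg_pos)
    ultimately have "Im \<tau> / (10 / 11) \<le> Im \<tau> / (6 * ((Re \<sigma>)^2 + (Im \<tau>)^2))"
      using assms by (intro divide_left_mono) auto
    then show ?thesis
      using Im_inversion_scaled [of 6 \<sigma>] that(1) [of n] Im by (simp add: \<sigma>_def)
  next
    case False
    have "\<bar>Re \<sigma> - 1 / 2\<bar> \<le> 1 / 6" using Re False unfolding abs_le_iff by linarith
    then have "(Re \<sigma> - 1 / 2)^2 \<le> (1 / 6)^2" by (intro power2_le_iff_abs_le [THEN iffD2]) auto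
    then have "12 * ((Re \<sigma> - 1 / 2)^2 + (Im \<tau>)^2) \<le> 10 / 11" using Im2 by (simp add: power_divide)
    moreover have "0 < (Re \<sigma> - 1 / 2)^2 + (Im \<tau>)^2" using assms by (simp add: add_nonneg_pos)
    ultimately have "Im \<tau> / (10 / 11) \<le> Im \<tau> / (12 * ((Re \<sigma> - 1 / 2)^2 + (Im \<tau>)^2))"
      using assms by (intro divide_left_mono) auto
    then show ?thesis
      using Im_fricke_3 [of \<sigma>] that(2) [of n] Im by (simp add: \<sigma>_def)
  qed
qed

section \<open>Transformation rules\<close>

text \<open>A primitive twelfth root of unity, the multiplier of the squared eta function under
  translation by one.\<close>

definition \<omega> :: complex where "\<omega> = exp (\<pi> * \<i> / 6)"

lemma \<omega>_cube: "\<omega> ^ 3 = \<i>" and \<omega>_nonzero [simp]: "\<omega> \<noteq> 0"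
proof -
  have "\<omega> ^ 3 = exp (of_nat 3 * (\<pi> * \<i> / 6))"
    unfolding \<omega>_def exp_of_nat_mult ..
  also have "of_nat 3 * (\<pi> * \<i> / 6) = \<i> * of_real (pi / 2)" by simp
  finally show "\<omega> ^ 3 = \<i>" by (simp only: cis_conv_exp [symmetric] cis_pi_half)
qed (simp add: \<omega>_def)

lemma dedekind_eta_shift: "dedekind_eta (z + of_int n) = exp (\<pi> * \<i> * of_int n / 12) * dedekind_eta z"
  by (simp add: dedekind_eta_conv_euler_phi ring_distribs add_divide_distrib exp_add)

lemma dedekind_eta_shift_product:
  assumes "a + b = 2"
  shows "dedekind_eta (z + of_int a) * dedekind_eta (\<sigma> + of_int b) = \<omega> * (dedekind_eta z * dedekind_eta \<sigma>)"
proof -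
  have "\<omega> = exp (\<pi> * \<i> * of_int a / 12) * exp (\<pi> * \<i> * of_int b / 12)"
  proof -
    have "of_int a + of_int b = (2::complex)"
      using assms by (metis of_int_add of_int_numeral)
    moreover have "\<pi> * \<i> * of_int a / 12 + \<pi> * \<i> * of_int b / 12 = \<pi> * \<i> * (of_int a + of_int b) / (12::complex)"
      by (simp only: distrib_left add_divide_distrib)
    ultimately have "\<pi> * \<i> * of_int a / 12 + \<pi> * \<i> * of_int b / 12 = \<pi> * \<i> / (6::complex)"
      by simp
    then show ?thesis unfolding exp_add [symmetric] by (simp only: \<omega>_def)
  qed
  then show ?thesis by (simp add: dedekind_eta_shift)
qed

text \<open>Eta values are grouped in pairs of total weight one: the two square roots in the
  inversion then multiply to \<open>- \<i> * z\<close>, and no branch has to be tracked any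
  more.\<close>

definition eta_x :: "complex \<Rightarrow> complex" where "eta_x \<tau> = dedekind_eta \<tau> ^ 2"
definition eta_y :: "complex \<Rightarrow> complex" where "eta_y \<tau> = dedekind_eta (3 * \<tau>) ^ 2"
definition eta_b :: "complex \<Rightarrow> complex" where "eta_b \<tau> = dedekind_eta \<tau> * dedekind_eta (3 * \<tau>)"

lemma dedekind_eta_inversion_product:
  assumes "c > 0" "d > 0" "Im z > 0"
  shows "dedekind_eta (- 1 / (of_real c * z)) * dedekind_eta (- 1 / (of_real d * z)) =
    of_real (sqrt (c * d)) * (- \<i> * z) * (dedekind_eta (of_real c * z) * dedekind_eta (of_real d * z))"
proof -
  have "weight_factor (of_real c * z) * weight_factor (of_real d * z) = of_real (sqrt (c * d)) * (- \<i> * z)"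
    unfolding weight_factor_scale [OF assms(1)] weight_factor_scale [OF assms(2)]
      weight_factor_squared [symmetric] by (simp add: real_sqrt_mult power2_eq_square del: weight_factor_squared)
  moreover have "Im (of_real c * z) > 0" "Im (of_real d * z) > 0" using assms by simp_all
  ultimately show ?thesis by (simp only: dedekind_eta_inversion mult_ac)
qed

lemma eta_level_3_inversion:
  assumes "Im z > 0"
  shows "eta_x (- 1 / (3 * z)) = 3 * (- \<i> * z) * eta_y z"
    "eta_y (- 1 / (3 * z)) = (- \<i> * z) * eta_x z"
    "eta_b (- 1 / (3 * z)) = \<surd>3 * (- \<i> * z) * eta_b z"
proof -
  have e: "3 * (- 1 / (3 * z)) = - 1 / z" by simp
  show "eta_x (- 1 / (3 * z)) = 3 * (- \<i> * z) * eta_y z"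
    using dedekind_eta_inversion_product [of 3 3 z] assms by (simp add: eta_x_def eta_y_def power2_eq_square)
  show "eta_y (- 1 / (3 * z)) = (- \<i> * z) * eta_x z"
    unfolding eta_y_def e
    using dedekind_eta_inversion_product [of 1 1 z] assms by (simp add: eta_x_def power2_eq_square)
  show "eta_b (- 1 / (3 * z)) = \<surd>3 * (- \<i> * z) * eta_b z"
    unfolding eta_b_def e
    using dedekind_eta_inversion_product [of 3 1 z] assms by (simp add: mult_ac)
qed

lemma eta_level_3_shift:
  "eta_x (z + 1) = \<omega> * eta_x z" "eta_y (z + 1) = \<i> * eta_y z" "eta_b (z + 1) = \<omega>^2 * eta_b z"
proof -
  show "eta_x (z + 1) = \<omega> * eta_x z"
    using dedekind_eta_shift_product [of 1 1 z z] by (simp add: eta_x_def power2_eq_square)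
  have e: "exp (\<pi> * \<i> * of_int 3 / 12) ^ 2 = \<i>" "exp (\<pi> * \<i> * of_int 1 / 12) * exp (\<pi> * \<i> * of_int 3 / 12) = \<omega>^2"
  proof -
    have "exp (\<pi> * \<i> * of_int 3 / 12) ^ 2 = \<omega>^3"
      unfolding \<omega>_def exp_of_nat_mult [symmetric] by simp
    then show "exp (\<pi> * \<i> * of_int 3 / 12) ^ 2 = \<i>" by (simp only: \<omega>_cube)
    show "exp (\<pi> * \<i> * of_int 1 / 12) * exp (\<pi> * \<i> * of_int 3 / 12) = \<omega>^2"
      unfolding \<omega>_def exp_of_nat_mult [symmetric] exp_add [symmetric] by simp
  qed
  have t: "3 * (z + 1) = 3 * z + of_int 3" by simp
  show "eta_y (z + 1) = \<i> * eta_y z"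
    unfolding eta_y_def t dedekind_eta_shift power_mult_distrib e ..
  have t1: "z + 1 = z + of_int 1" by simp
  show "eta_b (z + 1) = \<omega>^2 * eta_b z"
    unfolding eta_b_def t unfolding t1 dedekind_eta_shift e(2) [symmetric] by (simp only: mult_ac)
qed

lemma cubic_theta_a_shift: "Im z > 0 \<Longrightarrow> cubic_theta_a (z + of_int n) = cubic_theta_a z"
  by (simp add: cubic_theta_a_conv_nome)

text \<open>Translation by -1 followed by the level three inversion is an elliptic map of order six.
  Its third power is \<open>fricke_3\<close>, which is why this combination is recorded.\<close>

lemma level_3_elliptic:
  assumes "Im z > 0"
  defines "z' \<equiv> - 1 / (3 * (z - 1))"
  shows "Im z' > 0"
    "eta_x z' = - 3 * (z - 1) * eta_y z"
    "eta_y z' = - (\<i> / \<omega>) * (z - 1) * eta_x z"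
    "eta_b z' = - (\<i> * \<surd>3 / \<omega>^2) * (z - 1) * eta_b z"
    "cubic_theta_a z' = - (\<i> * \<surd>3) * (z - 1) * cubic_theta_a z"
proof -
  have z: "Im (z - 1) > 0" "Im (3 * (z - 1)) > 0" using assms(1) by simp_all
  show "Im z' > 0" unfolding z'_def by (rule Im_inversion_pos [OF z(2)])
  have sh: "eta_x (z - 1) = eta_x z / \<omega>" "eta_y (z - 1) = - \<i> * eta_y z" "eta_b (z - 1) = eta_b z / \<omega>^2"
    using eta_level_3_shift [of "z - 1"] by simp_all
  have A: "cubic_theta_a (z - 1) = cubic_theta_a z"
    using cubic_theta_a_shift [of "z - 1" 1] z by simp
  note inv = eta_level_3_inversion [OF z(1), folded z'_def, unfolded sh]
  show "eta_x z' = - 3 * (z - 1) * eta_y z"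
    unfolding inv by (simp add: algebra_simps)
  show "eta_y z' = - (\<i> / \<omega>) * (z - 1) * eta_x z"
    unfolding inv by simp
  show "eta_b z' = - (\<i> * \<surd>3 / \<omega>^2) * (z - 1) * eta_b z"
    unfolding inv by simp
  show "cubic_theta_a z' = - (\<i> * \<surd>3) * (z - 1) * cubic_theta_a z"
    unfolding cubic_theta_a_inversion [OF z(1), folded z'_def] A by simp
qed

text \<open>At argument \<open>z\<close> the elliptic map is applied three times, through
  \<open>t1\<close> and \<open>t2\<close>, and the factors multiply to
  \<open>(2 * z - 1) / 3\<close>. At argument \<open>2 * z\<close> once is enough, because
  \<open>2 * fricke_3 z = 1 - 1 / (3 * (2 * z - 1))\<close>.\<close>

lemma fricke_3_transformation:
  assumes z: "Im z > 0"
  shows "eta_x (fricke_3 z) = (- 3 * \<i> / \<omega>) * (2 * z - 1) * eta_y z"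
    "eta_y (fricke_3 z) = (1 / \<omega>^2) * (2 * z - 1) * eta_x z"
    "eta_b (fricke_3 z) = - (\<i> * \<surd>3) * (2 * z - 1) * eta_b z"
    "cubic_theta_a (fricke_3 z) = \<i> * \<surd>3 * (2 * z - 1) * cubic_theta_a z"
    "eta_x (2 * fricke_3 z) = (- 3 * \<omega>) * (2 * z - 1) * eta_y (2 * z)"
    "eta_y (2 * fricke_3 z) = (1 / \<omega>) * (2 * z - 1) * eta_x (2 * z)"
    "eta_b (2 * fricke_3 z) = - (\<i> * \<surd>3) * (2 * z - 1) * eta_b (2 * z)"
    "cubic_theta_a (2 * fricke_3 z) = - (\<i> * \<surd>3) * (2 * z - 1) * cubic_theta_a (2 * z)"
proof -
  define t1 where "t1 = - 1 / (3 * (z - 1))"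
  define t2 where "t2 = - 1 / (3 * (t1 - 1))"
  have nz: "z - 1 \<noteq> 0" "3 * z - 2 \<noteq> 0" "2 * z - 1 \<noteq> 0" "6 * z - 3 \<noteq> 0"
    using z by (auto simp: complex_eq_iff)
  have e1: "t1 - 1 = - (3 * z - 2) / (3 * (z - 1))"
    using nz(1) by (simp add: t1_def divide_simps)
  have e2: "t2 = (z - 1) / (3 * z - 2)"
  proof -
    have "- 1 / (3 * (- a / (3 * b))) = b / a" if "a \<noteq> 0" "b \<noteq> 0" for a b :: complex
      using that by simp
    from this [OF nz(2,1)] show ?thesis unfolding t2_def e1 .
  qed
  have e3: "t2 - 1 = - (2 * z - 1) / (3 * z - 2)"
    unfolding e2 using nz by (simp add: divide_simps)
  have e4: "- 1 / (3 * (t2 - 1)) = fricke_3 z"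
  proof -
    have "6 * z - 3 = 3 * (2 * z - 1)" by simp
    moreover have "- 1 / (3 * (- a / b)) = b / (3 * a)" for a b :: complex by simp
    ultimately show ?thesis unfolding e3 fricke_3_def by (simp only:)
  qed
  have prod: "(t2 - 1) * (t1 - 1) * (z - 1) = (2 * z - 1) / 3"
  proof -
    have "(- c / a) * (- a / (3 * b)) * b = c / 3" if "a \<noteq> 0" "b \<noteq> 0" for a b c :: complex
      using that by simp
    from this [OF nz(2,1)] show ?thesis unfolding e1 e3 .
  qed
  note l0 = level_3_elliptic [OF z, folded t1_def]
  note l1 = level_3_elliptic [OF l0(1), folded t2_def]
  note l2 = level_3_elliptic [OF l1(1), unfolded e4]
  have s3: "\<surd>3 * \<surd>3 = 3"
    unfolding of_real_mult [symmetric] by simp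
  have w6: "\<omega> ^ 6 = - 1"
  proof -
    have "\<omega> ^ 6 = (\<omega> ^ 3) ^ 2" by (simp flip: power_mult)
    then show ?thesis by (simp add: \<omega>_cube)
  qed
  have collect: "a * (t2 - 1) * (b * (t1 - 1) * (c * (z - 1) * f)) = (a * b * c / 3) * (2 * z - 1) * f" for a b c f
  proof -
    have "a * (t2 - 1) * (b * (t1 - 1) * (c * (z - 1) * f)) = (a * b * c) * ((t2 - 1) * (t1 - 1) * (z - 1)) * f"
      by (simp only: mult_ac)
    then show ?thesis unfolding prod by simp
  qed
  have "(- 3) * (- (\<i> / \<omega>)) * (- 3) / 3 = - 3 * \<i> / \<omega>" by simp
  then show "eta_x (fricke_3 z) = (- 3 * \<i> / \<omega>) * (2 * z - 1) * eta_y z"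
    unfolding l2 l1 l0 collect by (simp only:)
  have "(- (\<i> / \<omega>)) * (- 3) * (- (\<i> / \<omega>)) / 3 = 1 / \<omega>^2"
    by (simp add: power2_eq_square)
  then show "eta_y (fricke_3 z) = (1 / \<omega>^2) * (2 * z - 1) * eta_x z"
    unfolding l2 l1 l0 collect by (simp only:)
  have "(- (\<i> * \<surd>3 / \<omega>^2)) * (- (\<i> * \<surd>3 / \<omega>^2)) * (- (\<i> * \<surd>3 / \<omega>^2)) / 3
      = \<i> * \<surd>3 * (\<surd>3 * \<surd>3) / (3 * \<omega>^6)"
    by (simp add: eval_nat_numeral mult_ac)
  also have "\<dots> = - (\<i> * \<surd>3)" unfolding s3 w6 by simp
  finally show "eta_b (fricke_3 z) = - (\<i> * \<surd>3) * (2 * z - 1) * eta_b z"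
    unfolding l2 l1 l0 collect by (simp only:)
  have "(- (\<i> * \<surd>3)) * (- (\<i> * \<surd>3)) * (- (\<i> * \<surd>3)) / 3
      = \<i> * \<surd>3 * (\<surd>3 * \<surd>3) / (3 :: complex)"
    by (simp add: mult_ac)
  also have "\<dots> = \<i> * \<surd>3" unfolding s3 by simp
  finally show "cubic_theta_a (fricke_3 z) = \<i> * \<surd>3 * (2 * z - 1) * cubic_theta_a z"
    unfolding l2 l1 l0 collect by (simp only:)
  define m where "m = - 1 / (3 * (2 * z - 1))"
  have "2 * fricke_3 z = m + 1"
  proof -
    have "6 * z - 3 = 3 * (2 * z - 1)" by simp
    then show ?thesis using nz(3) by (simp add: fricke_3_def m_def divide_simps)
  qed
  note f = this
  have "Im (2 * z) > 0" using z by simp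
  note l = level_3_elliptic [OF this, folded m_def]
  show "eta_x (2 * fricke_3 z) = (- 3 * \<omega>) * (2 * z - 1) * eta_y (2 * z)"
    unfolding f eta_level_3_shift l by (simp add: algebra_simps)
  show "eta_y (2 * fricke_3 z) = (1 / \<omega>) * (2 * z - 1) * eta_x (2 * z)"
    unfolding f eta_level_3_shift l by (simp add: mult.assoc)
  show "eta_b (2 * fricke_3 z) = - (\<i> * \<surd>3) * (2 * z - 1) * eta_b (2 * z)"
    unfolding f eta_level_3_shift l by simp
  show "cubic_theta_a (2 * fricke_3 z) = - (\<i> * \<surd>3) * (2 * z - 1) * cubic_theta_a (2 * z)"
    unfolding f using cubic_theta_a_shift [of m 1] l by simp
qed

text \<open>This map is the level three inversion with \<open>z\<close> and \<open>2 * z\<close>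
  interchanged. All right-hand sides have the shape constant times \<open>n\<close> times form, even
  with constant 1, so that \<open>quot_scale_weight\<close> can be applied by rewriting.\<close>

lemma fricke_6_transformation:
  assumes z: "Im z > 0"
  defines "n \<equiv> - \<i> * z"
  shows "eta_x (- 1 / (6 * z)) = 6 * n * eta_y (2 * z)"
    "eta_y (- 1 / (6 * z)) = 2 * n * eta_x (2 * z)"
    "eta_b (- 1 / (6 * z)) = (2 * \<surd>3) * n * eta_b (2 * z)"
    "cubic_theta_a (- 1 / (6 * z)) = (2 * \<surd>3) * n * cubic_theta_a (2 * z)"
    "eta_x (2 * (- 1 / (6 * z))) = 3 * n * eta_y z"
    "eta_y (2 * (- 1 / (6 * z))) = 1 * n * eta_x z"
    "eta_b (2 * (- 1 / (6 * z))) = \<surd>3 * n * eta_b z"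
    "cubic_theta_a (2 * (- 1 / (6 * z))) = \<surd>3 * n * cubic_theta_a z"
proof -
  have a: "- 1 / (6 * z) = - 1 / (3 * (2 * z))" "2 * (- 1 / (6 * z)) = - 1 / (3 * z)"
    by simp_all
  have 2: "Im (2 * z) > 0" using z by simp
  note l = eta_level_3_inversion [OF 2] cubic_theta_a_inversion [OF 2]
    eta_level_3_inversion [OF z] cubic_theta_a_inversion [OF z]
  show "eta_x (- 1 / (6 * z)) = 6 * n * eta_y (2 * z)"
    "eta_y (- 1 / (6 * z)) = 2 * n * eta_x (2 * z)"
    "eta_b (- 1 / (6 * z)) = (2 * \<surd>3) * n * eta_b (2 * z)"
    "cubic_theta_a (- 1 / (6 * z)) = (2 * \<surd>3) * n * cubic_theta_a (2 * z)"
    unfolding a(1) l n_def by simp_all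
  show "eta_x (2 * (- 1 / (6 * z))) = 3 * n * eta_y z"
    "eta_y (2 * (- 1 / (6 * z))) = 1 * n * eta_x z"
    "eta_b (2 * (- 1 / (6 * z))) = \<surd>3 * n * eta_b z"
    "cubic_theta_a (2 * (- 1 / (6 * z))) = \<surd>3 * n * cubic_theta_a z"
    unfolding a(2) l n_def by simp_all
qed

section \<open>The weight one eta quotients of level six\<close>

text \<open>With \<open>\<eta>\<^sub>d\<close> for \<open>\<eta>(d\<tau>)\<close>, the four quotients below are
  \<open>\<eta>\<^sub>2\<eta>\<^sub>3^6/(\<eta>\<^sub>1^2\<eta>\<^sub>6^3)\<close>, \<open>\<eta>\<^sub>6\<eta>\<^sub>1^6/(\<eta>\<^sub>3^2\<eta>\<^sub>2^3)\<close>,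
  \<open>\<eta>\<^sub>1\<eta>\<^sub>6^6/(\<eta>\<^sub>2^2\<eta>\<^sub>3^3)\<close> and \<open>\<eta>\<^sub>3\<eta>\<^sub>2^6/(\<eta>\<^sub>6^2\<eta>\<^sub>1^3)\<close>; each vanishes at exactly one cusp.\<close>

definition quot :: "complex \<Rightarrow> complex \<Rightarrow> complex \<Rightarrow> complex \<Rightarrow> complex" where
  "quot x y b u = x ^ 3 / y * (b / u ^ 2)"

definition eta_p :: "complex \<Rightarrow> complex" where
  "eta_p \<tau> = quot (eta_y \<tau>) (eta_x \<tau>) (eta_b (2 * \<tau>)) (eta_y (2 * \<tau>))"
definition eta_r :: "complex \<Rightarrow> complex" where
  "eta_r \<tau> = quot (eta_x \<tau>) (eta_y \<tau>) (eta_b (2 * \<tau>)) (eta_x (2 * \<tau>))"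
definition eta_s :: "complex \<Rightarrow> complex" where
  "eta_s \<tau> = quot (eta_y (2 * \<tau>)) (eta_x (2 * \<tau>)) (eta_b \<tau>) (eta_y \<tau>)"
definition eta_t :: "complex \<Rightarrow> complex" where
  "eta_t \<tau> = quot (eta_x (2 * \<tau>)) (eta_y (2 * \<tau>)) (eta_b \<tau>) (eta_x \<tau>)"

lemma quot_scale:
  "quot (c * x) (d * y) (e * b) (f * u) = (c ^ 3 * e / (d * f ^ 2)) * quot x y b u"
  by (simp add: quot_def power_mult_distrib mult_ac)

text \<open>All four arguments carry one automorphy factor, and \<open>3 - 1 + 1 - 2 = 1\<close> of
  them survives. Each transformation rule of a quotient is thus reduced to arithmetic with
  constants.\<close>

lemma quot_scale_weight:
  assumes "n \<noteq> 0"
  shows "quot (c * n * x) (d * n * y) (e * n * b) (f * n * u) = (c ^ 3 * e / (d * f ^ 2)) * n * quot x y b u"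
proof -
  have "quot (c * n * x) (d * n * y) (e * n * b) (f * n * u) =
     (c ^ 3 * e / (d * f ^ 2)) * (n ^ 3 * n / (n * n ^ 2)) * quot x y b u"
    by (simp add: quot_def power_mult_distrib mult_ac)
  also have "n ^ 3 * n / (n * n ^ 2) = n"
    using assms by (simp add: eval_nat_numeral)
  finally show ?thesis .
qed

lemma sqrt3_squared: "\<surd>3 * \<surd>3 = 3"
  unfolding of_real_mult [symmetric] by simp

lemma fricke_6_quotients:
  assumes z: "Im z > 0"
  defines "n \<equiv> - \<i> * z" and "\<rho> \<equiv> \<surd>3"
  shows "eta_p (- 1 / (6 * z)) = (4 / 3 * \<rho>) * n * eta_t z"
    "eta_r (- 1 / (6 * z)) = (12 * \<rho>) * n * eta_s z"
    "eta_s (- 1 / (6 * z)) = (\<rho> / 6) * n * eta_r z"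
    "eta_t (- 1 / (6 * z)) = (3 / 2 * \<rho>) * n * eta_p z"
proof -
  have n: "n \<noteq> 0" using z by (auto simp: n_def)
  note l = fricke_6_transformation [OF z, folded n_def \<rho>_def]
  show "eta_p (- 1 / (6 * z)) = (4 / 3 * \<rho>) * n * eta_t z"
    unfolding eta_p_def eta_t_def l quot_scale_weight [OF n] by (simp add: mult_ac)
  show "eta_r (- 1 / (6 * z)) = (12 * \<rho>) * n * eta_s z"
    unfolding eta_r_def eta_s_def l quot_scale_weight [OF n] by (simp add: mult_ac)
  show "eta_s (- 1 / (6 * z)) = (\<rho> / 6) * n * eta_r z"
    unfolding eta_r_def eta_s_def l quot_scale_weight [OF n] by (simp add: mult_ac)
  show "eta_t (- 1 / (6 * z)) = (3 / 2 * \<rho>) * n * eta_p z"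
    unfolding eta_p_def eta_t_def l quot_scale_weight [OF n] by (simp add: mult_ac)
qed

lemma fricke_3_quotients:
  assumes z: "Im z > 0"
  defines "j \<equiv> 2 * z - 1" and "\<rho> \<equiv> \<surd>3"
  shows "eta_p (fricke_3 z) = (- \<i> * \<rho> / 3) * j * eta_r z"
    "eta_r (fricke_3 z) = (- 3 * \<i> * \<rho>) * j * eta_p z"
    "eta_s (fricke_3 z) = (\<i> * \<rho> / 3) * j * eta_t z"
    "eta_t (fricke_3 z) = (3 * \<i> * \<rho>) * j * eta_s z"
proof -
  have j: "j \<noteq> 0" using z by (auto simp: j_def complex_eq_iff)
  have w: "\<omega> * (\<omega> * \<omega>) = \<i>" using \<omega>_cube by (simp add: eval_nat_numeral)
  note l = fricke_3_transformation [OF z, folded j_def \<rho>_def]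
  have "(1 / \<omega>^2) ^ 3 * - (\<i> * \<rho>) / (- 3 * \<i> / \<omega> * (1 / \<omega>)^2) = \<rho> / (3 * \<omega>^3)"
    by (simp add: divide_simps eval_nat_numeral)
  also have "\<dots> = - \<i> * \<rho> / 3" unfolding \<omega>_cube by (simp add: divide_simps)
  finally show "eta_p (fricke_3 z) = (- \<i> * \<rho> / 3) * j * eta_r z"
    unfolding eta_p_def eta_r_def l quot_scale_weight [OF j] by (simp only:)
  have "(- 3 * \<i> / \<omega>) ^ 3 * - (\<i> * \<rho>) / (1 / \<omega>^2 * (- 3 * \<omega>)^2) = 3 * \<rho> / \<omega>^3"
    by (simp add: divide_simps eval_nat_numeral)
  also have "\<dots> = - 3 * \<i> * \<rho>" unfolding \<omega>_cube by (simp add: divide_simps)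
  finally show "eta_r (fricke_3 z) = (- 3 * \<i> * \<rho>) * j * eta_p z"
    unfolding eta_p_def eta_r_def l quot_scale_weight [OF j] by (simp only:)
  have "(1 / \<omega>) ^ 3 * - (\<i> * \<rho>) / (- 3 * \<omega> * (1 / \<omega>^2)^2) = \<i> * \<rho> / 3"
    by (simp add: divide_simps eval_nat_numeral)
  then show "eta_s (fricke_3 z) = (\<i> * \<rho> / 3) * j * eta_t z"
    unfolding eta_s_def eta_t_def l quot_scale_weight [OF j] by (simp only:)
  have "(- 3 * \<omega>) ^ 3 * - (\<i> * \<rho>) / (1 / \<omega> * (- 3 * \<i> / \<omega>)^2) = - 3 * \<i> * \<rho> * (\<omega>^3 * \<omega>^3)"
    by (simp add: divide_simps eval_nat_numeral)
  also have "\<dots> = 3 * \<i> * \<rho>" unfolding \<omega>_cube by simp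
  finally show "eta_t (fricke_3 z) = (3 * \<i> * \<rho>) * j * eta_s z"
    unfolding eta_s_def eta_t_def l quot_scale_weight [OF j] by (simp only:)
qed

section \<open>Expansions at infinity and identification with theta functions\<close>

lemma holomorphic_divide_ident:
  assumes "h holomorphic_on ball 0 1" "h 0 = 0"
  obtains G where "G holomorphic_on ball 0 1" "\<And>q. h q = q * G q"
proof
  show "(\<lambda>z. if z = 0 then deriv h 0 else (h z - h 0) / (z - 0)) holomorphic_on ball 0 1"
    by (rule pole_lemma_open [OF assms(1) open_ball])
  show "h q = q * (if q = 0 then deriv h 0 else (h q - h 0) / (q - 0))" for q
    using assms(2) by simp
qed

lemma holomorphic_euler_phi_power: "n > 0 \<Longrightarrow> (\<lambda>q. euler_phi (q ^ n)) holomorphic_on ball 0 1"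
  by (rule holomorphic_compose_power [OF holomorphic_euler_phi])

lemma norm_power_less_1:
  fixes q :: complex
  shows "q \<in> ball 0 1 \<Longrightarrow> n > 0 \<Longrightarrow> norm (q ^ n) < 1"
  by (auto simp: norm_power power_less_one_iff)

lemma eta_level_3_nome:
  defines "u \<equiv> \<lambda>z. exp (\<pi> * \<i> * z / 6)"
  shows "eta_x z = u z * euler_phi (nome z) ^ 2"
    "eta_y z = u z ^ 3 * euler_phi (nome z ^ 3) ^ 2"
    "eta_b z = u z ^ 2 * (euler_phi (nome z) * euler_phi (nome z ^ 3))"
    "eta_x (2 * z) = u z ^ 2 * euler_phi (nome z ^ 2) ^ 2"
    "eta_y (2 * z) = u z ^ 6 * euler_phi (nome z ^ 6) ^ 2"
    "eta_b (2 * z) = u z ^ 4 * (euler_phi (nome z ^ 2) * euler_phi (nome z ^ 6))"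
    "u z ^ 12 = nome z" "u z \<noteq> 0"
proof -
  define v where "v = exp (\<pi> * \<i> * z / 12)"
  have e: "dedekind_eta z = v * euler_phi (nome z)"
    "dedekind_eta (2 * z) = v ^ 2 * euler_phi (nome z ^ 2)"
    "dedekind_eta (3 * z) = v ^ 3 * euler_phi (nome z ^ 3)"
    "dedekind_eta (6 * z) = v ^ 6 * euler_phi (nome z ^ 6)"
    using nome_mult_of_nat [of 2 z] nome_mult_of_nat [of 3 z] nome_mult_of_nat [of 6 z]
    by (simp_all add: dedekind_eta_conv_euler_phi v_def mult_ac flip: exp_of_nat_mult)
  have u: "u z = v ^ 2"
    by (simp add: u_def v_def mult_ac flip: exp_of_nat_mult)
  have t: "3 * (2 * z) = 6 * z" by simp
  show "eta_x z = u z * euler_phi (nome z) ^ 2"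
    "eta_y z = u z ^ 3 * euler_phi (nome z ^ 3) ^ 2"
    "eta_b z = u z ^ 2 * (euler_phi (nome z) * euler_phi (nome z ^ 3))"
    "eta_x (2 * z) = u z ^ 2 * euler_phi (nome z ^ 2) ^ 2"
    "eta_y (2 * z) = u z ^ 6 * euler_phi (nome z ^ 6) ^ 2"
    "eta_b (2 * z) = u z ^ 4 * (euler_phi (nome z ^ 2) * euler_phi (nome z ^ 6))"
    unfolding eta_x_def eta_y_def eta_b_def t e u by (simp_all add: eval_nat_numeral)
  show "u z ^ 12 = nome z" "u z \<noteq> 0"
    unfolding u_def nome_def by (simp_all add: mult_ac flip: exp_of_nat_mult)
qed

definition p_nome :: "complex \<Rightarrow> complex" where
  "p_nome q = quot (euler_phi (q ^ 3) ^ 2) (euler_phi q ^ 2) (euler_phi (q ^ 2) * euler_phi (q ^ 6)) (euler_phi (q ^ 6) ^ 2)"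
definition r_nome :: "complex \<Rightarrow> complex" where
  "r_nome q = quot (euler_phi q ^ 2) (euler_phi (q ^ 3) ^ 2) (euler_phi (q ^ 2) * euler_phi (q ^ 6)) (euler_phi (q ^ 2) ^ 2)"
definition s_nome :: "complex \<Rightarrow> complex" where
  "s_nome q = q * quot (euler_phi (q ^ 6) ^ 2) (euler_phi (q ^ 2) ^ 2) (euler_phi q * euler_phi (q ^ 3)) (euler_phi (q ^ 3) ^ 2)"
definition t_nome :: "complex \<Rightarrow> complex" where
  "t_nome q = quot (euler_phi (q ^ 2) ^ 2) (euler_phi (q ^ 6) ^ 2) (euler_phi q * euler_phi (q ^ 3)) (euler_phi q ^ 2)"

lemma eta_quotients_nome:
  "eta_p z = p_nome (nome z)" "eta_r z = r_nome (nome z)"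
  "eta_s z = s_nome (nome z)" "eta_t z = t_nome (nome z)"
proof -
  define u where "u = exp (\<pi> * \<i> * z / 6)"
  note n = eta_level_3_nome [of z, folded u_def]
  have u: "u \<noteq> 0" "u ^ 12 = nome z" using n by simp_all
  \<comment> \<open>Here \<open>u\<close> is the twelfth root of the nome that eta contributes. Its
    powers cancel in three quotients and leave \<open>u ^ 12 = nome z\<close> in
    \<open>eta_s\<close>, the one that vanishes at infinity.\<close>
  have c: "(u ^ 3) ^ 3 * u ^ 4 / (u * (u ^ 6) ^ 2) = 1" "u ^ 3 * u ^ 4 / (u ^ 3 * (u ^ 2) ^ 2) = 1"
    "(u ^ 2) ^ 3 * u ^ 2 / (u ^ 6 * u ^ 2) = 1" "(u ^ 6) ^ 3 * u ^ 2 / (u ^ 2 * (u ^ 3) ^ 2) = nome z"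
    unfolding u(2) [symmetric] using u(1) by (simp_all add: divide_simps flip: power_mult power_add power_Suc)
  show "eta_p z = p_nome (nome z)" "eta_r z = r_nome (nome z)"
    "eta_s z = s_nome (nome z)" "eta_t z = t_nome (nome z)"
    unfolding eta_p_def eta_r_def eta_s_def eta_t_def p_nome_def r_nome_def s_nome_def t_nome_def n quot_scale c
    by simp_all
qed

lemma holomorphic_eta_quotients_nome:
  "p_nome holomorphic_on ball 0 1" "r_nome holomorphic_on ball 0 1"
  "s_nome holomorphic_on ball 0 1" "t_nome holomorphic_on ball 0 1"
proof -
  have nz: "euler_phi (q ^ n) \<noteq> 0" if "q \<in> ball 0 1" "n > 0" for q and n :: nat
    using norm_power_less_1 [OF that] by (rule euler_phi_nonzero)
  have nz1: "euler_phi q \<noteq> 0" if "q \<in> ball 0 1" for q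
    using nz [OF that, of 1] by simp
  note h = holomorphic_euler_phi holomorphic_euler_phi_power
  show "p_nome holomorphic_on ball 0 1" "r_nome holomorphic_on ball 0 1"
    "s_nome holomorphic_on ball 0 1" "t_nome holomorphic_on ball 0 1"
    unfolding p_nome_def [abs_def] r_nome_def [abs_def] s_nome_def [abs_def] t_nome_def [abs_def] quot_def
    by (intro holomorphic_on_mult holomorphic_on_divide holomorphic_on_power holomorphic_on_ident h;
        simp add: nz nz1)+
qed

lemma eta_quotients_nome_0 [simp]: "p_nome 0 = 1" "r_nome 0 = 1" "s_nome 0 = 0" "t_nome 0 = 1"
  by (simp_all add: p_nome_def r_nome_def s_nome_def t_nome_def quot_def)

lemma Im_fricke_3': "Im (fricke_3 \<tau>) = Im \<tau> / (3 * norm (2 * \<tau> - 1) ^ 2)"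
proof -
  have "norm (2 * \<tau> - 1) ^ 2 = 4 * ((Re \<tau> - 1 / 2)^2 + (Im \<tau>)^2)"
    unfolding cmod_power2 by (simp add: power2_eq_square algebra_simps)
  then show ?thesis by (simp add: Im_fricke_3)
qed

lemma Im_fricke_6: "Im (- 1 / (6 * \<tau>)) = Im \<tau> / (6 * norm \<tau> ^ 2)"
  using Im_inversion_scaled [of 6 \<tau>] by (simp add: cmod_power2)

text \<open>The two involutions permute the four differences up to automorphy factors, so the vanishing
  criterion is applied to all of them at once, after a rescaling that makes their sizes match.\<close>

lemma eta_quotients_eq_theta:
  assumes t: "Im t > 0"
  shows "eta_p t = (cubic_theta_a t + 2 * cubic_theta_a (2 * t)) / 3"
    "eta_r t = 2 * cubic_theta_a (2 * t) - cubic_theta_a t"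
    "eta_s t = (cubic_theta_a t - cubic_theta_a (2 * t)) / 6"
    "eta_t t = (cubic_theta_a t + cubic_theta_a (2 * t)) / 2"
proof -
  define A where "A = cubic_theta_a"
  define B where "B t = cubic_theta_a (2 * t)" for t
  define P where "P t = eta_p t - (A t + 2 * B t) / 3" for t
  define R where "R t = eta_r t - (2 * B t - A t)" for t
  define S where "S t = eta_s t - (A t - B t) / 6" for t
  define T where "T t = eta_t t - (A t + B t) / 2" for t
  define Y where "Y = (\<lambda>i::nat. if i = 0 then P else if i = 1 then R else if i = 2 then S else T)"
  \<comment> \<open>These scales make the squared sizes of \<open>P\<close>, \<open>R\<close>,
    \<open>S\<close>, \<open>T\<close> correspond exactly: if a move sends form \<open>i\<close> to
    \<open>c\<close> times form \<open>j\<close>, then \<open>k i * norm c ^ 2\<close> must be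
    \<open>6 * k j\<close> for \<open>-1/(6z)\<close> and \<open>3 * k j\<close> for
    \<open>fricke_3\<close>, the 6 and 3 stemming from the imaginary parts.\<close>
  define k where "k = (\<lambda>i::nat. if i = 0 then 1 else if i = 1 then 1 / 9 else if i = 2 then 8 else 8 / 9 :: real)"
  define \<rho> where "\<rho> = \<surd>3"
  have norm_\<rho>: "norm \<rho> ^ 2 = 3" by (simp add: \<rho>_def)
  have W: "P (- 1 / (6 * z)) = (4 / 3 * \<rho>) * (- \<i> * z) * T z" "R (- 1 / (6 * z)) = (12 * \<rho>) * (- \<i> * z) * S z"
     "S (- 1 / (6 * z)) = (\<rho> / 6) * (- \<i> * z) * R z" "T (- 1 / (6 * z)) = (3 / 2 * \<rho>) * (- \<i> * z) * P z"
    if "Im z > 0" for z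
  proof -
    note l = fricke_6_quotients [OF that, folded \<rho>_def] fricke_6_transformation(4,8) [OF that, folded \<rho>_def]
    show "P (- 1 / (6 * z)) = (4 / 3 * \<rho>) * (- \<i> * z) * T z" "R (- 1 / (6 * z)) = (12 * \<rho>) * (- \<i> * z) * S z"
     "S (- 1 / (6 * z)) = (\<rho> / 6) * (- \<i> * z) * R z" "T (- 1 / (6 * z)) = (3 / 2 * \<rho>) * (- \<i> * z) * P z"
      unfolding P_def R_def S_def T_def A_def B_def l by (simp_all add: field_simps)
  qed
  have V: "P (fricke_3 z) = (- \<i> * \<rho> / 3) * (2 * z - 1) * R z" "R (fricke_3 z) = (- 3 * \<i> * \<rho>) * (2 * z - 1) * P z"
     "S (fricke_3 z) = (\<i> * \<rho> / 3) * (2 * z - 1) * T z" "T (fricke_3 z) = (3 * \<i> * \<rho>) * (2 * z - 1) * S z"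
    if "Im z > 0" for z
  proof -
    note l = fricke_3_quotients [OF that, folded \<rho>_def] fricke_3_transformation(4,8) [OF that, folded \<rho>_def]
    show "P (fricke_3 z) = (- \<i> * \<rho> / 3) * (2 * z - 1) * R z" "R (fricke_3 z) = (- 3 * \<i> * \<rho>) * (2 * z - 1) * P z"
     "S (fricke_3 z) = (\<i> * \<rho> / 3) * (2 * z - 1) * T z" "T (fricke_3 z) = (3 * \<i> * \<rho>) * (2 * z - 1) * S z"
      unfolding P_def R_def S_def T_def A_def B_def l by (simp_all add: field_simps)
  qed
  have NW: "a * norm Z ^ 2 * Im (- 1 / (6 * z)) = b * norm X ^ 2 * Im z"
    if "Z = c * (- \<i> * z) * X" "a * norm c ^ 2 = 6 * b" "Im z > 0" for Z X c z and a b :: real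
  proof -
    have "a * norm Z ^ 2 * Im (- 1 / (6 * z)) = (a * norm c ^ 2) * norm X ^ 2 * (norm z ^ 2 * (Im z / (6 * norm z ^ 2)))"
      unfolding that(1) Im_fricke_6 by (simp add: norm_mult power_mult_distrib)
    also have "norm z ^ 2 * (Im z / (6 * norm z ^ 2)) = Im z / 6"
      using that(3) by auto
    finally show ?thesis unfolding that(2) by simp
  qed
  have NV: "a * norm Z ^ 2 * Im (fricke_3 z) = b * norm X ^ 2 * Im z"
    if "Z = c * (2 * z - 1) * X" "a * norm c ^ 2 = 3 * b" "Im z > 0" for Z X c z and a b :: real
  proof -
    have "2 * z - 1 \<noteq> 0" using that(3) by (auto simp: complex_eq_iff)
    then have j: "norm (2 * z - 1) ^ 2 * (Im z / (3 * norm (2 * z - 1) ^ 2)) = Im z / 3"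
      by simp
    have "a * norm Z ^ 2 * Im (fricke_3 z) = (a * norm c ^ 2) * norm X ^ 2 * (norm (2 * z - 1) ^ 2 * (Im z / (3 * norm (2 * z - 1) ^ 2)))"
      unfolding that(1) Im_fricke_3' by (simp add: norm_mult power_mult_distrib)
    then show ?thesis unfolding that(2) j by simp
  qed
  have nome: "\<exists>G. G holomorphic_on ball 0 1 \<and> (\<forall>t. Im t > 0 \<longrightarrow> of_real (sqrt (k i)) * Y i t = nome t ^ 1 * G (nome t))"
    if "i < 4" for i
  proof -
    define a where "a = cubic_theta_nome"
    define b where "b q = cubic_theta_nome (q ^ 2)" for q
    define H where "H = (\<lambda>q. of_real (sqrt (k i)) * (if i = 0 then p_nome q - (a q + 2 * b q) / 3
      else if i = 1 then r_nome q - (2 * b q - a q)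
      else if i = 2 then s_nome q - (a q - b q) / 6 else t_nome q - (a q + b q) / 2))"
    have ab: "a holomorphic_on ball 0 1" "b holomorphic_on ball 0 1"
      unfolding a_def b_def [abs_def]
      by (simp_all add: holomorphic_cubic_theta_nome holomorphic_compose_power)
    have "H holomorphic_on ball 0 1"
      unfolding H_def by (cases "i = 0"; cases "i = 1"; cases "i = 2";
        simp; intro holomorphic_intros holomorphic_eta_quotients_nome ab; simp)
    \<comment> \<open>Only constant terms are compared: they are 1, 1, 0, 1 for the quotients and 1
      for both theta functions. One order of vanishing is enough, since 1 < 4 pi / 5.\<close>
    moreover have "H 0 = 0" by (simp add: H_def a_def b_def)
    ultimately obtain G where G: "G holomorphic_on ball 0 1" "\<And>q. H q = q * G q"
      by (rule holomorphic_divide_ident) blast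
    have "of_real (sqrt (k i)) * Y i t = H (nome t)" if "Im t > 0" for t
    proof -
      have "A t = a (nome t)" "B t = b (nome t)"
        using cubic_theta_a_conv_nome [of t] cubic_theta_a_conv_nome [of "2 * t"] nome_mult_of_nat [of 2 t] that
        by (simp_all add: A_def B_def a_def b_def)
      then show ?thesis
        by (simp add: H_def Y_def P_def R_def S_def T_def eta_quotients_nome)
    qed
    then show ?thesis using G by auto
  qed
  then obtain G where G: "\<And>i. i < 4 \<Longrightarrow> G i holomorphic_on ball 0 1"
    "\<And>i t. i < 4 \<Longrightarrow> Im t > 0 \<Longrightarrow> of_real (sqrt (k i)) * Y i t = nome t ^ 1 * G i (nome t)"
    by metis
  have k0: "k i > 0" for i by (simp add: k_def)
  have zero: "of_real (sqrt (k i)) * Y i t = 0" if "i < 4" for i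
  proof (rule vanishing_of_small_weight [where I = "{..<4}" and X = "\<lambda>i t. of_real (sqrt (k i)) * Y i t"
        and G = G and c = "1 / 5" and l = "11 / 10" and K = 1 and m = 1])
    show "G i holomorphic_on ball 0 1" if "i \<in> {..<4}" for i using G that by simp
    show "of_real (sqrt (k i)) * Y i t = nome t ^ 1 * G i (nome t)" if "i \<in> {..<4}" "Im t > 0" for i t
      using G that by simp
    show "real 1 < 4 * pi * real 1 * (1 / 5)" using pi_gt3 by simp
    fix z assume z: "0 < Im z" "Im z < 1 / 5"
    define N where "N i z = k i * norm (Y i z) ^ 2 * Im z" for i z
    have N: "norm (of_real (sqrt (k i)) * Y i z) ^ 2 * Im z ^ 1 = N i z" for i z
      using k0 [of i] by (simp add: N_def norm_mult power_mult_distrib less_imp_le)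
    have per: "N i (z + of_int n) = N i z" if "i < 4" for i n
    proof -
      have "of_real (sqrt (k i)) * Y i (z + of_int n) = of_real (sqrt (k i)) * Y i z"
        using G(2) [OF that] z(1) by simp
      note eq = this
      show ?thesis unfolding N [symmetric] eq by simp
    qed
    have Nv: "N 0 w = 1 * norm (P w) ^ 2 * Im w" "N 1 w = 1 / 9 * norm (R w) ^ 2 * Im w"
      "N 2 w = 8 * norm (S w) ^ 2 * Im w" "N 3 w = 8 / 9 * norm (T w) ^ 2 * Im w" for w
      by (simp_all add: N_def Y_def k_def)
    have cW: "1 * norm (4 / 3 * \<rho>) ^ 2 = 6 * (8 / 9)" "1 / 9 * norm (12 * \<rho>) ^ 2 = 6 * 8"
      "8 * norm (\<rho> / 6) ^ 2 = 6 * (1 / 9)" "8 / 9 * norm (3 / 2 * \<rho>) ^ 2 = 6 * 1"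
      by (simp_all add: norm_mult norm_divide power_mult_distrib power_divide norm_\<rho>)
    have w: "N 0 (- 1 / (6 * \<sigma>)) = N 3 \<sigma>" "N 1 (- 1 / (6 * \<sigma>)) = N 2 \<sigma>"
      "N 2 (- 1 / (6 * \<sigma>)) = N 1 \<sigma>" "N 3 (- 1 / (6 * \<sigma>)) = N 0 \<sigma>" if "Im \<sigma> > 0" for \<sigma>
      unfolding Nv by (rule NW [OF W(1) [OF that] cW(1) that], rule NW [OF W(2) [OF that] cW(2) that],
        rule NW [OF W(3) [OF that] cW(3) that], rule NW [OF W(4) [OF that] cW(4) that])
    have cV: "1 * norm (- \<i> * \<rho> / 3) ^ 2 = 3 * (1 / 9)" "1 / 9 * norm (- 3 * \<i> * \<rho>) ^ 2 = 3 * 1"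
      "8 * norm (\<i> * \<rho> / 3) ^ 2 = 3 * (8 / 9)" "8 / 9 * norm (3 * \<i> * \<rho>) ^ 2 = 3 * 8"
      by (simp_all add: norm_mult norm_divide power_mult_distrib power_divide norm_\<rho>)
    have v: "N 0 (fricke_3 \<sigma>) = N 1 \<sigma>" "N 1 (fricke_3 \<sigma>) = N 0 \<sigma>"
      "N 2 (fricke_3 \<sigma>) = N 3 \<sigma>" "N 3 (fricke_3 \<sigma>) = N 2 \<sigma>" if "Im \<sigma> > 0" for \<sigma>
      unfolding Nv by (rule NV [OF V(1) [OF that] cV(1) that], rule NV [OF V(2) [OF that] cV(2) that],
        rule NV [OF V(3) [OF that] cV(3) that], rule NV [OF V(4) [OF that] cV(4) that])
    have lt: "0 < (4::nat)" "1 < (4::nat)" "2 < (4::nat)" "3 < (4::nat)" by simp_all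
    have four: "i = 0 \<or> i = 1 \<or> i = 2 \<or> i = 3" if "i < 4" for i :: nat using that by linarith
    have "\<exists>t'. 11 / 10 * Im z \<le> Im t' \<and> (\<forall>i<4. \<exists>j<4. N i z \<le> N j t')"
      using reduction_level_6 [OF z]
    proof cases
      case (1 n)
      have s: "Im (z + of_int n) > 0" using z by simp
      have "\<forall>i<4. \<exists>j<4. N i z \<le> N j (- 1 / (6 * (z + of_int n)))"
      proof (intro allI impI)
        fix i :: nat assume i: "i < 4"
        have "\<exists>j<4. N i (z + of_int n) \<le> N j (- 1 / (6 * (z + of_int n)))"
          using four [OF i] w [OF s] by (metis lt order_refl)
        then show "\<exists>j<4. N i z \<le> N j (- 1 / (6 * (z + of_int n)))" unfolding per [OF i] .
      qed
      then show ?thesis using 1 by blast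
    next
      case (2 n)
      have s: "Im (z + of_int n) > 0" using z by simp
      have "\<forall>i<4. \<exists>j<4. N i z \<le> N j (fricke_3 (z + of_int n))"
      proof (intro allI impI)
        fix i :: nat assume i: "i < 4"
        have "\<exists>j<4. N i (z + of_int n) \<le> N j (fricke_3 (z + of_int n))"
          using four [OF i] v [OF s] by (metis lt order_refl)
        then show "\<exists>j<4. N i z \<le> N j (fricke_3 (z + of_int n))" unfolding per [OF i] .
      qed
      then show ?thesis using 2 by blast
    qed
    then show "\<exists>t'. 11 / 10 * Im z \<le> Im t' \<and> (\<forall>i\<in>{..<4}. \<exists>j\<in>{..<4}.
        (norm (of_real (sqrt (k i)) * Y i z))\<^sup>2 * Im z ^ 1 \<le> (norm (of_real (sqrt (k j)) * Y j t'))\<^sup>2 * Im t' ^ 1)"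
      unfolding N by (simp only: Ball_def Bex_def lessThan_iff)
  qed (use that t in auto)
  have Y0: "Y i t = 0" if "i < 4" for i
    using zero [OF that] k0 [of i] by simp
  show "eta_p t = (cubic_theta_a t + 2 * cubic_theta_a (2 * t)) / 3"
    using Y0 [of 0] by (simp add: Y_def P_def A_def B_def)
  show "eta_r t = 2 * cubic_theta_a (2 * t) - cubic_theta_a t"
    using Y0 [of 1] by (simp add: Y_def R_def A_def B_def)
  show "eta_s t = (cubic_theta_a t - cubic_theta_a (2 * t)) / 6"
    using Y0 [of 2] by (simp add: Y_def S_def A_def B_def)
  show "eta_t t = (cubic_theta_a t + cubic_theta_a (2 * t)) / 2"
    using Y0 [of 3] by (simp add: Y_def T_def A_def B_def)
qed

section \<open>Derivatives of the cubic theta function and the two differential identities\<close>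

lemma open_upper_half_plane: "open upper_half_plane"
  unfolding upper_half_plane_def by (simp add: open_halfspace_Im_gt)

lemma nome_has_field_derivative: "DERIV nome z :> 2 * \<pi> * \<i> * nome z"
  unfolding nome_def [abs_def] by (auto intro!: derivative_eq_intros)

lemma has_field_derivative_compose_nome:
  assumes "f holomorphic_on ball 0 1" "Im t > 0"
  shows "DERIV (\<lambda>z. f (nome z)) t :> 2 * \<pi> * \<i> * (nome t * deriv f (nome t))"
proof -
  have "DERIV f (nome t) :> deriv f (nome t)"
    using holomorphic_derivI [OF assms(1) open_ball nome_in_ball [OF assms(2)]] .
  from DERIV_chain2 [OF this nome_has_field_derivative] show ?thesis
    by (simp only: mult_ac)
qed

lemma deriv_eq_on_upper_half_plane:
  assumes "\<And>z. Im z > 0 \<Longrightarrow> f z = g z" "DERIV g t :> d" "Im t > 0"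
  shows "DERIV f t :> d"
  using assms
  by (intro has_field_derivative_transform_within_open [OF assms(2) open_upper_half_plane])
    (auto simp: upper_half_plane_def)

lemma cubic_theta_a_has_field_derivative:
  assumes "Im z > 0"
  shows "DERIV cubic_theta_a z :> 2 * \<pi> * \<i> * (nome z * deriv cubic_theta_nome (nome z))"
  by (rule deriv_eq_on_upper_half_plane
      [OF cubic_theta_a_conv_nome has_field_derivative_compose_nome [OF holomorphic_cubic_theta_nome]])
    (use assms in auto)

lemma holomorphic_cubic_theta_a: "cubic_theta_a holomorphic_on upper_half_plane"
  using cubic_theta_a_has_field_derivative open_upper_half_plane
  by (auto simp: holomorphic_on_open upper_half_plane_def)

lemma cubic_theta_a_derivs:
  assumes "Im z > 0"
  shows "DERIV cubic_theta_a z :> deriv cubic_theta_a z"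
    "(deriv cubic_theta_a has_field_derivative deriv (deriv cubic_theta_a) z) (at z)"
  using holomorphic_derivI [OF holomorphic_cubic_theta_a open_upper_half_plane]
    holomorphic_derivI [OF holomorphic_deriv [OF holomorphic_cubic_theta_a open_upper_half_plane] open_upper_half_plane]
    assms by (auto simp: upper_half_plane_def)

lemma deriv_cubic_theta_a:
  "Im z > 0 \<Longrightarrow> deriv cubic_theta_a z = 2 * \<pi> * \<i> * (nome z * deriv cubic_theta_nome (nome z))"
  by (rule DERIV_imp_deriv [OF cubic_theta_a_has_field_derivative])

lemma deriv2_cubic_theta_a:
  assumes "Im t > 0"
  defines "q \<equiv> nome t"
  shows "deriv (deriv cubic_theta_a) t = (2 * \<pi> * \<i>)^2 *
    (q * (deriv cubic_theta_nome q + q * deriv (deriv cubic_theta_nome) q))"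
proof -
  define g where "g q = q * deriv cubic_theta_nome q" for q
  have h: "deriv cubic_theta_nome holomorphic_on ball 0 1"
    by (rule holomorphic_deriv [OF holomorphic_cubic_theta_nome open_ball])
  have g: "g holomorphic_on ball 0 1"
    unfolding g_def [abs_def] by (intro holomorphic_on_mult holomorphic_on_ident h)
  have q: "q \<in> ball 0 1" unfolding q_def by (rule nome_in_ball [OF assms(1)])
  have "DERIV g q :> 1 * deriv cubic_theta_nome q + deriv (deriv cubic_theta_nome) q * q"
    unfolding g_def [abs_def]
    by (rule DERIV_mult [OF DERIV_ident holomorphic_derivI [OF h open_ball q]])
  then have dg: "deriv g q = deriv cubic_theta_nome q + q * deriv (deriv cubic_theta_nome) q"
    by (simp add: DERIV_imp_deriv mult.commute)
  have "DERIV (\<lambda>z. 2 * \<pi> * \<i> * g (nome z)) t :> 2 * \<pi> * \<i> * (2 * \<pi> * \<i> * (nome t * deriv g (nome t)))"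
    by (rule DERIV_cmult [OF has_field_derivative_compose_nome [OF g assms(1)]])
  then have "(deriv cubic_theta_a has_field_derivative
      2 * \<pi> * \<i> * (2 * \<pi> * \<i> * (nome t * deriv g (nome t)))) (at t)"
    by (rule deriv_eq_on_upper_half_plane [rotated]) (use assms in \<open>simp_all add: deriv_cubic_theta_a g_def\<close>)
  from DERIV_imp_deriv [OF this] show ?thesis
    unfolding q_def [symmetric] dg by (simp add: power2_eq_square)
qed

text \<open>The weight is six on both sides; the left-hand side is, up to the factor \<open>- A^3\<close>, the second
  derivative of \<open>1 / A\<close>.\<close>

lemma theta_bol_identity:
  assumes "Im t > 0"
  shows "cubic_theta_a t * deriv (deriv cubic_theta_a) t - 2 * deriv cubic_theta_a t ^ 2 =
    - 24 * \<pi> ^ 2 * eta_b t ^ 6"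
proof -
  define A where "A = cubic_theta_a"
  define X where "X t = A t * deriv (deriv A) t - 2 * deriv A t ^ 2 - (- 24 * \<pi> ^ 2 * eta_b t ^ 6)" for t
  define a where "a = cubic_theta_nome"
  define e where "e q = (euler_phi q * euler_phi (q ^ 3)) ^ 6" for q
  define Y where "Y q = - 4 * \<pi> ^ 2 * (a q * (deriv a q + q * deriv (deriv a) q) - 2 * (q * deriv a q ^ 2) - 6 * e q)" for q
  have a: "a holomorphic_on ball 0 1"
    unfolding a_def by (rule holomorphic_cubic_theta_nome)
  note ha = a holomorphic_deriv [OF a open_ball] holomorphic_deriv [OF holomorphic_deriv [OF a open_ball] open_ball]
  have he: "e holomorphic_on ball 0 1"
    unfolding e_def [abs_def] by (intro holomorphic_intros holomorphic_euler_phi holomorphic_euler_phi_power) simp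
  have "Y holomorphic_on ball 0 1"
    unfolding Y_def [abs_def] by (intro holomorphic_on_mult holomorphic_on_add holomorphic_on_diff holomorphic_on_power
        holomorphic_on_const holomorphic_on_ident ha he)
  \<comment> \<open>Here the coefficient 6 enters: at 0 the bracket is
    \<open>a 0 * deriv a 0 - 6 * e 0 = 6 - 6\<close>. Since \<open>X\<close> is the nome times
    \<open>Y\<close>, it vanishes to order two.\<close>
  moreover have "Y 0 = 0" by (simp add: Y_def a_def e_def)
  ultimately obtain G where G: "G holomorphic_on ball 0 1" "\<And>q. Y q = q * G q"
    by (rule holomorphic_divide_ident) blast
  have XG: "X z = nome z ^ 2 * G (nome z)" if z: "Im z > 0" for z
  proof -
    define q where "q = nome z"
    have "eta_b z ^ 6 = exp (\<pi> * \<i> * z / 6) ^ 12 * e q"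
      unfolding eta_level_3_nome(3) e_def q_def by (simp add: power_mult_distrib flip: power_mult)
    then have b: "eta_b z ^ 6 = q * e q"
      unfolding eta_level_3_nome(7) by (simp only: q_def)
    have d: "A z = a q" "deriv A z = 2 * \<pi> * \<i> * (q * deriv a q)"
      "deriv (deriv A) z = (2 * \<pi> * \<i>)^2 * (q * (deriv a q + q * deriv (deriv a) q))"
      using cubic_theta_a_conv_nome [OF z] deriv_cubic_theta_a [OF z] deriv2_cubic_theta_a [OF z]
      by (simp_all only: A_def a_def q_def)
    have "X z = q * Y q"
      unfolding X_def b d Y_def by (simp add: power_mult_distrib) (simp add: algebra_simps power2_eq_square)
    then show ?thesis unfolding G(2) q_def by (simp add: power2_eq_square)
  qed
  have inv: "X (- 1 / (3 * z)) = - 27 * z ^ 6 * X z" if z: "Im z > 0" for z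
  proof -
    define k where "k = - (\<i> * \<surd>3)"
    have k2: "k ^ 2 = - 3"
      by (simp add: k_def power_mult_distrib flip: of_real_power)
    have M: "DERIV (\<lambda>w. - 1 / (3 * w)) w :> 1 / (3 * w ^ 2)" if "Im w > 0" for w
    proof -
      have "w \<noteq> 0" using that by auto
      then show ?thesis by (auto intro!: derivative_eq_intros simp: power2_eq_square)
    qed
    have MH: "Im (- 1 / (3 * w)) > 0" if "Im w > 0" for w
      using Im_inversion_pos [of "3 * w"] that by simp
    have A0: "A (- 1 / (3 * w)) = k * w * A w" if "Im w > 0" for w
      using cubic_theta_a_inversion [OF that] by (simp add: A_def k_def mult_ac)
    have A1: "deriv A (- 1 / (3 * w)) = 3 * k * (w ^ 2 * A w + w ^ 3 * deriv A w)" if w: "Im w > 0" for w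
    proof -
      have "DERIV (\<lambda>w. A (- 1 / (3 * w))) w :> deriv A (- 1 / (3 * w)) * (1 / (3 * w ^ 2))"
        unfolding A_def by (rule DERIV_chain2 [OF cubic_theta_a_derivs(1) [OF MH [OF w]] M [OF w]])
      moreover have "DERIV (\<lambda>w. A (- 1 / (3 * w))) w :> k * (A w + w * deriv A w)"
      proof (rule deriv_eq_on_upper_half_plane [OF A0 _ w])
        show "DERIV (\<lambda>w. k * w * A w) w :> k * (A w + w * deriv A w)"
          using cubic_theta_a_derivs(1) [OF w, folded A_def]
          by (auto intro!: derivative_eq_intros simp: algebra_simps)
      qed
      ultimately have "deriv A (- 1 / (3 * w)) * (1 / (3 * w ^ 2)) = k * (A w + w * deriv A w)"
        by (rule DERIV_unique)
      moreover have "w \<noteq> 0" using w by auto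
      ultimately have "deriv A (- 1 / (3 * w)) = 3 * w ^ 2 * (k * (A w + w * deriv A w))"
        by (simp add: divide_eq_eq mult_ac)
      then show ?thesis by (simp add: algebra_simps eval_nat_numeral)
    qed
    let ?e = "2 * z * A z + z ^ 2 * deriv A z + (3 * z ^ 2 * deriv A z + z ^ 3 * deriv (deriv A) z)"
    have "DERIV (\<lambda>w. deriv A (- 1 / (3 * w))) z :> deriv (deriv A) (- 1 / (3 * z)) * (1 / (3 * z ^ 2))"
      unfolding A_def by (rule DERIV_chain2 [OF cubic_theta_a_derivs(2) [OF MH [OF z]] M [OF z]])
    moreover have "DERIV (\<lambda>w. deriv A (- 1 / (3 * w))) z :> 3 * k * ?e"
    proof (rule deriv_eq_on_upper_half_plane [OF A1 _ z])
      show "DERIV (\<lambda>w. 3 * k * (w ^ 2 * A w + w ^ 3 * deriv A w)) z :> 3 * k * ?e"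
        using cubic_theta_a_derivs [OF z, folded A_def]
        by (auto intro!: derivative_eq_intros simp: algebra_simps)
    qed
    ultimately have "deriv (deriv A) (- 1 / (3 * z)) * (1 / (3 * z ^ 2)) =
       3 * k * ?e"
      by (rule DERIV_unique)
    moreover have "z \<noteq> 0" using z by auto
    ultimately have A2: "deriv (deriv A) (- 1 / (3 * z)) =
       3 * z ^ 2 * (3 * k * ?e)"
      by (simp add: divide_eq_eq mult_ac)
    have E: "eta_b (- 1 / (3 * z)) ^ 6 = - 27 * z ^ 6 * eta_b z ^ 6"
    proof -
      have "eta_b (- 1 / (3 * z)) = k * z * eta_b z"
        using eta_level_3_inversion(3) [OF z] by (simp add: k_def mult_ac)
      moreover have "k ^ 6 = - 27"
      proof -
        have "k ^ 6 = (k ^ 2) ^ 3" by (simp flip: power_mult)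
        then show ?thesis by (simp add: k2)
      qed
      ultimately show ?thesis by (simp add: power_mult_distrib)
    qed
    \<comment> \<open>All terms containing \<open>p ^ 2\<close> or \<open>p * r\<close> cancel
      because of the coefficient 2 before the squared derivative; this cancellation is the
      modularity of the left-hand side.\<close>
    have poly: "(k * z * p) * (3 * z ^ 2 * (3 * k * (2 * z * p + z ^ 2 * r + (3 * z ^ 2 * r + z ^ 3 * s))))
       - 2 * (3 * k * (z ^ 2 * p + z ^ 3 * r)) ^ 2 = 9 * k ^ 2 * z ^ 6 * (p * s - 2 * r ^ 2)" for p r s
      by (simp add: algebra_simps eval_nat_numeral)
    show ?thesis
      unfolding X_def A0 [OF z] A1 [OF z] A2 E poly k2 by (simp add: algebra_simps)
  qed
  have "X t = 0"
  proof (rule vanishing_of_small_weight [where I = "{()}" and X = "\<lambda>_. X"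
        and G = "\<lambda>_. G" and c = "1 / 4" and l = "16 / 15" and K = 6 and m = 2])
    show "real 6 < 4 * pi * real 2 * (1 / 4)" using pi_gt3 by simp
    fix z assume z: "0 < Im z" "Im z < 1 / 4"
    obtain n where n: "16 / 15 * Im z \<le> Im (- 1 / (3 * (z + of_int n)))"
      using reduction_level_3 [OF z] by blast
    define \<sigma> where "\<sigma> = z + of_int n"
    have \<sigma>: "Im \<sigma> > 0" "Im \<sigma> = Im z" "\<sigma> \<noteq> 0" using z by (auto simp: \<sigma>_def complex_eq_iff)
    have "X z = X \<sigma>" using XG [OF z(1)] XG [OF \<sigma>(1)] by (simp add: \<sigma>_def)
    moreover have "Im (- 1 / (3 * \<sigma>)) = Im \<sigma> / (3 * norm \<sigma> ^ 2)"
      using Im_inversion_scaled [of 3 \<sigma>] by (simp add: cmod_power2)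
    then have "norm (X (- 1 / (3 * \<sigma>))) ^ 2 * Im (- 1 / (3 * \<sigma>)) ^ 6 = norm (X \<sigma>) ^ 2 * Im \<sigma> ^ 6"
      unfolding inv [OF \<sigma>(1)] using \<sigma>
      by (simp add: norm_mult norm_power power_mult_distrib power_divide flip: power_mult)
    ultimately show "\<exists>t'. 16 / 15 * Im z \<le> Im t' \<and> (\<forall>i\<in>{()}. \<exists>j\<in>{()}. (norm (X z))\<^sup>2 * Im z ^ 6 \<le> (norm (X t'))\<^sup>2 * Im t' ^ 6)"
      using n \<sigma>(2) unfolding \<sigma>_def [symmetric] by (intro exI [of _ "- 1 / (3 * \<sigma>)"]) auto
  qed (use G XG assms in auto)
  then show ?thesis by (simp only: X_def A_def right_minus_eq)
qed

text \<open>The terms with the derivative \<open>h'\<close> of the automorphy factor cancel. The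
  pairs \<open>f\<close>, \<open>g\<close> and \<open>f2\<close>, \<open>g2\<close> are kept apart
  because a move may interchange the two functions.\<close>

lemma wronskian_transformation:
  assumes H: "open H" "z \<in> H"
    and f: "DERIV f (M z) :> f'" and g: "DERIV g (M z) :> g'"
    and f2: "DERIV f2 z :> f2'" and g2: "DERIV g2 z :> g2'"
    and M: "DERIV M z :> m" and h: "DERIV h z :> h'"
    and fM: "\<And>w. w \<in> H \<Longrightarrow> f (M w) = c * h w * f2 w" and gM: "\<And>w. w \<in> H \<Longrightarrow> g (M w) = d * h w * g2 w"
  shows "m * (g (M z) * f' - f (M z) * g') = c * d * h z ^ 2 * (g2 z * f2' - f2 z * (g2' :: complex))"
proof -
  have "DERIV (\<lambda>w. f (M w)) z :> c * (h' * f2 z + f2' * h z)"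
    by (rule has_field_derivative_transform_within_open [OF _ H, of "\<lambda>w. c * (h w * f2 w)"])
      (use DERIV_cmult [OF DERIV_mult [OF h f2], of c] fM in \<open>auto simp: mult.assoc\<close>)
  with DERIV_chain2 [OF f M] have f': "f' * m = c * (h' * f2 z + f2' * h z)"
    by (rule DERIV_unique)
  have "DERIV (\<lambda>w. g (M w)) z :> d * (h' * g2 z + g2' * h z)"
    by (rule has_field_derivative_transform_within_open [OF _ H, of "\<lambda>w. d * (h w * g2 w)"])
      (use DERIV_cmult [OF DERIV_mult [OF h g2], of d] gM in \<open>auto simp: mult.assoc\<close>)
  with DERIV_chain2 [OF g M] have g': "g' * m = d * (h' * g2 z + g2' * h z)"
    by (rule DERIV_unique)
  have "m * (g (M z) * f' - f (M z) * g') = g (M z) * (f' * m) - f (M z) * (g' * m)"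
    by (simp add: algebra_simps)
  also have "\<dots> = c * d * h z ^ 2 * (g2 z * f2' - f2 z * g2')"
    unfolding f' g' fM [OF H(2)] gM [OF H(2)] by (simp add: algebra_simps power2_eq_square)
  finally show ?thesis .
qed

lemma theta_wronskian_identity:
  assumes "Im t > 0"
  shows "cubic_theta_a (2 * t) * deriv cubic_theta_a t - cubic_theta_a t * (2 * deriv cubic_theta_a (2 * t)) =
    12 * \<pi> * \<i> * (eta_b t * eta_b (2 * t)) ^ 2"
proof -
  define A where "A = cubic_theta_a"
  define B where "B z = A (2 * z)" for z
  define A' where "A' = deriv A"
  define B' where "B' z = 2 * deriv A (2 * z)" for z
  define E where "E z = (eta_b z * eta_b (2 * z)) ^ 2" for z
  define X where "X z = B z * A' z - A z * B' z - 12 * \<pi> * \<i> * E z" for z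
  define a where "a = cubic_theta_nome"
  define e where "e q = (euler_phi q * euler_phi (q ^ 2) * euler_phi (q ^ 3) * euler_phi (q ^ 6)) ^ 2" for q
  define Y where "Y q = 2 * \<pi> * \<i> * (a (q ^ 2) * deriv a q - 2 * (q * (a q * deriv a (q ^ 2)))) - 12 * \<pi> * \<i> * e q" for q
  have A_deriv: "DERIV A z :> A' z" if "Im z > 0" for z
    using cubic_theta_a_derivs(1) [OF that] by (simp add: A_def A'_def)
  have B_deriv: "DERIV B z :> B' z" if "Im z > 0" for z
  proof -
    have "DERIV (\<lambda>z. 2 * z) z :> 2" by (auto intro!: derivative_eq_intros)
    moreover have "Im (2 * z) > 0" using that by simp
    ultimately have "DERIV (\<lambda>z. A (2 * z)) z :> A' (2 * z) * 2"
      by (intro DERIV_chain2 [OF A_deriv])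
    then show ?thesis by (simp add: B_def [abs_def] B'_def A'_def mult.commute)
  qed
  have ha: "a holomorphic_on ball 0 1" "deriv a holomorphic_on ball 0 1"
    unfolding a_def by (rule holomorphic_cubic_theta_nome, rule holomorphic_deriv [OF holomorphic_cubic_theta_nome open_ball])
  have ha2: "(\<lambda>q. a (q ^ 2)) holomorphic_on ball 0 1" "(\<lambda>q. deriv a (q ^ 2)) holomorphic_on ball 0 1"
    by (rule holomorphic_compose_power [OF ha(1)], simp, rule holomorphic_compose_power [OF ha(2)], simp)
  have he: "e holomorphic_on ball 0 1"
    unfolding e_def [abs_def]
    by (intro holomorphic_on_mult holomorphic_on_power holomorphic_euler_phi holomorphic_euler_phi_power) simp_all
  have "Y holomorphic_on ball 0 1"
    unfolding Y_def [abs_def] by (intro holomorphic_on_mult holomorphic_on_diff holomorphic_on_const holomorphic_on_ident ha ha2 he)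
  \<comment> \<open>The constant term is \<open>2 * \<pi> * \<i> * 6 - 12 * \<pi> * \<i>\<close>,
    again by the coefficient 6; together with the explicit factor of the nome in \<open>X\<close>
    this gives order two.\<close>
  moreover have "Y 0 = 0" by (simp add: Y_def a_def e_def)
  ultimately obtain G where G: "G holomorphic_on ball 0 1" "\<And>q. Y q = q * G q"
    by (rule holomorphic_divide_ident) blast
  have XG: "X z = nome z ^ 2 * G (nome z)" if z: "Im z > 0" for z
  proof -
    define q where "q = nome z"
    define u where "u = exp (\<pi> * \<i> * z / 6)"
    note n = eta_level_3_nome [of z, folded u_def q_def]
    have sq: "(u ^ 2 * b * (u ^ 4 * c)) ^ 2 = u ^ 12 * (b * c) ^ 2" for b c
    proof -
      have "u ^ 2 * b * (u ^ 4 * c) = u ^ 6 * (b * c)"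
        by (simp add: mult_ac flip: power_add)
      then show ?thesis by (simp only: power_mult_distrib) (simp flip: power_mult)
    qed
    have b: "E z = q * e q"
      unfolding E_def n(3,6) sq n(7) e_def by (simp only: mult_ac)
    have z2: "Im (2 * z) > 0" using z by simp
    have q2: "nome (2 * z) = q ^ 2" using nome_mult_of_nat [of 2 z] by (simp add: q_def)
    have d: "A z = a q" "B z = a (q ^ 2)" "A' z = 2 * \<pi> * \<i> * (q * deriv a q)"
      "B' z = 2 * (2 * \<pi> * \<i> * (q ^ 2 * deriv a (q ^ 2)))"
      using cubic_theta_a_conv_nome [OF z] deriv_cubic_theta_a [OF z]
        cubic_theta_a_conv_nome [OF z2] deriv_cubic_theta_a [OF z2]
      by (simp_all only: A_def B_def A'_def B'_def a_def q2 q_def)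
    have "X z = q * Y q"
      unfolding X_def b d Y_def by (simp add: algebra_simps power2_eq_square)
    then show ?thesis unfolding G(2) q_def by (simp add: power2_eq_square)
  qed
  have s3: "\<surd>3 * \<surd>3 = 3" by (rule sqrt3_squared)
  have W: "X (- 1 / (6 * z)) = 36 * z ^ 4 * X z" if z: "Im z > 0" for z
  proof -
    let ?w = "- 1 / (6 * z)"
    have z0: "z \<noteq> 0" using z by auto
    have Mz: "Im ?w > 0"
      using Im_inversion_pos [of "6 * z"] z by simp
    have M: "DERIV (\<lambda>w. - 1 / (6 * w)) z :> 1 / (6 * z ^ 2)"
      using z0 by (auto intro!: derivative_eq_intros simp: power2_eq_square)
    have h: "DERIV (\<lambda>w. - \<i> * w) z :> - \<i>"
      by (auto intro!: derivative_eq_intros)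
    have "1 / (6 * z ^ 2) * (B ?w * A' ?w - A ?w * B' ?w)
       = 2 * \<surd>3 * \<surd>3 * (- \<i> * z) ^ 2 * (A z * B' z - B z * A' z)"
    \<comment> \<open>This move interchanges \<open>A\<close> and \<open>B\<close>, so the Wronskian
      changes sign; the sign of \<open>(- \<i> * z) ^ 2 = - z ^ 2\<close> compensates for
      it.\<close>
    proof (rule wronskian_transformation [OF open_upper_half_plane _ A_deriv [OF Mz] B_deriv [OF Mz]
          B_deriv [OF z] A_deriv [OF z] M h])
      show "z \<in> upper_half_plane" using z by (simp add: upper_half_plane_def)
      show "A (- 1 / (6 * w)) = 2 * \<surd>3 * (- \<i> * w) * B w" if "w \<in> upper_half_plane" for w
        using fricke_6_transformation(4) [of w] that by (simp add: A_def B_def upper_half_plane_def)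
      show "B (- 1 / (6 * w)) = \<surd>3 * (- \<i> * w) * A w" if "w \<in> upper_half_plane" for w
        using fricke_6_transformation(8) [of w] that by (simp add: A_def B_def upper_half_plane_def)
    qed
    also have "2 * \<surd>3 * \<surd>3 * (- \<i> * z) ^ 2 * (A z * B' z - B z * A' z) = 6 * z ^ 2 * (B z * A' z - A z * B' z)"
    proof -
      have "2 * \<surd>3 * \<surd>3 = 6"
        using s3 by (simp add: mult.assoc)
      then show ?thesis by (simp add: power_mult_distrib algebra_simps)
    qed
    finally have w: "B ?w * A' ?w - A ?w * B' ?w = 36 * z ^ 4 * (B z * A' z - A z * B' z)"
    proof -
      assume eq: "1 / (6 * z ^ 2) * (B ?w * A' ?w - A ?w * B' ?w)
        = 6 * z ^ 2 * (B z * A' z - A z * B' z)"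
      have "x = 36 * z ^ 4 * y" if "1 / (6 * z ^ 2) * x = 6 * z ^ 2 * y" for x y
      proof -
        have "x = 6 * z ^ 2 * (1 / (6 * z ^ 2) * x)" using z0 by simp
        then show ?thesis unfolding that by (simp add: eval_nat_numeral)
      qed
      from this [OF eq] show ?thesis .
    qed
    have "eta_b ?w * eta_b (2 * ?w) = 2 * (\<surd>3 * \<surd>3) * (- \<i> * z) ^ 2 * (eta_b z * eta_b (2 * z))"
      unfolding fricke_6_transformation(3,7) [OF z] by (simp only: mult_ac power2_eq_square)
    also have "\<dots> = - 6 * z ^ 2 * (eta_b z * eta_b (2 * z))"
      unfolding s3 by (simp add: power_mult_distrib)
    finally have "E ?w = (- 6 * z ^ 2 * (eta_b z * eta_b (2 * z))) ^ 2" by (simp only: E_def)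
    then have E: "E ?w = 36 * z ^ 4 * E z"
      unfolding E_def by (simp add: power_mult_distrib)
    show ?thesis unfolding X_def w E by (simp add: algebra_simps)
  qed
  have V: "X (fricke_3 z) = 9 * (2 * z - 1) ^ 4 * X z" if z: "Im z > 0" for z
  proof -
    let ?v = "fricke_3 z"
    define j where "j = 2 * z - 1"
    have j0: "j \<noteq> 0" using z by (auto simp: j_def complex_eq_iff)
    have Mz: "Im ?v > 0"
      unfolding Im_fricke_3' using z j0 by (simp add: j_def)
    have M: "DERIV fricke_3 z :> 1 / (3 * j ^ 2)"
    proof -
      have nz: "6 * z - 3 \<noteq> 0" using j0 by (auto simp: j_def)
      have "DERIV fricke_3 z :> (3 * (6 * z - 3) - (3 * z - 2) * 6) / ((6 * z - 3) * (6 * z - 3))"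
        unfolding fricke_3_def [abs_def] using nz by (auto intro!: derivative_eq_intros)
      moreover have "(3 * (6 * z - 3) - (3 * z - 2) * 6) / ((6 * z - 3) * (6 * z - 3)) = 1 / (3 * j ^ 2)"
      proof -
        have 1: "3 * (6 * z - 3) - (3 * z - 2) * 6 = 3" by (simp add: algebra_simps)
        have 2: "(6 * z - 3) * (6 * z - 3) = 3 * (3 * j ^ 2)"
          by (simp add: j_def power2_eq_square algebra_simps)
        show ?thesis unfolding 1 2 by simp
      qed
      ultimately show ?thesis by (simp only:)
    qed
    have h: "DERIV (\<lambda>w. 2 * w - 1) z :> 2"
      by (auto intro!: derivative_eq_intros)
    have "1 / (3 * j ^ 2) * (B ?v * A' ?v - A ?v * B' ?v)
       = \<i> * \<surd>3 * - (\<i> * \<surd>3) * (2 * z - 1) ^ 2 * (B z * A' z - A z * B' z)"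
    proof (rule wronskian_transformation [OF open_upper_half_plane _ A_deriv [OF Mz] B_deriv [OF Mz]
          A_deriv [OF z] B_deriv [OF z] M h])
      show "z \<in> upper_half_plane" using z by (simp add: upper_half_plane_def)
      show "A (fricke_3 w) = \<i> * \<surd>3 * (2 * w - 1) * A w" if "w \<in> upper_half_plane" for w
        using fricke_3_transformation(4) [of w] that by (simp add: A_def upper_half_plane_def)
      show "B (fricke_3 w) = - (\<i> * \<surd>3) * (2 * w - 1) * B w" if "w \<in> upper_half_plane" for w
        using fricke_3_transformation(8) [of w] that by (simp add: A_def B_def upper_half_plane_def)
    qed
    also have "\<i> * \<surd>3 * - (\<i> * \<surd>3) = (\<surd>3 * \<surd>3 :: complex)"
      by (simp add: mult_ac)
    finally have eq: "1 / (3 * j ^ 2) * (B ?v * A' ?v - A ?v * B' ?v) = 3 * j ^ 2 * (B z * A' z - A z * B' z)"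
      unfolding s3 j_def .
    have "x = 9 * j ^ 4 * y" if "1 / (3 * j ^ 2) * x = 3 * j ^ 2 * y" for x y
    proof -
      have "x = 3 * j ^ 2 * (1 / (3 * j ^ 2) * x)" using j0 by simp
      then show ?thesis unfolding that by (simp add: eval_nat_numeral)
    qed
    note w = this [OF eq]
    have "eta_b ?v * eta_b (2 * ?v) = (\<i> * \<i>) * (\<surd>3 * \<surd>3) * j ^ 2 * (eta_b z * eta_b (2 * z))"
      unfolding fricke_3_transformation(3,7) [OF z] j_def power2_eq_square minus_mult_minus mult_minus_left mult_minus_right minus_minus
      by (simp only: mult_ac)
    also have "\<dots> = - 3 * j ^ 2 * (eta_b z * eta_b (2 * z))"
      unfolding s3 by simp
    finally have "E ?v = (- 3 * j ^ 2 * (eta_b z * eta_b (2 * z))) ^ 2" by (simp only: E_def)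
    then have E: "E ?v = 9 * j ^ 4 * E z"
      unfolding E_def by (simp add: power_mult_distrib)
    show ?thesis unfolding X_def w E j_def [symmetric] by (simp add: algebra_simps)
  qed
  have "X t = 0"
  proof (rule vanishing_of_small_weight [where I = "{()}" and X = "\<lambda>_. X"
        and G = "\<lambda>_. G" and c = "1 / 5" and l = "11 / 10" and K = 4 and m = 2])
    show "real 4 < 4 * pi * real 2 * (1 / 5)" using pi_gt3 by simp
    fix z assume z: "0 < Im z" "Im z < 1 / 5"
    have "\<exists>t'. 11 / 10 * Im z \<le> Im t' \<and> (norm (X z))\<^sup>2 * Im z ^ 4 = (norm (X t'))\<^sup>2 * Im t' ^ 4"
      using reduction_level_6 [OF z]
    proof cases
      case (1 n)
      define \<sigma> where "\<sigma> = z + of_int n"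
      have \<sigma>: "Im \<sigma> > 0" "Im \<sigma> = Im z" "\<sigma> \<noteq> 0" using z by (auto simp: \<sigma>_def complex_eq_iff)
      have "X z = X \<sigma>" using XG [OF z(1)] XG [OF \<sigma>(1)] by (simp add: \<sigma>_def)
      moreover have "norm (X (- 1 / (6 * \<sigma>))) ^ 2 * Im (- 1 / (6 * \<sigma>)) ^ 4 = norm (X \<sigma>) ^ 2 * Im \<sigma> ^ 4"
        unfolding W [OF \<sigma>(1)] Im_fricke_6 using \<sigma>
        by (simp add: norm_mult norm_power power_mult_distrib power_divide flip: power_mult)
      ultimately show ?thesis
        using 1 \<sigma>(2) unfolding \<sigma>_def [symmetric] by (intro exI [of _ "- 1 / (6 * \<sigma>)"]) auto
    next
      case (2 n)
      define \<sigma> where "\<sigma> = z + of_int n"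
      have \<sigma>: "Im \<sigma> > 0" "Im \<sigma> = Im z" "2 * \<sigma> - 1 \<noteq> 0" using z by (auto simp: \<sigma>_def complex_eq_iff)
      have "X z = X \<sigma>" using XG [OF z(1)] XG [OF \<sigma>(1)] by (simp add: \<sigma>_def)
      moreover have "norm (X (fricke_3 \<sigma>)) ^ 2 * Im (fricke_3 \<sigma>) ^ 4 = norm (X \<sigma>) ^ 2 * Im \<sigma> ^ 4"
        unfolding V [OF \<sigma>(1)] Im_fricke_3' using \<sigma>
        by (simp add: norm_mult norm_power power_mult_distrib power_divide flip: power_mult)
      ultimately show ?thesis
        using 2 \<sigma>(2) unfolding \<sigma>_def [symmetric] by (intro exI [of _ "fricke_3 \<sigma>"]) auto
    qed
    then show "\<exists>t'. 11 / 10 * Im z \<le> Im t' \<and> (\<forall>i\<in>{()}. \<exists>j\<in>{()}. (norm (X z))\<^sup>2 * Im z ^ 4 \<le> (norm (X t'))\<^sup>2 * Im t' ^ 4)"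
      by auto
  qed (use G XG assms in auto)
  then show ?thesis by (simp only: X_def A_def B_def A'_def B'_def E_def right_minus_eq)
qed

section \<open>The differential equation\<close>

lemma eta_level_3_nonzero:
  assumes "Im z > 0"
  shows "eta_x z \<noteq> 0" "eta_y z \<noteq> 0" "eta_b z \<noteq> 0"
  using assms by (simp_all add: eta_x_def eta_y_def eta_b_def dedekind_eta_nonzero)

lemma eta_b_squared: "eta_b z ^ 2 = eta_x z * eta_y z"
  by (simp add: eta_x_def eta_y_def eta_b_def power_mult_distrib)

lemma quot_products:
  fixes x y b u v d :: complex
  assumes nz: "x \<noteq> 0" "y \<noteq> 0" "u \<noteq> 0" "v \<noteq> 0" and b: "b ^ 2 = x * y" and d: "d ^ 2 = u * v"
  shows "quot y x d v * quot x y d u = x ^ 2 * y ^ 2 / d ^ 2"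
    "quot v u b y * quot u v b x = d ^ 4 / b ^ 2"
proof -
  have "quot y x d v * quot x y d u = x ^ 2 * y ^ 2 * d ^ 2 / (u * v) ^ 2"
    using nz by (simp add: quot_def divide_simps) (simp add: eval_nat_numeral mult_ac)
  also have "\<dots> = x ^ 2 * y ^ 2 / d ^ 2"
    using nz unfolding d [symmetric] by (simp add: power2_eq_square)
  finally show "quot y x d v * quot x y d u = x ^ 2 * y ^ 2 / d ^ 2" .
  have "quot v u b y * quot u v b x = (u * v) ^ 2 * b ^ 2 / (x * y) ^ 2"
    using nz by (simp add: quot_def divide_simps) (simp add: eval_nat_numeral mult_ac)
  also have "\<dots> = d ^ 4 / b ^ 2"
    using nz unfolding d [symmetric] b [symmetric] by (simp add: power2_eq_square eval_nat_numeral)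
  finally show "quot v u b y * quot u v b x = d ^ 4 / b ^ 2" .
qed

text \<open>With \<open>b = eta_b z\<close> and \<open>d = eta_b (2 * z)\<close>, the pairs multiply
  to \<open>b ^ 4 / d ^ 2\<close> and \<open>d ^ 4 / b ^ 2\<close>. Hence the eta products in both
  differential identities are monomials in the four quotients.\<close>

lemma eta_quotient_products:
  assumes z: "Im z > 0"
  shows "(eta_b z * eta_b (2 * z)) ^ 2 = eta_p z * eta_r z * (eta_s z * eta_t z)"
    "eta_b z ^ 6 = (eta_p z * eta_r z) ^ 2 * (eta_s z * eta_t z)"
    "eta_r z \<noteq> 0" "hauptmodul_f z = eta_p z / eta_r z"
proof -
  define x where "x = eta_x z"
  define y where "y = eta_y z"
  define b where "b = eta_b z"
  define u where "u = eta_x (2 * z)"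
  define v where "v = eta_y (2 * z)"
  define d where "d = eta_b (2 * z)"
  note defs = x_def [symmetric] y_def [symmetric] b_def [symmetric] u_def [symmetric] v_def [symmetric] d_def [symmetric]
  have z2: "Im (2 * z) > 0" using z by simp
  have nz: "x \<noteq> 0" "y \<noteq> 0" "u \<noteq> 0" "v \<noteq> 0" "b \<noteq> 0" "d \<noteq> 0"
    using eta_level_3_nonzero [OF z] eta_level_3_nonzero [OF z2] by (simp_all add: defs)
  have bd: "b ^ 2 = x * y" "d ^ 2 = u * v"
    using eta_b_squared [of z] eta_b_squared [of "2 * z"] by (simp_all add: defs)
  have pr: "eta_p z * eta_r z = b ^ 4 / d ^ 2"
  proof -
    have "x ^ 2 * y ^ 2 = (b ^ 2) ^ 2" unfolding bd by (simp add: power_mult_distrib)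
    then show ?thesis
      unfolding eta_p_def eta_r_def defs quot_products(1) [OF nz(1-4) bd] by (simp flip: power_mult)
  qed
  have st: "eta_s z * eta_t z = d ^ 4 / b ^ 2"
    unfolding eta_s_def eta_t_def defs by (rule quot_products(2) [OF nz(1-4) bd])
  have "b ^ 4 / d ^ 2 * (d ^ 4 / b ^ 2) = (b * d) ^ 2"
    using nz by (simp add: eval_nat_numeral)
  then show "(eta_b z * eta_b (2 * z)) ^ 2 = eta_p z * eta_r z * (eta_s z * eta_t z)"
    unfolding pr st defs by (simp only:)
  have "(b ^ 4 / d ^ 2) ^ 2 * (d ^ 4 / b ^ 2) = b ^ 6"
    using nz by (simp add: eval_nat_numeral)
  then show "eta_b z ^ 6 = (eta_p z * eta_r z) ^ 2 * (eta_s z * eta_t z)"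
    unfolding pr st defs by (simp only:)
  show "eta_r z \<noteq> 0"
    unfolding eta_r_def defs quot_def using nz by simp
  have e: "dedekind_eta (2 * z) ^ 4 = u ^ 2" "dedekind_eta (3 * z) ^ 8 = y ^ 4"
    "dedekind_eta z ^ 8 = x ^ 4" "dedekind_eta (6 * z) ^ 4 = v ^ 2"
    by (simp_all add: u_def v_def x_def y_def eta_x_def eta_y_def flip: power_mult)
  have "u ^ 2 * y ^ 4 / (x ^ 4 * v ^ 2) = quot y x d v / quot x y d u"
    using nz by (simp add: quot_def divide_simps) (simp add: eval_nat_numeral mult_ac)
  then show "hauptmodul_f z = eta_p z / eta_r z"
    unfolding hauptmodul_f_def e eta_p_def eta_r_def defs .
qed

text \<open>Everything is expressed by the function \<open>w\<close> and the nonvanishing form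
  \<open>r\<close>: \<open>A\<close> and \<open>B\<close> are solved from the linear forms for
  \<open>eta_p = w * r\<close> and \<open>eta_r = r\<close>, and then
  \<open>eta_s = (w - 1) * r / 8\<close> and \<open>eta_t = (9 * w - 1) * r / 8\<close>. The powers
  of \<open>r\<close> record the weights.\<close>

lemma hauptmodul_relations:
  assumes \<tau>: "Im \<tau> > 0"
  defines "w \<equiv> hauptmodul_f \<tau>" and "r \<equiv> eta_r \<tau>"
  shows "cubic_theta_a \<tau> = (3 * w - 1) * r / 2"
    "DERIV hauptmodul_f \<tau> :> \<pi> * \<i> / 4 * (w * (w - 1) * (9 * w - 1)) * r ^ 2"
    "cubic_theta_a \<tau> * deriv (deriv cubic_theta_a) \<tau> - 2 * deriv cubic_theta_a \<tau> ^ 2 =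
       - 3 / 8 * \<pi> ^ 2 * (w ^ 2 * (w - 1) * (9 * w - 1)) * r ^ 6"
proof -
  define A where "A = cubic_theta_a"
  define B where "B z = A (2 * z)" for z
  define A' where "A' = deriv A \<tau>"
  define B' where "B' = 2 * deriv A (2 * \<tau>)"
  have rel: "eta_p z = (A z + 2 * B z) / 3" "eta_r z = 2 * B z - A z"
     "eta_s z = (A z - B z) / 6" "eta_t z = (A z + B z) / 2" if "Im z > 0" for z
    using eta_quotients_eq_theta [OF that] by (simp_all add: A_def B_def)
  have r0: "r \<noteq> 0" using eta_quotient_products(3) [OF \<tau>] by (simp add: r_def)
  have p: "eta_p \<tau> = w * r"
    using eta_quotient_products(4) [OF \<tau>] r0 by (simp add: w_def r_def)
  have AB: "A \<tau> = (3 * w - 1) * r / 2" "B \<tau> = (3 * w + 1) * r / 4"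
  proof -
    have 1: "A \<tau> + 2 * B \<tau> = 3 * w * r" using rel(1) [OF \<tau>] p by (simp add: field_simps)
    have 2: "2 * B \<tau> - A \<tau> = r" using rel(2) [OF \<tau>] by (simp add: r_def)
    have "A \<tau> = ((A \<tau> + 2 * B \<tau>) - (2 * B \<tau> - A \<tau>)) / 2" by simp
    then show "A \<tau> = (3 * w - 1) * r / 2" unfolding 1 2 by (simp add: algebra_simps)
    have "B \<tau> = ((A \<tau> + 2 * B \<tau>) + (2 * B \<tau> - A \<tau>)) / 4" by simp
    then show "B \<tau> = (3 * w + 1) * r / 4" unfolding 1 2 by (simp add: algebra_simps)
  qed
  show "cubic_theta_a \<tau> = (3 * w - 1) * r / 2" using AB(1) by (simp add: A_def)
  have s: "eta_s \<tau> = (w - 1) * r / 8" and t: "eta_t \<tau> = (9 * w - 1) * r / 8"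
    unfolding rel(3,4) [OF \<tau>] AB by (simp_all add: field_simps)
  have Ad: "DERIV A \<tau> :> A'"
    using cubic_theta_a_derivs(1) [OF \<tau>] by (simp add: A_def A'_def)
  have Bd: "DERIV B \<tau> :> B'"
  proof -
    have "DERIV (\<lambda>z. 2 * z) \<tau> :> 2" by (auto intro!: derivative_eq_intros)
    moreover have "DERIV A (2 * \<tau>) :> deriv A (2 * \<tau>)"
      unfolding A_def using \<tau> by (intro cubic_theta_a_derivs(1)) simp
    ultimately have "DERIV (\<lambda>z. A (2 * z)) \<tau> :> deriv A (2 * \<tau>) * 2"
      by (intro DERIV_chain2)
    then show ?thesis by (simp add: B_def [abs_def] B'_def mult.commute)
  qed
  have r: "2 * B \<tau> - A \<tau> = r" using rel(2) [OF \<tau>] by (simp add: r_def)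
  have wr: "B \<tau> * A' - A \<tau> * B' = 12 * \<pi> * \<i> * (w * r * r * ((w - 1) * r / 8 * ((9 * w - 1) * r / 8)))"
    using theta_wronskian_identity [OF \<tau>, folded A_def]
    unfolding eta_quotient_products(1) [OF \<tau>] p s t r_def [symmetric] by (simp add: A'_def B'_def B_def)
  have "DERIV hauptmodul_f \<tau> :> ((A' + 2 * B') / 3 * (2 * B \<tau> - A \<tau>) - (A \<tau> + 2 * B \<tau>) / 3 * (2 * B' - A')) / ((2 * B \<tau> - A \<tau>) * (2 * B \<tau> - A \<tau>))"
  proof (rule deriv_eq_on_upper_half_plane [OF _ _ \<tau>])
    show "hauptmodul_f z = (A z + 2 * B z) / 3 / (2 * B z - A z)" if "Im z > 0" for z
      unfolding eta_quotient_products(4) [OF that] rel [OF that] ..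
    show "DERIV (\<lambda>z. (A z + 2 * B z) / 3 / (2 * B z - A z)) \<tau> :> ((A' + 2 * B') / 3 * (2 * B \<tau> - A \<tau>) - (A \<tau> + 2 * B \<tau>) / 3 * (2 * B' - A')) / ((2 * B \<tau> - A \<tau>) * (2 * B \<tau> - A \<tau>))"
      by (intro DERIV_divide DERIV_cdivide DERIV_add DERIV_diff DERIV_cmult Ad Bd) (use r r0 in simp)
  qed
  \<comment> \<open>The derivative of a quotient of linear forms in \<open>A\<close> and
    \<open>B\<close> has a multiple of their Wronskian as its numerator.\<close>
  also have "(A' + 2 * B') / 3 * (2 * B \<tau> - A \<tau>) - (A \<tau> + 2 * B \<tau>) / 3 * (2 * B' - A') = 4 / 3 * (B \<tau> * A' - A \<tau> * B')"
    by (simp add: field_simps)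
  also have "4 / 3 * (B \<tau> * A' - A \<tau> * B') / ((2 * B \<tau> - A \<tau>) * (2 * B \<tau> - A \<tau>)) =
      \<pi> * \<i> / 4 * (w * (w - 1) * (9 * w - 1)) * r ^ 2"
    unfolding wr r using r0 by (simp add: divide_simps power2_eq_square)
  finally show "DERIV hauptmodul_f \<tau> :> \<pi> * \<i> / 4 * (w * (w - 1) * (9 * w - 1)) * r ^ 2" .
  have "- 24 * \<pi> ^ 2 * eta_b \<tau> ^ 6 = - 24 * \<pi> ^ 2 * ((w * r * r) ^ 2 * ((w - 1) * r / 8 * ((9 * w - 1) * r / 8)))"
    unfolding eta_quotient_products(2) [OF \<tau>] p s t r_def [symmetric] ..
  also have "\<dots> = - 3 / 8 * \<pi> ^ 2 * (w ^ 2 * (w - 1) * (9 * w - 1)) * r ^ 6"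
    by (simp add: eval_nat_numeral mult_ac)
  finally show "cubic_theta_a \<tau> * deriv (deriv cubic_theta_a) \<tau> - 2 * deriv cubic_theta_a \<tau> ^ 2 =
       - 3 / 8 * \<pi> ^ 2 * (w ^ 2 * (w - 1) * (9 * w - 1)) * r ^ 6"
    using theta_bol_identity [OF \<tau>] by simp
qed

text \<open>With \<open>T\<close> the derivative of the inverse function, \<open>a1\<close> and
  \<open>a2\<close> the derivatives of \<open>a\<close> and \<open>L\<close> the value of
  \<open>l\<close>, one has \<open>l' = a1 T\<close> and \<open>l'' = a2 T^2 + a1 T'\<close>. The
  logarithmic derivative of \<open>T\<close> contributes the bracket times \<open>- l'\<close> and a
  term \<open>- 2 a1^2 T^2 / L\<close>, which completes \<open>a2 T^2\<close> to the expression in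
  the weight six identity.\<close>

theorem theorem8p7:
  fixes U :: "complex set" and \<tau> l :: "complex \<Rightarrow> complex"
  assumes "local_holomorphic_inverse upper_half_plane hauptmodul_f U \<tau>"
    and "\<And>f. f \<in> U \<Longrightarrow> l f = cubic_theta_a (\<tau> f)"
  shows "l holomorphic_on U \<and>
    (\<forall>f\<in>U - {0, 1, 1/3, 1/9}.
       deriv (deriv l) f
       + (1 / f + 1 / (f - 1) - 2 / (f - 1/3) + 1 / (f - 1/9)) * deriv l f
       - 8 / (27 * (f - 1) * (f - 1/9) * (f - 1/3)^2) * l f = 0)"
proof (intro conjI ballI)
  have U: "open U" and hol: "\<tau> holomorphic_on U"
    and inv: "\<And>f. f \<in> U \<Longrightarrow> Im (\<tau> f) > 0" "\<And>f. f \<in> U \<Longrightarrow> hauptmodul_f (\<tau> f) = f"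
    using assms(1) unfolding local_holomorphic_inverse_def upper_half_plane_def by auto
  have \<tau>d: "(\<tau> has_field_derivative deriv \<tau> f) (at f)" if "f \<in> U" for f
    by (rule holomorphic_derivI [OF hol U that])
  have ld: "(l has_field_derivative deriv cubic_theta_a (\<tau> f) * deriv \<tau> f) (at f)" if "f \<in> U" for f
    by (rule has_field_derivative_transform_within_open
        [OF DERIV_chain2 [OF cubic_theta_a_derivs(1) [OF inv(1) [OF that]] \<tau>d [OF that]] U that])
      (simp add: assms(2))
  then show "l holomorphic_on U"
    using U by (auto simp: holomorphic_on_open)
  fix f assume f: "f \<in> U - {0, 1, 1/3, 1/9}"
  define S where "S = U - {0, 1, 1/3, 1/9}"
  have S: "open S" "f \<in> S" using U f by (auto simp: S_def intro!: open_Diff finite_imp_closed)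
  define R where "R w = eta_r (\<tau> w)" for w
  define c where "c = \<pi> * \<i> / 4"
  define N where "N w = 4 * c * (w * (w - 1) * (9 * w - 1))" for w
  have c: "c \<noteq> 0" "c ^ 2 = - (\<pi> ^ 2 / 16)"
    by (simp_all add: c_def power_divide power_mult_distrib)
  have S_nz: "w \<noteq> 0" "w - 1 \<noteq> 0" "3 * w - 1 \<noteq> 0" "9 * w - 1 \<noteq> 0" "w \<in> U" if "w \<in> S" for w
    using that by (auto simp: S_def field_simps)
  have l_R: "l w = (3 * w - 1) * R w / 2" and R0: "R w \<noteq> 0" if "w \<in> U" for w
    using hauptmodul_relations(1) [OF inv(1) [OF that]] eta_quotient_products(3) [OF inv(1) [OF that]]
    by (simp_all add: assms(2) [OF that] inv(2) [OF that] R_def)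
  have \<tau>': "c * (w * (w - 1) * (9 * w - 1)) * R w ^ 2 * deriv \<tau> w = 1" if w: "w \<in> U" for w
  proof -
    have "((\<lambda>w. hauptmodul_f (\<tau> w)) has_field_derivative c * (w * (w - 1) * (9 * w - 1)) * R w ^ 2 * deriv \<tau> w) (at w)"
      using DERIV_chain2 [OF hauptmodul_relations(2) [OF inv(1) [OF w]] \<tau>d [OF w]]
      by (simp only: inv(2) [OF w] R_def c_def)
    moreover have "((\<lambda>w. hauptmodul_f (\<tau> w)) has_field_derivative 1) (at w)"
      by (rule has_field_derivative_transform_within_open [OF DERIV_ident U w]) (simp add: inv(2))
    ultimately show ?thesis by (rule DERIV_unique)
  qed
  \<comment> \<open>Substituting \<open>R w = 2 * l w / (3 * w - 1)\<close> eliminates the auxiliary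
    form: the derivative of the inverse function now involves only \<open>w\<close> and
    \<open>l\<close>, so it can be differentiated again.\<close>
  have T: "deriv \<tau> w * (N w * l w ^ 2) = (3 * w - 1) ^ 2" if w: "w \<in> U" for w
  proof -
    have "deriv \<tau> w * (N w * l w ^ 2) = (3 * w - 1) ^ 2 * (c * (w * (w - 1) * (9 * w - 1)) * R w ^ 2 * deriv \<tau> w)"
      unfolding l_R [OF w] N_def by (simp add: power_divide power_mult_distrib)
    then show ?thesis unfolding \<tau>' [OF w] by simp
  qed
  define T where "T = deriv \<tau> f"
  define T' where "T' = deriv (deriv \<tau>) f"
  define L where "L = l f"
  define a1 where "a1 = deriv cubic_theta_a (\<tau> f)"
  define a2 where "a2 = deriv (deriv cubic_theta_a) (\<tau> f)"
  note fU = S_nz(5) [OF S(2)]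
  note nz = S_nz(1-4) [OF S(2)]
  have Td: "(deriv \<tau> has_field_derivative T') (at f)"
    unfolding T'_def by (rule holomorphic_derivI [OF holomorphic_deriv [OF hol U] U fU])
  have dl: "deriv l f = a1 * T"
    using DERIV_imp_deriv [OF ld [OF fU]] by (simp add: a1_def T_def)
  have ddl: "deriv (deriv l) f = a2 * T ^ 2 + a1 * T'"
  proof -
    have "(deriv cubic_theta_a has_field_derivative a2) (at (\<tau> f))"
      unfolding a2_def by (rule cubic_theta_a_derivs(2) [OF inv(1) [OF fU]])
    from DERIV_mult [OF DERIV_chain2 [OF this \<tau>d [OF fU]] Td]
    have "((\<lambda>w. deriv cubic_theta_a (\<tau> w) * deriv \<tau> w) has_field_derivative a2 * T ^ 2 + a1 * T') (at f)"
      by (simp add: T_def a1_def power2_eq_square mult_ac)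
    then have "(deriv l has_field_derivative a2 * T ^ 2 + a1 * T') (at f)"
      by (rule has_field_derivative_transform_within_open [OF _ U fU]) (simp add: DERIV_imp_deriv [OF ld])
    then show ?thesis by (rule DERIV_imp_deriv)
  qed
  have L_R: "L = (3 * f - 1) * R f / 2" using l_R [OF fU] by (simp only: L_def)
  have L0: "L \<noteq> 0" unfolding L_R using R0 [OF fU] nz by simp
  have N0: "N f \<noteq> 0" using nz c by (simp add: N_def)
  define N' where "N' = 4 * c * ((f - 1) * (9 * f - 1) + f * (9 * f - 1) + 9 * (f * (f - 1)))"
  have T'_eq: "T' * (N f * L ^ 2) + (N' * L ^ 2 + 2 * L * (a1 * T) * N f) * T = 6 * (3 * f - 1)"
  proof -
    have Nd: "(N has_field_derivative N') (at f)"
      unfolding N_def [abs_def] N'_def by (auto intro!: derivative_eq_intros simp: algebra_simps)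
    have "((\<lambda>w. l w ^ 2) has_field_derivative 2 * L * (a1 * T)) (at f)"
      using ld [OF fU] by (auto intro!: derivative_eq_intros simp: L_def a1_def T_def)
    from DERIV_mult [OF Td DERIV_mult [OF Nd this]]
    have "((\<lambda>w. deriv \<tau> w * (N w * l w ^ 2)) has_field_derivative
      T' * (N f * L ^ 2) + (N' * L ^ 2 + 2 * L * (a1 * T) * N f) * T) (at f)"
      by (simp add: L_def T_def)
    moreover have "((\<lambda>w. deriv \<tau> w * (N w * l w ^ 2)) has_field_derivative 6 * (3 * f - 1)) (at f)"
    proof (rule has_field_derivative_transform_within_open [OF _ U fU])
      show "((\<lambda>w. (3 * w - 1) ^ 2) has_field_derivative 6 * (3 * f - 1)) (at f)"
        by (auto intro!: derivative_eq_intros)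
    qed (simp add: T)
    ultimately show ?thesis by (rule DERIV_unique)
  qed
  have T_f: "T * (N f * L ^ 2) = (3 * f - 1) ^ 2" using T [OF fU] by (simp add: T_def L_def)
  have nN: "N' / N f = 1 / f + 1 / (f - 1) + 1 / (f - 1/9)"
  proof -
    have "N' / N f = ((f - 1) * (9 * f - 1) + f * (9 * f - 1) + 9 * (f * (f - 1))) / (f * (f - 1) * (9 * f - 1))"
      unfolding N_def N'_def using c(1) by (simp only: mult_divide_mult_cancel_left_if) simp
    also have "\<dots> = 1 / f + 1 / (f - 1) + 9 / (9 * f - 1)"
      using nz by (simp add: add_divide_distrib)
    also have "9 / (9 * f - 1) = 1 / (f - 1/9)"
    proof -
      have "f - 1/9 = (9 * f - 1) / 9" by simp
      then show ?thesis by (simp only: divide_divide_eq_right mult_1)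
    qed
    finally show ?thesis .
  qed
  \<comment> \<open>The logarithmic derivative of \<open>T = (3 f - 1)^2 / (N l^2)\<close>,
    multiplied by \<open>T\<close>. The square of \<open>3 f - 1\<close> produces the term with
    coefficient -2 in the equation, and \<open>N' / N\<close> gives the three simple poles at 0, 1
    and 1/9.\<close>
  have "T' = T * (2 / (f - 1/3) - N' / N f) - 2 * a1 * T ^ 2 / L"
  proof -
    have "T' * (N f * L ^ 2) = 6 * (3 * f - 1) - (N' * L ^ 2 + 2 * L * (a1 * T) * N f) * T"
      using T'_eq by (simp add: eq_diff_eq)
    also have "6 * (3 * f - 1) = T * (2 / (f - 1/3)) * (N f * L ^ 2)"
    proof -
      have "f - 1/3 = (3 * f - 1) / 3" by simp
      then have "2 / (f - 1/3) = 6 / (3 * f - 1)" by (simp only: divide_divide_eq_right) simp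
      then have "T * (2 / (f - 1/3)) * (N f * L ^ 2) = (T * (N f * L ^ 2)) * (6 / (3 * f - 1))" by (simp only: mult_ac)
      then show ?thesis unfolding T_f using nz by (simp add: power2_eq_square)
    qed
    also have "T * (2 / (f - 1/3)) * (N f * L ^ 2) - (N' * L ^ 2 + 2 * L * (a1 * T) * N f) * T =
       (T * (2 / (f - 1/3) - N' / N f) - 2 * a1 * T ^ 2 / L) * (N f * L ^ 2)"
    proof -
      have "N' / N f * (N f * L ^ 2) = N' * L ^ 2" "2 * a1 * T ^ 2 / L * (N f * L ^ 2) = 2 * L * (a1 * T) * N f * T"
        using N0 L0 by (simp_all add: power2_eq_square)
      then show ?thesis by (simp only: left_diff_distrib right_diff_distrib distrib_right mult.assoc) (simp add: mult_ac)
    qed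
    finally show ?thesis using N0 L0 by simp
  qed
  then have T': "T' = - T * (1 / f + 1 / (f - 1) - 2 / (f - 1/3) + 1 / (f - 1/9)) - 2 * a1 * T ^ 2 / L"
    unfolding nN by (simp add: algebra_simps)
  have bol: "L * a2 - 2 * a1 ^ 2 = 6 * c ^ 2 * (f ^ 2 * (f - 1) * (9 * f - 1)) * R f ^ 6"
    using hauptmodul_relations(3) [OF inv(1) [OF fU]] unfolding inv(2) [OF fU] assms(2) [OF fU, symmetric] c(2)
    by (simp add: L_def a1_def a2_def R_def)
  have T1: "c * (f * (f - 1) * (9 * f - 1)) * R f ^ 2 * T = 1" using \<tau>' [OF fU] by (simp add: T_def)
  \<comment> \<open>The extra factor \<open>(f - 1) * (9 * f - 1)\<close> completes the right-hand
    side to the square of the expression in \<open>T1\<close>, which equals 1, so \<open>c\<close>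
    and all powers of \<open>R f\<close> but the second disappear.\<close>
  have "(L * a2 - 2 * a1 ^ 2) * T ^ 2 * ((f - 1) * (9 * f - 1)) = 6 * R f ^ 2 * (c * (f * (f - 1) * (9 * f - 1)) * R f ^ 2 * T) ^ 2"
    unfolding bol by (simp add: power_mult_distrib eval_nat_numeral mult_ac)
  also have "\<dots> = 6 * R f ^ 2" unfolding T1 by simp
  finally have "(L * a2 - 2 * a1 ^ 2) * T ^ 2 = 6 * R f ^ 2 / ((f - 1) * (9 * f - 1))"
    using nz by (simp add: eq_divide_eq)
  moreover have "R f = 2 * L / (3 * f - 1)" unfolding L_R using nz by simp
  ultimately have key: "(L * a2 - 2 * a1 ^ 2) * T ^ 2 / L = 24 * L / ((3 * f - 1) ^ 2 * ((f - 1) * (9 * f - 1)))"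
    using L0 by (simp add: power_divide power_mult_distrib power2_eq_square mult_ac)
  have co: "8 / (27 * (f - 1) * (f - 1/9) * (f - 1/3)^2) * L = 24 * L / ((3 * f - 1) ^ 2 * ((f - 1) * (9 * f - 1)))"
  proof -
    have eq: "27 * (f - 1) * (f - 1/9) * (f - 1/3)^2 = (3 * f - 1) ^ 2 * ((f - 1) * (9 * f - 1)) / 3"
      by (simp add: power2_eq_square algebra_simps)
    show ?thesis unfolding eq by simp
  qed
  have "deriv (deriv l) f + (1 / f + 1 / (f - 1) - 2 / (f - 1/3) + 1 / (f - 1/9)) * deriv l f
      = (L * a2 - 2 * a1 ^ 2) * T ^ 2 / L"
    unfolding dl ddl T' using L0 by (simp add: diff_divide_distrib left_diff_distrib right_diff_distrib power2_eq_square mult_ac)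
  then show "deriv (deriv l) f + (1 / f + 1 / (f - 1) - 2 / (f - 1/3) + 1 / (f - 1/9)) * deriv l f
       - 8 / (27 * (f - 1) * (f - 1/9) * (f - 1/3)^2) * l f = 0"
    unfolding L_def [symmetric] co key by simp
qed

end
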